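(* Let $\nu>0$, $T>0$, and let $v:[0,T]\times\mathbb T\to\mathbb R^d$, together with a pressure $p:[0,T]\times\mathbb T\to\mathbb R$, be a regular deterministic solution of the Navier–Stokes equation $$\partial_t v+(v\cdot\nabla)v=\nu\Delta v-\nabla p,\qquad\operatorname{div}v(t,\cdot)=0,\qquad x\in\mathbb T,\ t\in[0,T],$$ and let $g_t$ be the associated stochastic flow $$dg_t(x)=\sqrt{2\nu}\,dW_t+v(t,g_t(x))\,dt,\qquad g_0(x)=x .$$ Let $\eta:[0,T]\times\mathbb T\to\mathbb R^d$ be smooth with $\eta(0,\cdot)=\eta(T,\cdot)=0$. If the Lagrangian $$L(g,p)=\frac12|D_tg_t(x)|^2+p(t,g_t(x))\big(\det\nabla g_t(x)-1\big)$$ is invariant under the transformation associated with $\eta$, with corresponding function $G:[0,T]\times\mathbb T\to\mathbb R$, then, with $\mathcal L_t=\frac{\partial}{\partial t}+(v\cdot\nabla)+\nu\Delta$, $$\int_{\mathbb T}\Big(\mathcal L_t\,(v\cdot\eta-G)\Big)(t,x)\,dx=0\qquad\text{for all }t\in[0,T].$$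
   Context: $\mathbb T$ is the $d$-dimensional flat torus, identified with $[0,2\pi]^d$ with periodic boundary conditions; $dx$ is Lebesgue measure. $(\Omega,\mathcal F,P)$ is a probability space with a filtration $(\mathcal P_t)$ satisfying the usual assumptions, and $E_t$ is conditional expectation given $\mathcal P_t$. $W_t$ is an $\mathbb R^d$-valued $\mathcal P_t$-adapted Wiener process and $dW_t$ is the Itô differential. The drift $v$ is assumed regular enough that $x\mapsto g_t(x)$ is a diffeomorphism and Itô's formula applies to $v(t,g_t(x))$ (e.g. $C^1$ in $t$ and $C^2$ in $x$, with continuous derivatives); $p$ is continuous with continuous $x$-derivatives. $\nabla g_t(x)$ is the Jacobian matrix of $x\mapsto g_t(x)$. Generalised derivative: for a $\mathbb T$-valued semimartingale $\xi_t(x)$ and $F$ on $[0,T]\times\mathbb T$, $$D_tF(t,\xi_t(x))=\lim_{\epsilon\to0^+}\frac1\epsilon E_t\big[F(t+\epsilon,\xi_{t+\epsilon}(x))-F(t,\xi_t(x))\big]$$ when the a.s. limit exists; $D_t\xi_t(x)$ (the case $F(t,x)=x$) is the drift of the semimartingale $\xi_t(x)$. In particular $D_tg_t(x)=v(t,g_t(x))$, and by Itô's formula $D_tF(t,g_t(x))=(\mathcal L_tF)(t,g_t(x))$ for $F$ of class $C^1$ in $t$ and $C^2$ in $x$. Invariance: the transformation associated with $\eta$ is $g_t(\cdot)\mapsto g^\alpha_t(\cdot)=g_t(\cdot)+\alpha\,\eta(t,g_t(\cdot))$, $\alpha\in\mathbb R$, and $L(g^\alpha,p)$ is given by the formula for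 $L$ with $g$ replaced by $g^\alpha$. $L$ is invariant under the transformation associated with $\eta$ if there exists a function $G:[0,T]\times\mathbb T\to\mathbb R$ ($C^1$ in $t$ and $C^2$ in $x$) such that for every $t$, $P$-almost surely, $$\frac{d}{d\alpha}\Big|_{\alpha=0}\int_{\mathbb T}L(g^\alpha_t,p)\,dx=\int_{\mathbb T}D_tG(t,g_t(x))\,dx .$$ *)

theory Defs
  imports "HOL-Probability.Probability"
begin

section \<open>Calculus on the flat torus\<close>

text \<open>
  The torus is rendered through its universal cover: functions on it are functions on
  \<open>real ^ 'd\<close> that are \<open>2 * pi\<close>-periodic in every coordinate, maps and flows of the torus are
  represented by their lifts to \<open>real ^ 'd\<close>, and integrals run over one fundamental cell.
  Functions on \<open>[0,T]\<close> times the torus are curried; their values at times outside \<open>{0..T}\<close>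
  are never used.
\<close>

definition torus_cell :: "(real ^ 'd) set" where
  "torus_cell = cbox 0 (\<chi> i. 2 * pi)"

definition periodic :: "real \<Rightarrow> (real \<Rightarrow> real ^ 'd \<Rightarrow> 'b) \<Rightarrow> bool" where
  "periodic T F \<longleftrightarrow> (\<forall>t\<in>{0..T}. \<forall>x i. F t (x + axis i (2 * pi)) = F t x)"

definition partial :: "'d \<Rightarrow> (real ^ 'd \<Rightarrow> 'b::real_normed_vector) \<Rightarrow> real ^ 'd \<Rightarrow> 'b" where
  "partial i f x = frechet_derivative f (at x) (axis i 1)"

definition gradient :: "(real ^ 'd \<Rightarrow> real) \<Rightarrow> real ^ 'd \<Rightarrow> real ^ 'd" where
  "gradient f x = (\<chi> i. partial i f x)"

definition divergence :: "(real ^ 'd \<Rightarrow> real ^ 'd) \<Rightarrow> real ^ 'd \<Rightarrow> real" where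
  "divergence u x = (\<Sum>i\<in>UNIV. partial i u x $ i)"

definition laplacian :: "(real ^ 'd \<Rightarrow> 'b::real_normed_vector) \<Rightarrow> real ^ 'd \<Rightarrow> 'b" where
  "laplacian f x = (\<Sum>i\<in>UNIV. partial i (partial i f) x)"

definition advect ::
  "(real ^ 'd \<Rightarrow> real ^ 'd) \<Rightarrow> (real ^ 'd \<Rightarrow> 'b::real_normed_vector) \<Rightarrow> real ^ 'd \<Rightarrow> 'b" where
  "advect u f x = (\<Sum>i\<in>UNIV. u x $ i *\<^sub>R partial i f x)"

text \<open>The time derivative is one-sided at \<open>0\<close> and at \<open>T\<close>.\<close>

definition time_deriv ::
  "real \<Rightarrow> (real \<Rightarrow> real ^ 'd \<Rightarrow> 'b::real_normed_vector) \<Rightarrow> real \<Rightarrow> real ^ 'd \<Rightarrow> 'b" where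
  "time_deriv T F t x = vector_derivative (\<lambda>s. F s x) (at t within {0..T})"

definition generator ::
  "real \<Rightarrow> real \<Rightarrow> (real \<Rightarrow> real ^ 'd \<Rightarrow> real ^ 'd) \<Rightarrow>
   (real \<Rightarrow> real ^ 'd \<Rightarrow> 'b::real_normed_vector) \<Rightarrow> real \<Rightarrow> real ^ 'd \<Rightarrow> 'b" where
  "generator T \<nu> v F t x =
     time_deriv T F t x + advect (v t) (F t) x + \<nu> *\<^sub>R laplacian (F t) x"

text \<open>
  Regularity on \<open>[0,T]\<close> times the torus: \<open>C01\<close> means continuous with continuous first
  space derivatives, \<open>C12\<close> means \<open>C\<^sup>1\<close> in time and \<open>C\<^sup>2\<close> in space; all derivatives
  are jointly continuous.
\<close>

definition C01 :: "real \<Rightarrow> (real \<Rightarrow> real ^ 'd \<Rightarrow> 'b::real_normed_vector) \<Rightarrow> bool" where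
  "C01 T F \<longleftrightarrow>
     continuous_on ({0..T} \<times> UNIV) (\<lambda>(t, x). F t x) \<and>
     (\<forall>t\<in>{0..T}. \<forall>x. F t differentiable (at x)) \<and>
     (\<forall>i. continuous_on ({0..T} \<times> UNIV) (\<lambda>(t, x). partial i (F t) x))"

definition C12 :: "real \<Rightarrow> (real \<Rightarrow> real ^ 'd \<Rightarrow> 'b::real_normed_vector) \<Rightarrow> bool" where
  "C12 T F \<longleftrightarrow>
     C01 T F \<and>
     (\<forall>i. C01 T (\<lambda>t. partial i (F t))) \<and>
     (\<forall>t\<in>{0..T}. \<forall>x. (\<lambda>s. F s x) differentiable (at t within {0..T})) \<and>
     continuous_on ({0..T} \<times> UNIV) (\<lambda>(t, x). time_deriv T F t x)"

text \<open>\<open>C\<^sup>k\<close> and smooth functions on a set such as \<open>{0..T} \<times> UNIV\<close>, with derivatives taken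
  within the set; there these are unique, as the set is convex with nonempty interior.\<close>

primrec Ck_on ::
  "nat \<Rightarrow> 'a::euclidean_space set \<Rightarrow> ('a \<Rightarrow> 'b::real_normed_vector) \<Rightarrow> bool" where
  "Ck_on 0 S f \<longleftrightarrow> continuous_on S f"
| "Ck_on (Suc k) S f \<longleftrightarrow>
     (\<exists>f'. (\<forall>z\<in>S. (f has_derivative f' z) (at z within S)) \<and>
           (\<forall>b\<in>Basis. Ck_on k S (\<lambda>z. f' z b)))"

definition smooth_on :: "'a::euclidean_space set \<Rightarrow> ('a \<Rightarrow> 'b::real_normed_vector) \<Rightarrow> bool" where
  "smooth_on S f \<longleftrightarrow> (\<forall>k. Ck_on k S f)"

definition C1_diffeomorphism :: "(real ^ 'd \<Rightarrow> real ^ 'd) \<Rightarrow> bool" where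
  "C1_diffeomorphism f \<longleftrightarrow>
     bij f \<and>
     (\<forall>h\<in>{f, inv f}. (\<forall>x. h differentiable (at x)) \<and> (\<forall>i. continuous_on UNIV (partial i h)))"

definition navier_stokes_solution ::
  "real \<Rightarrow> real \<Rightarrow> (real \<Rightarrow> real ^ 'd \<Rightarrow> real ^ 'd) \<Rightarrow> (real \<Rightarrow> real ^ 'd \<Rightarrow> real) \<Rightarrow> bool" where
  "navier_stokes_solution T \<nu> v p \<longleftrightarrow>
     periodic T v \<and> C12 T v \<and> periodic T p \<and> C01 T p \<and>
     (\<forall>t\<in>{0..T}. \<forall>x.
        time_deriv T v t x + advect (v t) (v t) x
          = \<nu> *\<^sub>R laplacian (v t) x - gradient (p t) x \<and>
        divergence (v t) x = 0)"


section \<open>Wiener process and stochastic flow\<close>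

text \<open>
  A filtration is indexed by \<open>real\<close> to match the library locale; only times \<open>t \<ge> 0\<close> matter.
\<close>

definition usual_filtration :: "'w measure \<Rightarrow> (real \<Rightarrow> 'w measure) \<Rightarrow> bool" where
  "usual_filtration M P \<longleftrightarrow>
     filtration (space M) P \<and>
     (\<forall>t\<ge>0. subalgebra M (P t)) \<and>
     (\<forall>N\<in>null_sets M. \<forall>A. A \<subseteq> N \<longrightarrow> A \<in> sets (P 0)) \<and>
     (\<forall>t\<ge>0. sets (P t) = (\<Inter>u\<in>{t<..}. sets (P u)))"

text \<open>A standard Wiener process relative to the filtration: the increment after time \<open>s\<close> is
  independent of the whole of \<open>P s\<close>, not merely of the past of \<open>W\<close>.\<close>

definition wiener_process ::
  "'w measure \<Rightarrow> (real \<Rightarrow> 'w measure) \<Rightarrow> (real \<Rightarrow> 'w \<Rightarrow> real ^ 'd) \<Rightarrow> bool" where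
  "wiener_process M P W \<longleftrightarrow>
     (\<forall>t\<ge>0. W t \<in> borel_measurable (P t)) \<and>
     (AE \<omega> in M. W 0 \<omega> = 0) \<and>
     (AE \<omega> in M. continuous_on {0..} (\<lambda>t. W t \<omega>)) \<and>
     (\<forall>s t. 0 \<le> s \<longrightarrow> s < t \<longrightarrow>
        (\<forall>i. distributed M lborel (\<lambda>\<omega>. (W t \<omega> - W s \<omega>) $ i) (normal_density 0 (sqrt (t - s)))) \<and>
        prob_space.indep_vars M (\<lambda>_. borel) (\<lambda>i \<omega>. (W t \<omega> - W s \<omega>) $ i) UNIV \<and>
        prob_space.indep_set M (sets (P s))
          (sets (vimage_algebra (space M) (\<lambda>\<omega>. W t \<omega> - W s \<omega>) borel)))"

text \<open>
  As the noise is additive, \<open>dg = sqrt (2 * \<nu>) dW + v(t,g) dt\<close>, \<open>g\<^sub>0(x) = x\<close>, is the pathwise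
  integral equation below and no stochastic integral is needed. That almost every path
  consists of diffeomorphisms is a standing assumption on the flow. It is stated for the lift
  \<open>g t\<close> of the torus flow.
\<close>

definition stochastic_flow ::
  "'w measure \<Rightarrow> (real \<Rightarrow> 'w measure) \<Rightarrow> real \<Rightarrow> real \<Rightarrow> (real \<Rightarrow> real ^ 'd \<Rightarrow> real ^ 'd) \<Rightarrow>
   (real \<Rightarrow> 'w \<Rightarrow> real ^ 'd) \<Rightarrow> (real \<Rightarrow> real ^ 'd \<Rightarrow> 'w \<Rightarrow> real ^ 'd) \<Rightarrow> bool" where
  "stochastic_flow M P T \<nu> v W g \<longleftrightarrow>
     (\<forall>t\<in>{0..T}. \<forall>x. g t x \<in> borel_measurable (P t)) \<and>
     (AE \<omega> in M. \<forall>t\<in>{0..T}. \<forall>x.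
        (\<lambda>s. v s (g s x \<omega>)) integrable_on {0..t} \<and>
        g t x \<omega> = x + sqrt (2 * \<nu>) *\<^sub>R W t \<omega> + integral {0..t} (\<lambda>s. v s (g s x \<omega>))) \<and>
     (AE \<omega> in M. \<forall>t\<in>{0..T}. C1_diffeomorphism (\<lambda>x. g t x \<omega>))"


section \<open>Generalised derivative and invariance of the Lagrangian\<close>

definition cond_exp :: "'w measure \<Rightarrow> 'w measure \<Rightarrow> ('w \<Rightarrow> 'b::euclidean_space) \<Rightarrow> 'w \<Rightarrow> 'b" where
  "cond_exp M F X \<omega> = (\<Sum>b\<in>Basis. real_cond_exp M F (\<lambda>\<omega>. X \<omega> \<bullet> b) \<omega> *\<^sub>R b)"

text \<open>
  \<open>has_gen_deriv M P T t X D\<close>: the generalised derivative \<open>D\<^sub>t X\<close> of the process \<open>X\<close> at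
  time \<open>t\<close> exists and is (a version of) the random variable \<open>D\<close>. For each increment
  \<open>\<epsilon>\<close>, a conditional expectation is determined only up to a null set depending on \<open>\<epsilon>\<close>, so
  for a continuum of \<open>\<epsilon>\<close> the phrase ``almost sure limit'' would depend on the chosen versions.
  Taking the limit along every sequence of positive \<open>\<epsilon>\<^sub>n\<close> that tends to \<open>0\<close> makes the
  notion independent of versions. For the flow itself, \<open>X\<close> is the lifted process.
\<close>

definition has_gen_deriv ::
  "'w measure \<Rightarrow> (real \<Rightarrow> 'w measure) \<Rightarrow> real \<Rightarrow> real \<Rightarrow>
   (real \<Rightarrow> 'w \<Rightarrow> 'b::euclidean_space) \<Rightarrow> ('w \<Rightarrow> 'b) \<Rightarrow> bool" where
  "has_gen_deriv M P T t X D \<longleftrightarrow>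
     (\<forall>s\<in>{t<..T}. integrable M (\<lambda>\<omega>. X s \<omega> - X t \<omega>)) \<and>
     (\<forall>\<epsilon> :: nat \<Rightarrow> real. (\<forall>n. 0 < \<epsilon> n \<and> t + \<epsilon> n \<le> T) \<longrightarrow> \<epsilon> \<longlonglongrightarrow> 0 \<longrightarrow>
        (AE \<omega> in M. (\<lambda>n. cond_exp M (P t) (\<lambda>\<omega>. X (t + \<epsilon> n) \<omega> - X t \<omega>) \<omega> /\<^sub>R \<epsilon> n)
                       \<longlonglongrightarrow> D \<omega>))"

definition transformed_flow ::
  "(real \<Rightarrow> real ^ 'd \<Rightarrow> real ^ 'd) \<Rightarrow> real \<Rightarrow> (real \<Rightarrow> real ^ 'd \<Rightarrow> 'w \<Rightarrow> real ^ 'd) \<Rightarrow>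
   real \<Rightarrow> real ^ 'd \<Rightarrow> 'w \<Rightarrow> real ^ 'd" where
  "transformed_flow \<eta> \<alpha> g t x \<omega> = g t x \<omega> + \<alpha> *\<^sub>R \<eta> t (g t x \<omega>)"

text \<open>The integrand \<open>L(g,p)\<close> at time \<open>t\<close> and point \<open>x\<close> for a fixed path; \<open>u\<close> is the field
  \<open>x \<mapsto> D\<^sub>t g\<^sub>t(x)\<close> and \<open>h\<close> is the map \<open>x \<mapsto> g\<^sub>t(x)\<close>.\<close>

definition lagrangian ::
  "(real \<Rightarrow> real ^ 'd \<Rightarrow> real) \<Rightarrow> real \<Rightarrow> (real ^ 'd \<Rightarrow> real ^ 'd) \<Rightarrow> (real ^ 'd \<Rightarrow> real ^ 'd) \<Rightarrow>
   real ^ 'd \<Rightarrow> real" where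
  "lagrangian p t u h x =
     (norm (u x))\<^sup>2 / 2 + p t (h x) * (det (jacobian h (at x)) - 1)"

text \<open>
  Each generalised derivative \<open>D\<^sub>t g\<^sup>\<alpha>\<^sub>t(x)\<close>, \<open>D\<^sub>t G(t,g\<^sub>t(x))\<close> is defined up to a null set
  depending on \<open>\<alpha>\<close> and \<open>x\<close>. To integrate in \<open>x\<close> and differentiate in \<open>\<alpha>\<close> for a fixed path,
  the versions \<open>U\<close>, \<open>K\<close> that are continuous in these parameters are used; continuity determines
  them uniquely up to one null set. Time \<open>T\<close> is excluded, as \<open>D\<^sub>t\<close> looks beyond \<open>t\<close>.
\<close>

definition lagrangian_invariant ::
  "'w measure \<Rightarrow> (real \<Rightarrow> 'w measure) \<Rightarrow> real \<Rightarrow> (real \<Rightarrow> real ^ 'd \<Rightarrow> 'w \<Rightarrow> real ^ 'd) \<Rightarrow>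
   (real \<Rightarrow> real ^ 'd \<Rightarrow> real) \<Rightarrow> (real \<Rightarrow> real ^ 'd \<Rightarrow> real ^ 'd) \<Rightarrow>
   (real \<Rightarrow> real ^ 'd \<Rightarrow> real) \<Rightarrow> bool" where
  "lagrangian_invariant M P T g p \<eta> G \<longleftrightarrow>
     periodic T G \<and> C12 T G \<and>
     (\<forall>t\<in>{0..<T}. \<exists>U K.
        (\<forall>\<alpha> x. has_gen_deriv M P T t (\<lambda>s. transformed_flow \<eta> \<alpha> g s x) (U \<alpha> x)) \<and>
        (AE \<omega> in M. continuous_on UNIV (\<lambda>(\<alpha>, x). U \<alpha> x \<omega>)) \<and>
        (\<forall>x. has_gen_deriv M P T t (\<lambda>s \<omega>. G s (g s x \<omega>)) (K x)) \<and>
        (AE \<omega> in M. continuous_on UNIV (\<lambda>x. K x \<omega>)) \<and>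
        (AE \<omega> in M.
           ((\<lambda>\<alpha>. LINT x:torus_cell|lborel.
                    lagrangian p t (\<lambda>y. U \<alpha> y \<omega>) (\<lambda>y. transformed_flow \<eta> \<alpha> g t y \<omega>) x)
            has_real_derivative (LINT x:torus_cell|lborel. K x \<omega>)) (at 0)))"

end

theory Submission
  imports Defs
begin

text \<open>
  The theorem is Noether's argument carried out for a stochastic flow, at one time \<open>t < T\<close> at a
  time. Write \<open>L\<close> for the generator \<open>\<partial>\<^sub>t + (v \<cdot> \<nabla>) + \<nu> \<Delta>\<close>.

  The generalised derivative turns composition with the flow into the generator: \<open>F(s, g\<^sub>s(x))\<close>
  has the derivative \<open>(L F)(t, g\<^sub>t(x))\<close> (\<open>gen_deriv_eq_generator\<close>). So the transformed flow has
  velocity \<open>v + \<alpha> L \<eta>\<close> along the flow (\<open>transformed_gen_deriv\<close>), and \<open>G\<close> contributes \<open>L G\<close>. As the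
  noise is additive, it cancels in the difference of two trajectories. Hence the Jacobian matrix of
  \<open>g\<^sub>t\<close> solves, path by path, a linear equation whose coefficient has trace \<open>div v = 0\<close>, and
  Liouville's formula gives \<open>det (\<nabla> g\<^sub>t) = 1\<close> (\<open>det_flow\<close>). Integrals over the torus of functions of
  \<open>g\<^sub>t(x)\<close> are therefore integrals of the same functions of \<open>y = g\<^sub>t(x)\<close> (\<open>volume_preserving\<close>). The
  integrated Lagrangian of the transformed flow becomes the deterministic integral of
  \<open>|v + \<alpha> L \<eta>|\<^sup>2 / 2 + p(y + \<alpha> \<eta>(y)) (det (I + \<alpha> \<nabla> \<eta>) - 1)\<close>, whose derivative at \<open>\<alpha> = 0\<close> is the
  integral of \<open>v \<cdot> L \<eta> + p div \<eta>\<close> (\<open>integral_variation\<close>). Invariance says that this equals the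
  integral of \<open>L G\<close> (\<open>noether_identity\<close>).

  On the other side, the product rule and the Navier-Stokes equation give
  \<open>L (v \<cdot> \<eta>) = v \<cdot> L \<eta> + p div \<eta>\<close> up to space derivatives of periodic functions, which integrate to
  zero (\<open>integral_generator_inner\<close>). Subtracting gives the conservation law for \<open>t < T\<close>, and it extends
  to \<open>t = T\<close> because the integral is continuous in \<open>t\<close>.

  Two ingredients need an argument of their own. The generalised derivative is a limit along every
  sequence of time steps, so one sequence identifies it. Along that sequence the second-order
  expansion of \<open>F\<close> splits the increment into the step size times \<open>L F\<close>, a part of conditional mean
  zero, and a remainder that is small in \<open>L\<^sup>1\<close> compared with the step size (\<open>expansion_remainder\<close>).
  That the integral over the cell is invariant under a volume-preserving diffeomorphism of the torus
  is shown on the universal cover: such a map carries the cell to another fundamental domain of the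
  period lattice, and periodic functions have the same integral over all of these
  (\<open>nn_integral_fundamental\<close>).
\<close>

section \<open>Fundamental domains of the period lattice\<close>

definition lattice_vec :: "('d \<Rightarrow> int) \<Rightarrow> real ^ 'd" where
  "lattice_vec k = (\<chi> i. 2 * pi * of_int (k i))"

lemma lattice_vec_axis: "lattice_vec k = (\<Sum>i\<in>UNIV. axis i (2 * pi * of_int (k i)))"
  by (simp add: lattice_vec_def vec_eq_iff axis_def if_distrib cong: if_cong)

lemma lattice_vec_uminus: "lattice_vec (\<lambda>i. - k i) = - lattice_vec k"
  by (simp add: lattice_vec_def vec_eq_iff)

lemma periodic_lattice_vec:
  fixes f :: "real ^ 'd \<Rightarrow> 'b"
  assumes per: "\<And>x i. f (x + axis i (2 * pi)) = f x"
  shows "f (x + lattice_vec k) = f x"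
proof -
  have nat: "f (x + axis i (2 * pi * real n)) = f x" for x i n
  proof (induction n)
    case (Suc n)
    have "x + axis i (2 * pi * real (Suc n)) = (x + axis i (2 * pi * real n)) + axis i (2 * pi)"
      by (simp add: vec_eq_iff axis_def algebra_simps)
    then show ?case using per[of "x + axis i (2 * pi * real n)" i] Suc by argo
  next
    case 0
    have "x + axis i (2 * pi * real 0) = x" by (simp add: vec_eq_iff axis_def)
    then show ?case by (simp only:)
  qed
  have int: "f (x + axis i (2 * pi * of_int n)) = f x" for x i n
  proof (cases "n \<ge> 0")
    case True
    then show ?thesis using nat[of x i "nat n"] by simp
  next
    case False
    have "x + axis i (2 * pi * of_int n) + axis i (2 * pi * real (nat (- n))) = x"
      using False by (simp add: vec_eq_iff axis_def algebra_simps)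
    then show ?thesis using nat[of "x + axis i (2 * pi * of_int n)" i "nat (- n)"] by (simp only:)
  qed
  have "f (x + (\<Sum>i\<in>S. axis i (2 * pi * of_int (k i)))) = f x" if "finite S" for S
    using that
  proof (induction S)
    case (insert a S)
    have "x + (\<Sum>i\<in>insert a S. axis i (2 * pi * of_int (k i)))
      = (x + (\<Sum>i\<in>S. axis i (2 * pi * of_int (k i)))) + axis a (2 * pi * of_int (k a))"
      using insert by (simp add: algebra_simps)
    then show ?case using int insert.IH by (simp only:)
  qed simp
  then show ?thesis by (simp add: lattice_vec_axis)
qed

lemma equivariant_lattice_vec:
  fixes f :: "real ^ 'd \<Rightarrow> real ^ 'd"
  assumes "\<And>x i. f (x + axis i (2 * pi)) = f x + axis i (2 * pi)"
  shows "f (x + lattice_vec k) = f x + lattice_vec k"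
  using periodic_lattice_vec[of "\<lambda>x. f x - x" x k] assms by (simp add: algebra_simps)

definition fundamental :: "(real ^ 'd) set \<Rightarrow> bool" where
  "fundamental A \<longleftrightarrow> A \<in> sets borel \<and> (\<forall>x. \<exists>!k. x + lattice_vec k \<in> A)"

lemma nn_integral_translate:
  fixes f :: "'a::euclidean_space \<Rightarrow> ennreal"
  assumes [measurable]: "f \<in> borel_measurable borel"
  shows "(\<integral>\<^sup>+x. f (x + c) \<partial>lborel) = (\<integral>\<^sup>+x. f x \<partial>lborel)"
proof -
  have "(\<integral>\<^sup>+x. f x \<partial>lborel) = (\<integral>\<^sup>+x. f x \<partial>distr lborel borel ((+) c))"
    by (simp add: lborel_distr_plus)
  also have "\<dots> = (\<integral>\<^sup>+x. f (x + c) \<partial>lborel)"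
    by (subst nn_integral_distr) (auto simp: add.commute)
  finally show ?thesis by simp
qed

lemma nn_integral_indicator_unique:
  assumes "\<exists>!k. P k"
  shows "(\<integral>\<^sup>+k. indicator {k. P k} k \<partial>count_space UNIV) = 1"
proof -
  from assms obtain k where "{k. P k} = {k}" by blast
  then show ?thesis by (simp add: one_ennreal_def[symmetric])
qed

text \<open>
  As \<open>B\<close> contains exactly one lattice translate of each point, the indicators of its translates sum
  to \<open>1\<close>. Inserting this sum into the integral over \<open>A\<close>, translating each summand and summing the
  indicators of the translates of \<open>A\<close> gives the integral over \<open>B\<close>.
\<close>

lemma nn_integral_fundamental:
  fixes f :: "real ^ 'd \<Rightarrow> ennreal"
  assumes A: "fundamental A" and B: "fundamental B"
    and f[measurable]: "f \<in> borel_measurable borel" and per: "\<And>x k. f (x + lattice_vec k) = f x"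
  shows "(\<integral>\<^sup>+x. indicator A x * f x \<partial>lborel) = (\<integral>\<^sup>+x. indicator B x * f x \<partial>lborel)"
proof -
  have [measurable]: "A \<in> sets borel" "B \<in> sets borel"
    using A B by (auto simp: fundamental_def)
  have uA: "(\<integral>\<^sup>+k. indicator A (x - lattice_vec k) \<partial>count_space UNIV) = (1 :: ennreal)" for x
  proof -
    have "\<exists>!k. x + lattice_vec (\<lambda>i. - k i) \<in> A"
    proof -
      from A obtain k where k: "x + lattice_vec k \<in> A" "\<And>l. x + lattice_vec l \<in> A \<Longrightarrow> l = k"
        unfolding fundamental_def by metis
      show ?thesis
      proof (rule ex1I[of _ "\<lambda>i. - k i"])
        fix l assume "x + lattice_vec (\<lambda>i. - l i) \<in> A"
        then have "(\<lambda>i. - l i) = k" by (rule k(2))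
        then show "l = (\<lambda>i. - k i)" by auto
      qed (use k(1) in simp)
    qed
    from nn_integral_indicator_unique[OF this] show ?thesis
      by (simp add: lattice_vec_uminus indicator_def)
  qed
  have uB: "(\<integral>\<^sup>+k. indicator B (x + lattice_vec k) \<partial>count_space UNIV) = (1 :: ennreal)" for x
    using nn_integral_indicator_unique[of "\<lambda>k. x + lattice_vec k \<in> B"] B
    by (simp add: fundamental_def indicator_def)
  have cnt: "countable (UNIV :: ('d \<Rightarrow> int) set)" by simp
  have "(\<integral>\<^sup>+x. indicator A x * f x \<partial>lborel)
      = (\<integral>\<^sup>+x. \<integral>\<^sup>+k. indicator A x * f x * indicator B (x + lattice_vec k) \<partial>count_space UNIV \<partial>lborel)"
    by (subst nn_integral_cmult) (simp_all add: uB)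
  also have "\<dots> = (\<integral>\<^sup>+k. \<integral>\<^sup>+x. indicator A x * f x * indicator B (x + lattice_vec k) \<partial>lborel \<partial>count_space UNIV)"
    by (rule nn_integral_count_space_nn_integral[OF cnt]) measurable
  also have "\<dots> = (\<integral>\<^sup>+k. \<integral>\<^sup>+x. indicator A (x - lattice_vec k) * f x * indicator B x \<partial>lborel \<partial>count_space UNIV)"
  proof (rule nn_integral_cong)
    fix k :: "'d \<Rightarrow> int"
    have "(\<integral>\<^sup>+x. indicator A (x - lattice_vec k) * f x * indicator B x \<partial>lborel)
      = (\<integral>\<^sup>+x. indicator A (x + lattice_vec k - lattice_vec k) * f (x + lattice_vec k)
          * indicator B (x + lattice_vec k) \<partial>lborel)"
      by (rule nn_integral_translate[symmetric]) measurable
    then show "(\<integral>\<^sup>+x. indicator A x * f x * indicator B (x + lattice_vec k) \<partial>lborel)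
      = (\<integral>\<^sup>+x. indicator A (x - lattice_vec k) * f x * indicator B x \<partial>lborel)"
      by (simp add: per)
  qed
  also have "\<dots> = (\<integral>\<^sup>+x. \<integral>\<^sup>+k. indicator A (x - lattice_vec k) * f x * indicator B x \<partial>count_space UNIV \<partial>lborel)"
    by (rule nn_integral_count_space_nn_integral[OF cnt, symmetric]) measurable
  also have "\<dots> = (\<integral>\<^sup>+x. \<integral>\<^sup>+k. (indicator B x * f x) * indicator A (x - lattice_vec k) \<partial>count_space UNIV \<partial>lborel)"
    by (simp add: mult_ac)
  also have "\<dots> = (\<integral>\<^sup>+x. indicator B x * f x \<partial>lborel)"
    by (subst nn_integral_cmult) (simp_all add: uA)
  finally show ?thesis .
qed

definition half_open_cell :: "(real ^ 'd) set" where
  "half_open_cell = {x. \<forall>i. 0 \<le> x $ i \<and> x $ i < 2 * pi}"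

lemma fundamental_half_open_cell: "fundamental (half_open_cell :: (real ^ 'd) set)"
  unfolding fundamental_def
proof (intro conjI allI)
  have "(\<lambda>x :: real ^ 'd. x $ i) \<in> borel_measurable borel" for i
    by (intro borel_measurable_continuous_onI continuous_intros)
  note [measurable] = this
  show "half_open_cell \<in> sets (borel :: (real ^ 'd) measure)"
    unfolding half_open_cell_def by measurable
  fix x :: "real ^ 'd"
  have iff: "(0 \<le> a + 2 * pi * of_int n \<and> a + 2 * pi * of_int n < 2 * pi) \<longleftrightarrow> n = - \<lfloor>a / (2 * pi)\<rfloor>"
    for a n
  proof -
    have "(0 \<le> a + 2 * pi * of_int n \<and> a + 2 * pi * of_int n < 2 * pi) \<longleftrightarrow>
      of_int (- n) \<le> a / (2 * pi) \<and> a / (2 * pi) < of_int (- n) + 1"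
      by (auto simp: field_simps)
    also have "\<dots> \<longleftrightarrow> \<lfloor>a / (2 * pi)\<rfloor> = - n"
      by (metis floor_eq_iff)
    finally show ?thesis by auto
  qed
  show "\<exists>!k. x + lattice_vec k \<in> half_open_cell"
    by (rule ex1I[of _ "\<lambda>i. - \<lfloor>x $ i / (2 * pi)\<rfloor>"])
       (auto simp: half_open_cell_def lattice_vec_def iff fun_eq_iff simp del: of_int_minus)
qed

lemma fundamental_vimage:
  fixes h :: "real ^ 'd \<Rightarrow> real ^ 'd"
  assumes "fundamental A" and [measurable]: "h \<in> borel_measurable borel"
    and "\<And>x k. h (x + lattice_vec k) = h x + lattice_vec k"
  shows "fundamental (h -` A)"
proof -
  have [measurable]: "A \<in> sets borel" using assms by (simp add: fundamental_def)
  have "h -` A \<in> sets borel"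
    using measurable_sets[OF assms(2), of A] by simp
  then show ?thesis using assms by (simp add: fundamental_def)
qed

lemma AE_half_open_cell:
  "AE x in lborel. indicator (torus_cell :: (real ^ 'd) set) x = (indicator half_open_cell x :: 'b::zero_neq_one)"
proof -
  let ?b = "(\<chi> i. 2 * pi) :: real ^ 'd"
  have "cbox 0 ?b - box 0 ?b \<in> null_sets (lebesgue :: (real ^ 'd) measure)"
    using negligible_frontier_interval[of "0 :: real ^ 'd" ?b] by (simp add: negligible_iff_null_sets)
  then have "cbox 0 ?b - box 0 ?b \<in> null_sets (lborel :: (real ^ 'd) measure)"
    using null_sets_completion_iff[of "cbox 0 ?b - box 0 ?b" "lborel :: (real ^ 'd) measure"] by simp
  then show ?thesis
  proof (rule AE_I')
    show "{x \<in> space lborel. \<not> indicator torus_cell x = (indicator half_open_cell x :: 'b)} \<subseteq> cbox 0 ?b - box 0 ?b"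
      by (auto simp: torus_cell_def half_open_cell_def mem_box_cart split: split_indicator_asm)
         (meson less_eq_real_def order.trans less_le_trans)+
  qed
qed

lemma nn_integral_torus_cell:
  fixes f :: "real ^ 'd \<Rightarrow> ennreal"
  shows "(\<integral>\<^sup>+x. indicator torus_cell x * f x \<partial>lborel) = (\<integral>\<^sup>+x. indicator half_open_cell x * f x \<partial>lborel)"
  using AE_half_open_cell[where 'b=ennreal] by (intro nn_integral_cong_AE) auto

lemma integral_torus_cell_nn:
  fixes f :: "real ^ 'd \<Rightarrow> real"
  assumes "continuous_on UNIV f"
  shows "(LINT x:torus_cell|lborel. f x) =
    enn2real (\<integral>\<^sup>+x. indicator torus_cell x * ennreal (f x) \<partial>lborel) -
    enn2real (\<integral>\<^sup>+x. indicator torus_cell x * ennreal (- f x) \<partial>lborel)"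
proof -
  have "integrable lborel (\<lambda>x. indicator torus_cell x *\<^sub>R f x)"
    using assms unfolding torus_cell_def
    by (intro borel_integrable_compact) (auto intro: continuous_on_subset)
  moreover have "ennreal (indicator torus_cell x *\<^sub>R f x) = indicator torus_cell x * ennreal (f x)"
    "ennreal (- (indicator torus_cell x *\<^sub>R f x)) = indicator torus_cell x * ennreal (- f x)" for x
    by (auto split: split_indicator)
  ultimately show ?thesis
    unfolding set_lebesgue_integral_def by (subst real_lebesgue_integral_def) simp_all
qed

text \<open>
  The map \<open>g\<close> is the lift of a measure-preserving homeomorphism of the torus. It carries the
  half-open cell to the preimage of the cell under \<open>h\<close>, which is again a fundamental domain.
\<close>

theorem integral_torus_cell_invariant:
  fixes f :: "real ^ 'd \<Rightarrow> real" and g h :: "real ^ 'd \<Rightarrow> real ^ 'd"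
  assumes f: "continuous_on UNIV f" and per: "\<And>x i. f (x + axis i (2 * pi)) = f x"
    and g: "continuous_on UNIV g" and h: "continuous_on UNIV h" and hg: "\<And>x. h (g x) = x"
    and gh: "\<And>x. g (h x) = x"
    and equi: "\<And>x i. g (x + axis i (2 * pi)) = g x + axis i (2 * pi)"
    and mp: "distr lborel borel g = lborel"
  shows "(LINT x:torus_cell|lborel. f (g x)) = (LINT x:torus_cell|lborel. f x)"
proof -
  have [measurable]: "f \<in> borel_measurable borel" "g \<in> borel_measurable borel" "h \<in> borel_measurable borel"
    using f g h by (auto intro: borel_measurable_continuous_onI)
  have equi_h: "h (x + lattice_vec k) = h x + lattice_vec k" for x k
    using equivariant_lattice_vec[OF equi, of "h x" k] hg gh by metis
  have fund: "fundamental (h -` half_open_cell)"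
    by (intro fundamental_vimage fundamental_half_open_cell equi_h) measurable
  have [measurable]: "half_open_cell \<in> sets (borel :: (real ^ 'd) measure)"
    using fundamental_half_open_cell[where 'd='d] unfolding fundamental_def by (rule conjunct1)
  have main: "(\<integral>\<^sup>+x. indicator torus_cell x * F (g x) \<partial>lborel) = (\<integral>\<^sup>+x. indicator torus_cell x * F x \<partial>lborel)"
    if [measurable]: "F \<in> borel_measurable borel" and F: "\<And>x i. F (x + axis i (2 * pi)) = F x"
    for F :: "real ^ 'd \<Rightarrow> ennreal"
  proof -
    have "(\<integral>\<^sup>+x. indicator torus_cell x * F (g x) \<partial>lborel)
      = (\<integral>\<^sup>+x. indicator half_open_cell (h (g x)) * F (g x) \<partial>lborel)"
      by (simp add: nn_integral_torus_cell hg)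
    also have "\<dots> = (\<integral>\<^sup>+x. indicator half_open_cell (h x) * F x \<partial>distr lborel borel g)"
      by (subst nn_integral_distr) measurable
    also have "\<dots> = (\<integral>\<^sup>+x. indicator (h -` half_open_cell) x * F x \<partial>lborel)"
      by (simp add: mp indicator_vimage[symmetric] indicator_def)
    also have "\<dots> = (\<integral>\<^sup>+x. indicator half_open_cell x * F x \<partial>lborel)"
      by (rule nn_integral_fundamental[OF fund fundamental_half_open_cell])
         (auto intro: periodic_lattice_vec F)
    finally show ?thesis by (simp add: nn_integral_torus_cell)
  qed
  have "continuous_on UNIV (\<lambda>x. f (g x))"
    by (rule continuous_on_compose2[OF f g]) simp
  then show ?thesis
    using main[of "\<lambda>x. ennreal (f x)"] main[of "\<lambda>x. ennreal (- f x)"] per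
    by (simp add: integral_torus_cell_nn f)
qed

section \<open>Volume-preserving diffeomorphisms\<close>

text \<open>
  The change of variables formula is a statement about vectors whose index type is well-ordered.
  Enumerating the indices of a finite type orders a copy of it, and relabelling the coordinates by
  this copy changes neither Lebesgue measure nor determinants.
\<close>

typedef 'a ordered_copy = "UNIV :: 'a set" morphisms of_copy to_copy ..

instance ordered_copy :: (finite) finite
proof
  have "(UNIV :: 'a ordered_copy set) = range to_copy"
    using of_copy_inverse by (intro set_eqI) (auto intro: range_eqI[OF sym])
  also have "finite \<dots>" by simp
  finally show "finite (UNIV :: 'a ordered_copy set)" .
qed

definition enum_copy :: "'a::finite ordered_copy \<Rightarrow> nat" where
  "enum_copy = to_nat_on UNIV"

lemma inj_enum_copy: "inj enum_copy"
  unfolding enum_copy_def by (intro inj_on_to_nat_on countable_finite finite)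

instantiation ordered_copy :: (finite) wellorder
begin

definition less_eq_ordered_copy :: "'a ordered_copy \<Rightarrow> 'a ordered_copy \<Rightarrow> bool" where
  "less_eq_ordered_copy a b \<longleftrightarrow> enum_copy a \<le> enum_copy b"

definition less_ordered_copy :: "'a ordered_copy \<Rightarrow> 'a ordered_copy \<Rightarrow> bool" where
  "less_ordered_copy a b \<longleftrightarrow> enum_copy a < enum_copy b"

instance
proof
  fix P :: "'a ordered_copy \<Rightarrow> bool" and a
  assume step: "\<And>x. (\<And>y. y < x \<Longrightarrow> P y) \<Longrightarrow> P x"
  show "P a"
  proof (induction a rule: measure_induct_rule[of enum_copy])
    case (less x)
    show ?case by (rule step) (simp add: less less_ordered_copy_def)
  qed
next
  fix a b :: "'a ordered_copy"
  assume "a \<le> b" "b \<le> a"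
  then have "enum_copy a = enum_copy b" by (simp add: less_eq_ordered_copy_def)
  then show "a = b" by (rule injD[OF inj_enum_copy])
qed (auto simp: less_eq_ordered_copy_def less_ordered_copy_def)

end

lemma bij_of_copy: "bij (of_copy :: 'd ordered_copy \<Rightarrow> 'd)"
  by (metis to_copy_inverse of_copy_inverse UNIV_I bij_betw_byWitness subset_UNIV)

lemma copy_inverse[simp]: "to_copy (of_copy a) = a" "of_copy (to_copy b) = b"
  by (auto simp: of_copy_inverse to_copy_inverse)

definition relabel :: "real ^ 'd \<Rightarrow> real ^ 'd ordered_copy" where
  "relabel x = (\<chi> j. x $ of_copy j)"

definition unlabel :: "real ^ 'd ordered_copy \<Rightarrow> real ^ 'd" where
  "unlabel y = (\<chi> i. y $ to_copy i)"

lemma relabel_unlabel[simp]: "relabel (unlabel y) = y" "unlabel (relabel x) = x"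
  by (simp_all add: relabel_def unlabel_def vec_eq_iff)

lemma linear_relabel: "linear relabel" "linear unlabel"
  by (auto intro!: linearI simp: relabel_def unlabel_def vec_eq_iff)

lemmas bounded_linear_relabel = linear_conv_bounded_linear[THEN iffD1, OF linear_relabel(1)]
  linear_conv_bounded_linear[THEN iffD1, OF linear_relabel(2)]

lemma continuous_relabel: "continuous_on UNIV relabel" "continuous_on UNIV unlabel"
  using bounded_linear_relabel by (auto intro: linear_continuous_on)

lemma emeasure_lborel_box_cart:
  fixes l u :: "real ^ 'n"
  assumes "\<And>i. l $ i \<le> u $ i"
  shows "emeasure lborel (box l u) = (\<Prod>i\<in>UNIV. u $ i - l $ i)"
proof -
  have inj: "inj (\<lambda>i :: 'n. axis i (1::real))" by (auto simp: inj_on_def axis_eq_axis)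
  have B: "(Basis :: (real ^ 'n) set) = range (\<lambda>i. axis i 1)"
    by (auto simp: Basis_vec_def)
  have "emeasure lborel (box l u) = (\<Prod>b\<in>Basis. (u - l) \<bullet> b)"
    using assms by (intro emeasure_lborel_box) (auto simp: B inner_axis)
  also have "(\<Prod>b\<in>Basis. (u - l) \<bullet> b) = (\<Prod>i\<in>UNIV. u $ i - l $ i)"
    unfolding B using inj by (simp add: prod.reindex inner_axis)
  finally show ?thesis .
qed

lemma distr_unlabel: "distr lborel borel unlabel = (lborel :: (real ^ 'd) measure)"
proof (rule lborel_eqI[symmetric])
  fix l u :: "real ^ 'd"
  assume *: "\<And>b. b \<in> Basis \<Longrightarrow> l \<bullet> b \<le> u \<bullet> b"
  have le: "l $ i \<le> u $ i" for i
    using *[of "axis i 1"] by (simp add: inner_axis)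
  have [measurable]: "unlabel \<in> borel_measurable borel"
    using continuous_relabel by (intro borel_measurable_continuous_onI)
  have vi: "unlabel -` box l u = box (relabel l) (relabel u)"
  proof (intro set_eqI iffI)
    fix y assume "y \<in> unlabel -` box l u"
    then have "l $ i < y $ to_copy i \<and> y $ to_copy i < u $ i" for i
      by (auto simp: mem_box_cart unlabel_def)
    from this[of "of_copy j" for j] show "y \<in> box (relabel l) (relabel u)"
      by (auto simp: mem_box_cart relabel_def)
  next
    fix y assume "y \<in> box (relabel l) (relabel u)"
    then have "l $ of_copy j < y $ j \<and> y $ j < u $ of_copy j" for j
      by (auto simp: mem_box_cart relabel_def)
    from this[of "to_copy i" for i] show "y \<in> unlabel -` box l u"
      by (auto simp: mem_box_cart unlabel_def)
  qed
  have "emeasure (distr lborel borel unlabel) (box l u) = emeasure lborel (box (relabel l) (relabel u))"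
    by (subst emeasure_distr) (auto simp: vi)
  also have "\<dots> = (\<Prod>j\<in>UNIV. u $ of_copy j - l $ of_copy j)"
    by (subst emeasure_lborel_box_cart) (auto simp: relabel_def le)
  also have "(\<Prod>j\<in>UNIV. u $ of_copy j - l $ of_copy j) = (\<Prod>i\<in>UNIV. u $ i - l $ i)"
    by (rule prod.reindex_bij_betw[OF bij_of_copy])
  also have "ennreal \<dots> = emeasure lborel (box l u)"
    by (rule emeasure_lborel_box_cart[OF le, symmetric])
  also have "\<dots> = (\<Prod>b\<in>Basis. (u - l) \<bullet> b)"
    using * by (rule emeasure_lborel_box)
  finally show "emeasure (distr lborel borel unlabel) (box l u) = (\<Prod>b\<in>Basis. (u - l) \<bullet> b)" .
qed simp

lemma swapidseq_relabel:
  assumes "swapidseq n p"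
  shows "swapidseq n (\<lambda>j. to_copy (p (of_copy j)))"
  using assms
proof induction
  case id
  have eq: "(\<lambda>j :: 'a ordered_copy. to_copy (id (of_copy j))) = id"
    by (simp add: fun_eq_iff)
  show ?case unfolding eq by (rule swapidseq.id)
next
  case (comp_Suc n p a b)
  have eq: "(\<lambda>j. to_copy ((Transposition.transpose a b \<circ> p) (of_copy j))) =
     Transposition.transpose (to_copy a) (to_copy b) \<circ> (\<lambda>j. to_copy (p (of_copy j)))"
    by (simp add: fun_eq_iff Transposition.transpose_def) (metis copy_inverse)
  have ne: "to_copy a \<noteq> to_copy b"
    using comp_Suc.hyps(2) by (metis copy_inverse(2))
  show ?case
    unfolding eq by (rule swapidseq.comp_Suc[OF comp_Suc.IH ne])
qed

text \<open>
  Conjugation maps a product of \<open>n\<close> transpositions to another such product, so it preserves parity.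
\<close>

lemma sign_relabel:
  assumes "p permutes (UNIV :: 'd::finite set)"
  shows "sign (\<lambda>j. to_copy (p (of_copy j))) = sign p"
proof -
  have "permutation p" unfolding permutation_permutes
    using assms by (intro exI[of _ UNIV]) simp
  then obtain n where n: "swapidseq n p" by (auto simp: permutation_def)
  from evenperm_unique[OF n refl] evenperm_unique[OF swapidseq_relabel[OF n] refl]
  show ?thesis by (simp add: sign_def)
qed

lemma det_relabel:
  fixes A :: "real ^ 'd ^ 'd"
  shows "det (\<chi> a b. A $ of_copy a $ of_copy b) = det A"
proof -
  define F :: "('d \<Rightarrow> 'd) \<Rightarrow> 'd ordered_copy \<Rightarrow> 'd ordered_copy" where
    "F p = (\<lambda>j. to_copy (p (of_copy j)))" for p
  have bijF: "bij_betw F {p. p permutes UNIV} {p. p permutes UNIV}"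
  proof (rule bij_betw_byWitness[of _ "\<lambda>q i. of_copy (q (to_copy i))"])
    have bR: "bij (of_copy :: 'd ordered_copy \<Rightarrow> 'd)" "bij (to_copy :: 'd \<Rightarrow> 'd ordered_copy)"
      using bij_of_copy by (auto intro: bij_betw_byWitness[of _ of_copy])
    show "F ` {p. p permutes UNIV} \<subseteq> {p. p permutes UNIV}"
    proof clarify
      fix p :: "'d \<Rightarrow> 'd" assume "p permutes UNIV"
      then have "bij (to_copy \<circ> (p \<circ> of_copy))"
        by (intro bij_comp bR permutes_bij)
      then show "F p permutes UNIV" by (intro bij_imp_permutes) (simp_all add: F_def o_def)
    qed
    show "(\<lambda>q i. of_copy (q (to_copy i))) ` {p. p permutes UNIV} \<subseteq> {p :: 'd \<Rightarrow> 'd. p permutes UNIV}"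
    proof clarify
      fix q :: "'d ordered_copy \<Rightarrow> 'd ordered_copy" assume "q permutes UNIV"
      then have "bij (of_copy \<circ> (q \<circ> to_copy))"
        by (intro bij_comp bR permutes_bij)
      then show "(\<lambda>i. of_copy (q (to_copy i))) permutes UNIV"
        by (intro bij_imp_permutes) (simp_all add: o_def)
    qed
  qed (auto simp: F_def)
  have "det (\<chi> a b. A $ of_copy a $ of_copy b)
      = (\<Sum>q | q permutes UNIV. of_int (sign q) * (\<Prod>j\<in>UNIV. A $ of_copy j $ of_copy (q j)))"
    by (simp add: det_def)
  also have "\<dots> = (\<Sum>p | p permutes UNIV. of_int (sign (F p)) * (\<Prod>j\<in>UNIV. A $ of_copy j $ of_copy (F p j)))"
    by (rule sum.reindex_bij_betw[OF bijF, symmetric])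
  also have "\<dots> = (\<Sum>p | p permutes UNIV. of_int (sign p) * (\<Prod>i\<in>UNIV. A $ i $ p i))"
  proof (rule sum.cong, simp, clarify)
    fix p :: "'d \<Rightarrow> 'd" assume p: "p permutes UNIV"
    have "(\<Prod>j\<in>UNIV. A $ of_copy j $ of_copy (F p j)) = (\<Prod>i\<in>UNIV. A $ i $ p i)"
      using prod.reindex_bij_betw[OF bij_of_copy, of "\<lambda>i. A $ i $ p i"] by (simp add: F_def)
    then show "real_of_int (sign (F p)) * (\<Prod>j\<in>UNIV. A $ of_copy j $ of_copy (F p j))
      = of_int (sign p) * (\<Prod>i\<in>UNIV. A $ i $ p i)"
      using sign_relabel[OF p] by (simp add: F_def)
  qed
  finally show ?thesis by (simp add: det_def)
qed

lemma distr_lborel_ordered: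
  fixes g :: "real ^ 'n::{finite,wellorder} \<Rightarrow> real ^ 'n::_"
  assumes der: "\<And>x. (g has_derivative g' x) (at x)" and det: "\<And>x. \<bar>det (matrix (g' x))\<bar> = 1"
    and "bij g"
  shows "distr lborel borel g = lborel"
proof (rule lborel_eqI[symmetric])
  fix l u :: "real ^ 'n::_"
  assume *: "\<And>b. b \<in> Basis \<Longrightarrow> l \<bullet> b \<le> u \<bullet> b"
  have "continuous_on UNIV g"
    by (metis continuous_at_imp_continuous_on der has_derivative_continuous)
  then have [measurable]: "g \<in> borel_measurable borel"
    by (rule borel_measurable_continuous_onI)
  define S where "S = g -` box l u"
  have S: "S \<in> sets borel"
    unfolding S_def using measurable_sets[of g borel borel "box l u"] by simp
  have img: "g ` S = box l u" unfolding S_def using \<open>bij g\<close> by (simp add: bij_is_surj surj_image_vimage_eq)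
  have "g ` S \<in> lmeasurable \<and> measure lebesgue (g ` S) = measure lebesgue (box l u)"
    unfolding img by simp
  then have "((\<lambda>x. \<bar>det (matrix (g' x))\<bar>) has_integral measure lebesgue (box l u)) S"
    by (subst (asm) has_measure_differentiable_image[where f'=g'])
       (use S \<open>bij g\<close> in \<open>auto intro: has_derivative_at_withinI der bij_is_inj inj_on_subset\<close>)
  then have "((\<lambda>x. 1) has_integral measure lebesgue (box l u)) S" by (simp add: det)
  then have S1: "(\<lambda>x. 1 :: real) integrable_on S" and "integral S (\<lambda>x. 1) = measure lebesgue (box l u)"
    by (auto simp: has_integral_iff)
  then have S2: "S \<in> lmeasurable" "measure lebesgue S = measure lebesgue (box l u)"
    by (auto simp: lmeasurable_iff_integrable_on lmeasure_integral)
  have "emeasure (distr lborel borel g) (box l u) = emeasure lborel S"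
    by (subst emeasure_distr) (auto simp: S_def)
  also have "\<dots> = emeasure lebesgue S" using S by simp
  also have "\<dots> = ennreal (measure lebesgue (box l u))"
    using emeasure_eq_measure2[OF S2(1)] S2(2) by simp
  also have "\<dots> = (\<Prod>b\<in>Basis. (u - l) \<bullet> b)"
    using * by simp
  finally show "emeasure (distr lborel borel g) (box l u) = (\<Prod>b\<in>Basis. (u - l) \<bullet> b)" .
qed simp

text \<open>
  The relabelled map satisfies the same hypotheses over a well-ordered index type, and relabelling
  preserves Lebesgue measure.
\<close>

lemma distr_lborel_volume_preserving:
  fixes g :: "real ^ 'd \<Rightarrow> real ^ 'd"
  assumes der: "\<And>x. (g has_derivative g' x) (at x)" and det: "\<And>x. \<bar>det (matrix (g' x))\<bar> = 1"
    and "bij g"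
  shows "distr lborel borel g = lborel"
proof -
  have "continuous_on UNIV g"
    by (metis continuous_at_imp_continuous_on der has_derivative_continuous)
  then have [measurable]: "g \<in> borel_measurable borel"
    by (rule borel_measurable_continuous_onI)
  have [measurable]: "(relabel :: real ^ 'd \<Rightarrow> _) \<in> borel_measurable borel"
     "(unlabel :: _ \<Rightarrow> real ^ 'd) \<in> borel_measurable borel"
    using continuous_relabel by (auto intro: borel_measurable_continuous_onI)
  define G where "G y = relabel (g (unlabel y))" for y
  define G' where "G' y h = relabel (g' (unlabel y) (unlabel h))" for y h
  have "(G has_derivative G' y) (at y)" for y
    unfolding G_def G'_def
    by (intro bounded_linear.has_derivative[OF bounded_linear_relabel(1)]
          has_derivative_compose[OF bounded_linear_imp_has_derivative[OF bounded_linear_relabel(2)] der])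
  moreover have "\<bar>det (matrix (G' y))\<bar> = 1" for y
  proof -
    have "unlabel (axis b 1) = axis (of_copy b) (1::real)" for b :: "'d ordered_copy"
      by (auto simp: unlabel_def axis_def vec_eq_iff)
    then have "matrix (G' y) = (\<chi> a b. matrix (g' (unlabel y)) $ of_copy a $ of_copy b)"
      unfolding matrix_def G'_def relabel_def by (simp only: vec_lambda_beta)
    then show ?thesis using det[of "unlabel y"] by (simp add: det_relabel)
  qed
  moreover have "bij G"
  proof (rule o_bij)
    show "(\<lambda>y. relabel (inv g (unlabel y))) \<circ> G = id" "G \<circ> (\<lambda>y. relabel (inv g (unlabel y))) = id"
      using \<open>bij g\<close> by (auto simp: G_def fun_eq_iff bij_is_inj bij_is_surj surj_f_inv_f)
  qed
  ultimately have G: "distr lborel borel G = lborel"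
    by (rule distr_lborel_ordered)
  then have [measurable]: "G \<in> borel_measurable borel"
    unfolding G_def by measurable
  have "distr lborel borel g = distr (distr lborel borel unlabel) borel g"
    by (simp only: distr_unlabel)
  also have "\<dots> = distr lborel borel (\<lambda>y. unlabel (G y))"
    by (subst distr_distr) (auto simp: o_def G_def)
  also have "\<dots> = distr (distr lborel borel G) borel unlabel"
    by (subst distr_distr) (auto simp: o_def)
  finally show ?thesis by (simp add: G distr_unlabel)
qed

section \<open>Derivatives of determinants\<close>

lemma has_field_derivative_det:
  fixes M :: "real \<Rightarrow> real ^ 'n ^ 'n" and M' :: "real ^ 'n ^ 'n"
  assumes "\<And>i j. ((\<lambda>t. M t $ i $ j) has_field_derivative M' $ i $ j) (at z)"
  shows "((\<lambda>t. det (M t)) has_field_derivative (\<Sum>i\<in>UNIV. det (\<chi> k. if k = i then M' $ i else M z $ k))) (at z)"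
proof -
  have "((\<lambda>t. det (M t)) has_field_derivative
     (\<Sum>p | p permutes UNIV. of_int (sign p) * (\<Sum>i\<in>UNIV. M' $ i $ p i * (\<Prod>k\<in>UNIV - {i}. M z $ k $ p k)))) (at z)"
    unfolding det_def by (intro DERIV_sum DERIV_cmult has_field_derivative_prod assms)
  also have "(\<Sum>p | p permutes UNIV. of_int (sign p) * (\<Sum>i\<in>UNIV. M' $ i $ p i * (\<Prod>k\<in>UNIV - {i}. M z $ k $ p k)))
    = (\<Sum>p | p permutes UNIV. \<Sum>i\<in>UNIV. of_int (sign p) * (\<Prod>k\<in>UNIV. (\<chi> k. if k = i then M' $ i else M z $ k) $ k $ p k))"
  proof (intro sum.cong refl)
    fix p :: "'n \<Rightarrow> 'n"
    have "(\<Prod>k\<in>UNIV. (\<chi> k. if k = i then M' $ i else M z $ k) $ k $ p k)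
        = M' $ i $ p i * (\<Prod>k\<in>UNIV - {i}. M z $ k $ p k)" for i
      by (subst prod.remove[of UNIV i]) (auto intro!: prod.cong)
    then show "of_int (sign p) * (\<Sum>i\<in>UNIV. M' $ i $ p i * (\<Prod>k\<in>UNIV - {i}. M z $ k $ p k))
      = (\<Sum>i\<in>UNIV. of_int (sign p) * (\<Prod>k\<in>UNIV. (\<chi> k. if k = i then M' $ i else M z $ k) $ k $ p k))"
      by (simp add: sum_distrib_left)
  qed
  also have "\<dots> = (\<Sum>i\<in>UNIV. det (\<chi> k. if k = i then M' $ i else M z $ k))"
    unfolding det_def by (rule sum.swap)
  finally show ?thesis .
qed

text \<open>
  Row \<open>i\<close> of \<open>B ** M\<close> is a combination of the rows of \<open>M\<close>. All of them except row \<open>i\<close> itself occur a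
  second time in the matrix, so only the coefficient \<open>B $ i $ i\<close> survives.
\<close>

lemma det_replace_row_product:
  fixes B M :: "real ^ 'n ^ 'n"
  shows "det (\<chi> k. if k = i then (B ** M) $ i else M $ k) = B $ i $ i * det M"
proof -
  have row: "(B ** M) $ i = (\<Sum>j\<in>UNIV. B $ i $ j *s M $ j)"
    by (simp add: vec_eq_iff matrix_matrix_mult_def)
  have "det (\<chi> k. if k = i then (B ** M) $ i else M $ k) =
    (\<Sum>j\<in>UNIV. det (\<chi> k. if k = i then B $ i $ j *s M $ j else M $ k))"
    unfolding row by (rule det_linear_row_sum) simp
  also have "\<dots> = (\<Sum>j\<in>UNIV. B $ i $ j * det (\<chi> k. if k = i then M $ j else M $ k))"
    by (simp add: det_row_mul)
  also have "\<dots> = (\<Sum>j\<in>UNIV. if j = i then B $ i $ j * det M else 0)"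
  proof (intro sum.cong refl)
    fix j
    have "(\<chi> k. if k = i then M $ i else M $ k) = M" by (simp add: vec_eq_iff)
    moreover have "det (\<chi> k. if k = i then M $ j else M $ k) = 0" if "j \<noteq> i"
      by (rule det_identical_rows[of i j]) (use that in \<open>auto simp: row_def vec_eq_iff\<close>)
    ultimately show "B $ i $ j * det (\<chi> k. if k = i then M $ j else M $ k) = (if j = i then B $ i $ j * det M else 0)"
      by auto
  qed
  finally show ?thesis by simp
qed

text \<open>
  Liouville's formula for a solution of \<open>M' = B M\<close>.
\<close>

lemma has_field_derivative_det_linear:
  fixes M :: "real \<Rightarrow> real ^ 'n ^ 'n" and B :: "real ^ 'n ^ 'n"
  assumes "\<And>i j. ((\<lambda>t. M t $ i $ j) has_field_derivative (B ** M z) $ i $ j) (at z)"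
  shows "((\<lambda>t. det (M t)) has_field_derivative trace B * det (M z)) (at z)"
  using has_field_derivative_det[OF assms]
  by (simp add: det_replace_row_product trace_def sum_distrib_right)

lemma abs_det_le:
  fixes A :: "real ^ 'n ^ 'n"
  assumes "\<And>i j. \<bar>A $ i $ j\<bar> \<le> K"
  shows "\<bar>det A\<bar> \<le> (\<Sum>p | p permutes (UNIV :: 'n set). K ^ CARD('n))"
  unfolding det_def
proof (rule order_trans[OF sum_abs sum_mono])
  fix p :: "'n \<Rightarrow> 'n"
  have "\<bar>of_int (sign p) * (\<Prod>i\<in>UNIV. A $ i $ p i)\<bar> = (\<Prod>i\<in>UNIV. \<bar>A $ i $ p i\<bar>)"
    by (simp add: abs_mult abs_prod sign_def)
  also have "\<dots> \<le> (\<Prod>i\<in>(UNIV :: 'n set). K)"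
    by (intro prod_mono) (simp add: assms)
  finally show "\<bar>of_int (sign p) * (\<Prod>i\<in>UNIV. A $ i $ p i)\<bar> \<le> K ^ CARD('n)" by simp
qed

section \<open>Flows with additive noise\<close>

lemma gronwall:
  fixes \<phi> :: "real \<Rightarrow> real"
  assumes cont: "continuous_on {0..T} \<phi>" and "L \<ge> 0"
    and le: "\<And>t. t \<in> {0..T} \<Longrightarrow> \<phi> t \<le> C + L * integral {0..t} \<phi>" and t: "t \<in> {0..T}"
  shows "\<phi> t \<le> C * exp (L * t)"
proof -
  define w where "w s = exp (- (L * s)) * (C + L * integral {0..s} \<phi>)" for s
  have der: "((\<lambda>s. integral {0..s} \<phi>) has_real_derivative \<phi> s) (at s within {0..T})" if "s \<in> {0..T}" for s
    by (rule integral_has_real_derivative[OF cont that])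
  have "continuous_on {0..T} (\<lambda>s. integral {0..s} \<phi>)"
    using DERIV_continuous[OF der] by (simp add: continuous_on_eq_continuous_within)
  then have "continuous_on {0..t} (\<lambda>s. integral {0..s} \<phi>)"
    by (rule continuous_on_subset) (use t in auto)
  then have cw: "continuous_on {0..t} w"
    unfolding w_def by (intro continuous_intros)
  have "w t \<le> w 0"
  proof (rule DERIV_nonpos_imp_decreasing_open[OF _ _ cw])
    fix s assume s: "0 < s" "s < t"
    then have "at s within {0..T} = at s" using t by (intro at_within_interior) auto
    with der[of s] s t have d: "((\<lambda>s. integral {0..s} \<phi>) has_real_derivative \<phi> s) (at s)" by auto
    have "(w has_real_derivative exp (- (L * s)) * (L * (\<phi> s - (C + L * integral {0..s} \<phi>)))) (at s)"
      unfolding w_def by (auto intro!: derivative_eq_intros d simp: algebra_simps)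
    moreover have "exp (- (L * s)) * (L * (\<phi> s - (C + L * integral {0..s} \<phi>))) \<le> 0"
      using le[of s] s t \<open>L \<ge> 0\<close> by (intro mult_nonneg_nonpos) auto
    ultimately show "\<exists>y. (w has_real_derivative y) (at s) \<and> y \<le> 0" by blast
  qed (use t in auto)
  then have "C + L * integral {0..t} \<phi> \<le> C * exp (L * t)"
    by (simp add: w_def exp_minus field_simps)
  with le[OF t] show ?thesis by linarith
qed

lemma partial_has_derivative:
  fixes f :: "real ^ 'd \<Rightarrow> 'b::real_normed_vector"
  assumes "f differentiable (at x)"
  shows "(f has_derivative (\<lambda>h. \<Sum>k\<in>UNIV. h $ k *\<^sub>R partial k f x)) (at x)"
proof -
  let ?D = "frechet_derivative f (at x)"
  have D: "(f has_derivative ?D) (at x)"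
    using assms by (simp add: frechet_derivative_works)
  interpret linear ?D using D by (rule has_derivative_linear)
  have "?D h = (\<Sum>k\<in>UNIV. h $ k *\<^sub>R partial k f x)" for h
  proof -
    have "h = (\<Sum>k\<in>UNIV. h $ k *\<^sub>R axis k 1)"
      by (simp add: vec_eq_iff axis_def if_distrib cong: if_cong)
    then have "?D h = ?D (\<Sum>k\<in>UNIV. h $ k *\<^sub>R axis k 1)" by simp
    then show ?thesis by (simp add: sum scale partial_def)
  qed
  then have "?D = (\<lambda>h. \<Sum>k\<in>UNIV. h $ k *\<^sub>R partial k f x)" by auto
  with D show ?thesis by simp
qed

lemma partial_eq:
  assumes "(f has_derivative f') (at x)"
  shows "partial i f x = f' (axis i 1)"
  using frechet_derivative_at[OF assms] by (simp add: partial_def)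

lemma has_derivative_difference_quotient:
  assumes f: "(f has_derivative f') (at x)" and r: "r \<longlonglongrightarrow> 0" "\<And>n::nat. r n > 0"
  shows "(\<lambda>n. (f (x + r n *\<^sub>R e) - f x) /\<^sub>R r n) \<longlonglongrightarrow> f' e"
proof (cases "e = 0")
  case True
  then show ?thesis using has_derivative_linear[OF f] by (simp add: linear_0)
next
  case False
  interpret linear f' using f by (rule has_derivative_linear)
  have "((\<lambda>h. norm (f (x + h) - f x - f' h) / norm h) \<longlongrightarrow> 0) (at 0)"
    using f by (simp add: has_derivative_at)
  moreover have "filterlim (\<lambda>n. r n *\<^sub>R e) (at 0) sequentially"
    unfolding filterlim_at using r False
    by (auto intro!: tendsto_eq_intros simp: less_imp_neq[symmetric] always_eventually)
  ultimately have "(\<lambda>n. norm (f (x + r n *\<^sub>R e) - f x - f' (r n *\<^sub>R e)) / norm (r n *\<^sub>R e)) \<longlonglongrightarrow> 0"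
    by (rule filterlim_compose)
  then have "(\<lambda>n. norm (f (x + r n *\<^sub>R e) - f x - f' (r n *\<^sub>R e)) / norm (r n *\<^sub>R e) * norm e) \<longlonglongrightarrow> 0"
    by (rule tendsto_mult_left_zero)
  also have "(\<lambda>n. norm (f (x + r n *\<^sub>R e) - f x - f' (r n *\<^sub>R e)) / norm (r n *\<^sub>R e) * norm e)
     = (\<lambda>n. norm ((f (x + r n *\<^sub>R e) - f x) /\<^sub>R r n - f' e))"
  proof
    fix n
    have "(f (x + r n *\<^sub>R e) - f x) /\<^sub>R r n - f' e = (f (x + r n *\<^sub>R e) - f x - f' (r n *\<^sub>R e)) /\<^sub>R r n"
      using r(2)[of n] by (simp add: scale algebra_simps)
    then show "norm (f (x + r n *\<^sub>R e) - f x - f' (r n *\<^sub>R e)) / norm (r n *\<^sub>R e) * norm e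
      = norm ((f (x + r n *\<^sub>R e) - f x) /\<^sub>R r n - f' e)"
      using r(2)[of n] False by (simp only: norm_scaleR) (simp add: divide_inverse)
  qed
  finally show ?thesis
    using tendsto_norm_zero_iff LIM_zero_iff by blast
qed

abbreviation jointly_continuous :: "real \<Rightarrow> (real \<Rightarrow> real ^ 'd \<Rightarrow> 'b::topological_space) \<Rightarrow> bool" where
  "jointly_continuous T F \<equiv> continuous_on ({0..T} \<times> UNIV) (\<lambda>(t, x). F t x)"

text \<open>
  One path of the stochastic flow, with noise \<open>c\<close>. Almost every path of the Wiener process is continuous
  but nowhere differentiable, so the equation is kept in integral form; the noise drops out as soon as
  two trajectories are compared.
\<close>

locale additive_flow =
  fixes T L :: real and v :: "real \<Rightarrow> real ^ 'd \<Rightarrow> real ^ 'd" and c :: "real \<Rightarrow> real ^ 'd"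
    and g :: "real \<Rightarrow> real ^ 'd \<Rightarrow> real ^ 'd"
  assumes cont_noise: "continuous_on {0..T} c"
    and integrable_drift: "\<And>t x. t \<in> {0..T} \<Longrightarrow> (\<lambda>s. v s (g s x)) integrable_on {0..t}"
    and flow_eq: "\<And>t x. t \<in> {0..T} \<Longrightarrow> g t x = x + c t + integral {0..t} (\<lambda>s. v s (g s x))"
    and C01_drift: "C01 T v" and L_nonneg: "L \<ge> 0"
    and lipschitz_drift: "\<And>s y z. s \<in> {0..T} \<Longrightarrow> norm (v s y - v s z) \<le> L * norm (y - z)"
begin

lemma continuous_on_time: "continuous_on {0..T} (\<lambda>s. g s x)"
proof (cases "0 \<le> T")
  case True
  have "continuous_on {0..T} (\<lambda>t. x + c t + integral {0..t} (\<lambda>s. v s (g s x)))"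
    using True by (intro continuous_intros cont_noise indefinite_integral_continuous_1 integrable_drift) auto
  then show ?thesis by (rule continuous_on_eq) (simp add: flow_eq)
qed simp

lemma continuous_on_along_flow:
  assumes "jointly_continuous T F"
  shows "continuous_on {0..T} (\<lambda>s. F s (g s x))"
proof -
  have "continuous_on {0..T} (\<lambda>s. (\<lambda>(t, x). F t x) (s, g s x))"
    by (rule continuous_on_compose2[OF assms]) (auto intro: continuous_intros continuous_on_time)
  then show ?thesis by simp
qed

text \<open>
  The noise cancels in the difference of two trajectories, which leaves a Gronwall inequality. The
  shift \<open>a\<close> by a period makes one estimate serve twice: \<open>a = 0\<close> gives Lipschitz dependence on the
  initial point, and \<open>y = x - a\<close> gives equivariance.
\<close>

lemma flow_stability:
  assumes per: "\<And>s y. s \<in> {0..T} \<Longrightarrow> v s (y - a) = v s y" and t: "t \<in> {0..T}"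
  shows "norm (g t x - a - g t y) \<le> norm (x - a - y) * exp (L * t)"
proof (rule gronwall[OF _ L_nonneg _ t])
  show cont: "continuous_on {0..T} (\<lambda>t. norm (g t x - a - g t y))"
    by (intro continuous_intros continuous_on_time)
  fix t assume t: "t \<in> {0..T}"
  have int: "(\<lambda>s. norm (g s x - a - g s y)) integrable_on {0..t}"
    by (rule integrable_continuous_real[OF continuous_on_subset[OF cont]]) (use t in auto)
  have "g t x - a - g t y = (x - a - y) + (integral {0..t} (\<lambda>s. v s (g s x)) - integral {0..t} (\<lambda>s. v s (g s y)))"
    using flow_eq[OF t, of x] flow_eq[OF t, of y] by simp
  also have "integral {0..t} (\<lambda>s. v s (g s x)) - integral {0..t} (\<lambda>s. v s (g s y)) =
      integral {0..t} (\<lambda>s. v s (g s x) - v s (g s y))"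
    by (intro integral_diff[symmetric] integrable_drift t)
  finally have eq: "g t x - a - g t y = (x - a - y) + integral {0..t} (\<lambda>s. v s (g s x) - v s (g s y))" .
  have "norm (g t x - a - g t y) \<le> norm (x - a - y) + norm (integral {0..t} (\<lambda>s. v s (g s x) - v s (g s y)))"
    unfolding eq by (rule norm_triangle_ineq)
  also have "norm (integral {0..t} (\<lambda>s. v s (g s x) - v s (g s y))) \<le> integral {0..t} (\<lambda>s. L * norm (g s x - a - g s y))"
  proof (rule integral_norm_bound_integral)
    show "(\<lambda>s. v s (g s x) - v s (g s y)) integrable_on {0..t}"
      by (intro integrable_diff integrable_drift t)
    show "(\<lambda>s. L * norm (g s x - a - g s y)) integrable_on {0..t}"
      using int by (rule integrable_on_mult_right)
    fix s assume "s \<in> {0..t}"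
    then have s: "s \<in> {0..T}" using t by auto
    show "norm (v s (g s x) - v s (g s y)) \<le> L * norm (g s x - a - g s y)"
      using lipschitz_drift[OF s, of "g s x - a" "g s y"] per[OF s, of "g s x"] by simp
  qed
  finally show "norm (g t x - a - g t y) \<le> norm (x - a - y) + L * integral {0..t} (\<lambda>s. norm (g s x - a - g s y))"
    by simp
qed

lemma flow_lipschitz:
  "t \<in> {0..T} \<Longrightarrow> norm (g t x - g t y) \<le> norm (x - y) * exp (L * t)"
  using flow_stability[of 0 t x y] by simp

lemma flow_equivariant:
  assumes "\<And>s y. s \<in> {0..T} \<Longrightarrow> v s (y + a) = v s y" and "t \<in> {0..T}"
  shows "g t (x + a) = g t x + a"
proof -
  have "v s (y - a) = v s y" if "s \<in> {0..T}" for s y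
    using assms(1)[OF that, of "y - a"] by simp
  from flow_stability[OF this assms(2), of "x + a" x] show ?thesis by (simp add: algebra_simps)
qed

text \<open>
  The derivative of the flow in \<open>x\<close> exists by assumption at each time, so the chain rule gives the
  limit of the integrands in the difference quotient of the flow equation; Lipschitz dependence on
  the initial point dominates them.
\<close>

lemma variational_equation:
  fixes e :: "real ^ 'd"
  assumes der: "\<And>s. s \<in> {0..T} \<Longrightarrow> (g s has_derivative A s) (at x)" and t: "t \<in> {0..T}"
  defines "J \<equiv> \<lambda>s. \<Sum>k\<in>UNIV. A s e $ k *\<^sub>R partial k (v s) (g s x)"
  shows "J integrable_on {0..t}" and "A t e = e + integral {0..t} J"
proof -
  define r where "r n = inverse (real (Suc n))" for n
  have r: "r \<longlonglongrightarrow> 0" "\<And>n. r n > 0"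
    unfolding r_def by (rule LIMSEQ_inverse_real_of_nat) simp
  define q where "q n s = (v s (g s (x + r n *\<^sub>R e)) - v s (g s x)) /\<^sub>R r n" for n s
  have q_int: "q n integrable_on {0..t}" for n
    unfolding q_def by (intro integrable_cmul integrable_diff integrable_drift t)
  have q_le: "norm (q n s) \<le> L * (norm e * exp (L * T))" if "s \<in> {0..t}" for n s
  proof -
    have s: "s \<in> {0..T}" using that t by auto
    have "norm (v s (g s (x + r n *\<^sub>R e)) - v s (g s x)) \<le> L * norm (g s (x + r n *\<^sub>R e) - g s x)"
      by (rule lipschitz_drift[OF s])
    also have "\<dots> \<le> L * (norm (x + r n *\<^sub>R e - x) * exp (L * s))"
      by (intro mult_left_mono flow_lipschitz s L_nonneg)
    also have "\<dots> \<le> L * (norm (x + r n *\<^sub>R e - x) * exp (L * T))"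
      using s L_nonneg by (intro mult_left_mono) (auto intro: mult_left_mono)
    finally have "norm (v s (g s (x + r n *\<^sub>R e)) - v s (g s x)) \<le> r n * (L * (norm e * exp (L * T)))"
      using r(2)[of n] by (simp add: mult_ac)
    then show ?thesis
      using r(2)[of n] unfolding q_def norm_scaleR by (simp add: field_simps)
  qed
  have q_lim: "(\<lambda>n. q n s) \<longlonglongrightarrow> J s" if "s \<in> {0..t}" for s
  proof -
    have s: "s \<in> {0..T}" using that t by auto
    have "v s differentiable (at (g s x))" using C01_drift s by (simp add: C01_def)
    from has_derivative_compose[OF der[OF s] partial_has_derivative[OF this]]
    have "((\<lambda>x. v s (g s x)) has_derivative (\<lambda>h. \<Sum>k\<in>UNIV. A s h $ k *\<^sub>R partial k (v s) (g s x))) (at x)" .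
    from has_derivative_difference_quotient[OF this r, of e] show ?thesis
      by (simp add: q_def J_def)
  qed
  have dom: "(\<lambda>s. L * (norm e * exp (L * T))) integrable_on {0..t}" by (rule integrable_const_ivl)
  show "J integrable_on {0..t}"
    by (rule dominated_convergence(1)[OF q_int dom q_le q_lim])
  have "(\<lambda>n. integral {0..t} (q n)) \<longlonglongrightarrow> integral {0..t} J"
    by (rule dominated_convergence(2)[OF q_int dom q_le q_lim])
  then have "(\<lambda>n. e + integral {0..t} (q n)) \<longlonglongrightarrow> e + integral {0..t} J"
    by (intro tendsto_intros)
  moreover have "(g t (x + r n *\<^sub>R e) - g t x) /\<^sub>R r n = e + integral {0..t} (q n)" for n
  proof -
    have "integral {0..t} (q n) = (integral {0..t} (\<lambda>s. v s (g s (x + r n *\<^sub>R e))) - integral {0..t} (\<lambda>s. v s (g s x))) /\<^sub>R r n"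
      unfolding q_def by (simp add: integral_diff[OF integrable_drift[OF t] integrable_drift[OF t]])
    then show ?thesis
      using flow_eq[OF t, of "x + r n *\<^sub>R e"] flow_eq[OF t, of x] r(2)[of n]
      by (simp add: algebra_simps)
  qed
  ultimately have "(\<lambda>n. (g t (x + r n *\<^sub>R e) - g t x) /\<^sub>R r n) \<longlonglongrightarrow> e + integral {0..t} J" by simp
  then show "A t e = e + integral {0..t} J"
    using has_derivative_difference_quotient[OF der[OF t] r, of e] by (rule LIMSEQ_unique[rotated])
qed

theorem det_flow:
  assumes der: "\<And>s. s \<in> {0..T} \<Longrightarrow> (g s has_derivative A s) (at x)" and t: "t \<in> {0..T}"
    and div: "\<And>s y. s \<in> {0..T} \<Longrightarrow> divergence (v s) y = 0"
  shows "det (matrix (A t)) = 1"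
proof -
  have T: "0 \<le> T" using t by simp
  define J where "J e s = (\<Sum>k\<in>UNIV. A s e $ k *\<^sub>R partial k (v s) (g s x))" for e s
  have J: "J e integrable_on {0..t}" "A t e = e + integral {0..t} (J e)" if t: "t \<in> {0..T}" for e t
  proof -
    have eq: "J e = (\<lambda>s. \<Sum>k\<in>UNIV. A s e $ k *\<^sub>R partial k (v s) (g s x))"
      by (rule ext) (rule J_def)
    show "J e integrable_on {0..t}"
      unfolding eq by (rule variational_equation(1)[OF _ t]) (rule der)
    show "A t e = e + integral {0..t} (J e)"
      unfolding eq by (rule variational_equation(2)[OF _ t]) (rule der)
  qed
  have "continuous_on {0..T} (\<lambda>t. e + integral {0..t} (J e))" for e
    using T by (intro continuous_intros indefinite_integral_continuous_1 J) auto
  then have contA: "continuous_on {0..T} (\<lambda>t. A t e)" for e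
    by (rule continuous_on_eq) (simp add: J(2)[symmetric])
  have contJ: "continuous_on {0..T} (J e)" for e
    unfolding J_def using C01_drift
    by (intro continuous_intros contA continuous_on_along_flow) (simp add: C01_def)
  have contM: "continuous_on {0..T} (\<lambda>t. det (matrix (A t)))"
    unfolding det_def matrix_def by (simp, intro continuous_intros contA)
  have derA: "((\<lambda>t. A t e) has_vector_derivative J e s) (at s)" if "0 < s" "s < T" for e s
  proof -
    have s: "s \<in> {0..T}" using that by simp
    have "((\<lambda>t. e + integral {0..t} (J e)) has_vector_derivative 0 + J e s) (at s within {0..T})"
      by (rule has_vector_derivative_add[OF has_vector_derivative_const integral_has_vector_derivative[OF contJ s]])
    then have "((\<lambda>t. A t e) has_vector_derivative 0 + J e s) (at s within {0..T})"
      using has_vector_derivative_transform[OF s, of "\<lambda>t. A t e" "\<lambda>t. e + integral {0..t} (J e)"] J(2) by blast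
    moreover have "at s within {0..T} = at s"
      by (rule at_within_interior) (use that in simp)
    ultimately show ?thesis by simp
  qed
  have der0: "((\<lambda>t. det (matrix (A t))) has_real_derivative 0) (at s)" if s: "0 < s" "s < T" for s
  proof -
    define B where "B = (\<chi> i k. partial k (v s) (g s x) $ i)"
    have "((\<lambda>t. matrix (A t) $ i $ j) has_real_derivative (B ** matrix (A s)) $ i $ j) (at s)" for i j
    proof -
      have "((\<lambda>t. A t (axis j 1) $ i) has_vector_derivative J (axis j 1) s $ i) (at s)"
        by (rule bounded_linear.has_vector_derivative[OF bounded_linear_vec_nth derA[OF s]])
      then show ?thesis
        by (simp add: has_real_derivative_iff_has_vector_derivative matrix_def J_def B_def matrix_matrix_mult_def mult.commute)
    qed
    from has_field_derivative_det_linear[OF this] 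
    have "((\<lambda>t. det (matrix (A t))) has_real_derivative trace B * det (matrix (A s))) (at s)" .
    moreover have "trace B = divergence (v s) (g s x)"
      by (simp add: trace_def B_def divergence_def)
    ultimately show ?thesis using div[of s] s by simp
  qed
  have "det (matrix (A t)) = det (matrix (A 0))"
  proof (cases "t = 0")
    case False
    show ?thesis
    proof (rule DERIV_isconst_end[of 0 t "\<lambda>t. det (matrix (A t))"])
      show "continuous_on {0..t} (\<lambda>t. det (matrix (A t)))"
        by (rule continuous_on_subset[OF contM]) (use t in auto)
    qed (use False t der0 in auto)
  qed simp
  also have "A 0 = id"
    using J(2)[of 0] T by (auto simp: fun_eq_iff)
  finally show ?thesis by (simp only: matrix_id)
qed

end

section \<open>Calculus of periodic functions\<close>

text \<open>
  The derivative at \<open>x + a\<close> and at \<open>x\<close> is characterised by the same limit, so this holds also where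
  \<open>f\<close> is not differentiable and both sides are the default value.
\<close>

lemma partial_translate:
  assumes "\<And>x. f (x + a) = f x"
  shows "partial i f (x + a) = partial i f x"
proof -
  have "f (x + a + h) = f (x + h)" for h
    using assms[of "x + h"] by (simp add: ac_simps)
  then have "(f has_derivative D) (at (x + a)) \<longleftrightarrow> (f has_derivative D) (at x)" for D
    using assms by (simp add: has_derivative_at)
  then show ?thesis by (simp add: partial_def frechet_derivative_def)
qed

lemma periodic_partial: "periodic T F \<Longrightarrow> periodic T (\<lambda>t. partial i (F t))"
  by (auto simp: periodic_def intro!: partial_translate)

lemma time_deriv_works:
  assumes "C12 T F" "t \<in> {0..T}"
  shows "((\<lambda>s. F s x) has_vector_derivative time_deriv T F t x) (at t within {0..T})"
  using assms by (auto simp: C12_def time_deriv_def vector_derivative_works)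

lemma time_deriv_eq:
  assumes "((\<lambda>s. F s x) has_vector_derivative y) (at t within {0..T})" "T > 0" "t \<in> {0..T}"
  shows "time_deriv T F t x = y"
  unfolding time_deriv_def using assms vector_derivative_within_cbox[of 0 T t "\<lambda>s. F s x" y] by simp

lemma periodic_time_deriv:
  assumes "periodic T F" "C12 T F" "T > 0"
  shows "periodic T (time_deriv T F)"
  unfolding periodic_def
proof (intro ballI allI)
  fix t x i assume t: "t \<in> {0..T}"
  show "time_deriv T F t (x + axis i (2 * pi)) = time_deriv T F t x"
  proof (rule time_deriv_eq[OF has_vector_derivative_transform[OF t _ time_deriv_works[OF assms(2) t]] assms(3) t])
    fix s assume "s \<in> {0..T}"
    then show "F s (x + axis i (2 * pi)) = F s x" using assms(1) by (simp add: periodic_def)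
  qed
qed

lemma periodic_lattice:
  "periodic T F \<Longrightarrow> t \<in> {0..T} \<Longrightarrow> F t (x + lattice_vec k) = F t x"
  by (rule periodic_lattice_vec) (simp add: periodic_def)

lemma C01_continuous: "C01 T F \<Longrightarrow> jointly_continuous T F"
  and C01_differentiable: "C01 T F \<Longrightarrow> t \<in> {0..T} \<Longrightarrow> F t differentiable (at x)"
  and C01_continuous_partial: "C01 T F \<Longrightarrow> jointly_continuous T (\<lambda>t x. partial i (F t) x)"
  by (auto simp: C01_def)

lemma C12_C01: "C12 T F \<Longrightarrow> C01 T F"
  and C12_partial: "C12 T F \<Longrightarrow> C01 T (\<lambda>t. partial i (F t))"
  and C12_continuous_time_deriv: "C12 T F \<Longrightarrow> jointly_continuous T (time_deriv T F)"
  by (auto simp: C12_def)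

lemma continuous_on_slice:
  assumes "jointly_continuous T F" "t \<in> {0..T}"
  shows "continuous_on UNIV (F t)"
proof -
  have "continuous_on UNIV (\<lambda>x. (\<lambda>(t, x). F t x) (t, x))"
    by (rule continuous_on_compose2[OF assms(1)]) (use assms(2) in \<open>auto intro: continuous_intros\<close>)
  then show ?thesis by simp
qed

lemma half_open_cell_representative:
  fixes x :: "real ^ 'd"
  obtains k where "x + lattice_vec k \<in> half_open_cell"
  using fundamental_half_open_cell[where 'd='d] unfolding fundamental_def by blast

lemma periodic_bounded:
  fixes F :: "real \<Rightarrow> real ^ 'd \<Rightarrow> 'b::real_normed_vector"
  assumes cont: "jointly_continuous T F" and per: "periodic T F"
  obtains B where "B \<ge> 0" "\<And>t x. t \<in> {0..T} \<Longrightarrow> norm (F t x) \<le> B"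
proof -
  have "compact ((\<lambda>(t, x). F t x) ` ({0..T} \<times> torus_cell))"
    by (intro compact_continuous_image continuous_on_subset[OF cont] compact_Times)
       (auto simp: torus_cell_def)
  then obtain B where "B > 0" and B: "\<And>y. y \<in> (\<lambda>(t, x). F t x) ` ({0..T} \<times> torus_cell) \<Longrightarrow> norm y \<le> B"
    using compact_imp_bounded bounded_pos by metis
  have "norm (F t x) \<le> B" if t: "t \<in> {0..T}" for t x
  proof -
    obtain k where "x + lattice_vec k \<in> half_open_cell" by (rule half_open_cell_representative)
    then have "x + lattice_vec k \<in> torus_cell"
      by (auto simp: half_open_cell_def torus_cell_def mem_box_cart less_imp_le)
    with t have "norm (F t (x + lattice_vec k)) \<le> B" by (intro B) force
    then show ?thesis by (simp add: periodic_lattice[OF per t])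
  qed
  with \<open>B > 0\<close> show ?thesis by (intro that[of B]) auto
qed

text \<open>
  Uniform continuity and boundedness in one estimate that is valid for all pairs of points. The
  linear growth in time and quadratic growth in space are chosen so that, along the flow, its
  expectation is controlled by moments of the Wiener increments.
\<close>

lemma periodic_modulus:
  fixes F :: "real \<Rightarrow> real ^ 'd \<Rightarrow> 'b::real_normed_vector"
  assumes cont: "jointly_continuous T F" and per: "periodic T F" and "\<kappa> > 0"
  obtains C where "C \<ge> 0"
    "\<And>s t x y. s \<in> {0..T} \<Longrightarrow> t \<in> {0..T} \<Longrightarrow> norm (F s x - F t y) \<le> \<kappa> + C * (\<bar>s - t\<bar> + (norm (x - y))\<^sup>2)"
proof -
  obtain B where B: "B \<ge> 0" "\<And>t x. t \<in> {0..T} \<Longrightarrow> norm (F t x) \<le> B"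
    by (rule periodic_bounded[OF cont per]) blast
  define K :: "(real \<times> (real ^ 'd)) set" where "K = {0..T} \<times> cbox (\<chi> i. - 1) (\<chi> i. 2 * pi + 1)"
  have "uniformly_continuous_on K (\<lambda>(t, x). F t x)"
    unfolding K_def by (intro compact_uniformly_continuous continuous_on_subset[OF cont] compact_Times) auto
  then obtain \<delta>0 where "\<delta>0 > 0"
    and \<delta>0: "\<And>z z'. z \<in> K \<Longrightarrow> z' \<in> K \<Longrightarrow> dist z z' < \<delta>0 \<Longrightarrow> dist ((\<lambda>(t, x). F t x) z) ((\<lambda>(t, x). F t x) z') < \<kappa>"
    using \<open>\<kappa> > 0\<close> unfolding uniformly_continuous_on_def by metis
  define \<delta> where "\<delta> = min 1 (\<delta>0 / 2)"
  have \<delta>: "0 < \<delta>" "\<delta> \<le> 1" "\<delta> \<le> \<delta>0 / 2" using \<open>\<delta>0 > 0\<close> by (auto simp: \<delta>_def)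
  have near: "norm (F s x - F t y) \<le> \<kappa>"
    if st: "s \<in> {0..T}" "t \<in> {0..T}" and "\<bar>s - t\<bar> < \<delta>" and xy: "norm (x - y) < \<delta>" for s t x y
  proof -
    obtain k where k: "x + lattice_vec k \<in> half_open_cell" by (rule half_open_cell_representative)
    have "\<bar>x $ i - y $ i\<bar> < 1" for i
      using component_le_norm_cart[of "x - y" i] xy \<delta>(2) by simp
    then have "- 1 \<le> (y + lattice_vec k) $ i \<and> (y + lattice_vec k) $ i \<le> 2 * pi + 1" for i
      using k by (simp add: half_open_cell_def) (smt (verit))
    then have yK: "(t, y + lattice_vec k) \<in> K" using st by (simp add: K_def mem_box_cart)
    have "- 1 \<le> (x + lattice_vec k) $ i \<and> (x + lattice_vec k) $ i \<le> 2 * pi + 1" for i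
      using k by (simp add: half_open_cell_def) (smt (verit))
    then have xK: "(s, x + lattice_vec k) \<in> K" using st by (simp add: K_def mem_box_cart)
    have "dist (s, x + lattice_vec k) (t, y + lattice_vec k) \<le> \<bar>s - t\<bar> + norm (x - y)"
      using norm_Pair_le[of "s - t" "x - y"] by (simp add: dist_norm)
    also have "\<dots> < \<delta>0" using that \<delta>(3) by linarith
    finally have "dist (F s (x + lattice_vec k)) (F t (y + lattice_vec k)) < \<kappa>"
      using \<delta>0[OF xK yK] by simp
    then show ?thesis
      using st by (simp add: periodic_lattice[OF per] dist_norm)
  qed
  define C where "C = 2 * B / \<delta>\<^sup>2"
  have "norm (F s x - F t y) \<le> \<kappa> + C * (\<bar>s - t\<bar> + (norm (x - y))\<^sup>2)"
    if st: "s \<in> {0..T}" "t \<in> {0..T}" for s t x y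
  proof (cases "\<bar>s - t\<bar> < \<delta> \<and> norm (x - y) < \<delta>")
    case True
    then have "norm (F s x - F t y) \<le> \<kappa>" using near st by blast
    moreover have "0 \<le> C * (\<bar>s - t\<bar> + (norm (x - y))\<^sup>2)"
      using B(1) by (simp add: C_def)
    ultimately show ?thesis by linarith
  next
    case False
    have "\<delta>\<^sup>2 \<le> \<bar>s - t\<bar> + (norm (x - y))\<^sup>2"
    proof (cases "\<bar>s - t\<bar> < \<delta>")
      case True
      then have "\<delta> \<le> norm (x - y)" using False by auto
      then have "\<delta>\<^sup>2 \<le> (norm (x - y))\<^sup>2" using \<delta>(1) by (intro power_mono) auto
      then show ?thesis by linarith
    next
      case False
      moreover have "\<delta>\<^sup>2 \<le> \<delta>" using \<delta>(1,2) by (simp add: power2_eq_square mult_left_le)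
      ultimately show ?thesis by (smt (verit) zero_le_power2)
    qed
    then have "2 * B \<le> C * (\<bar>s - t\<bar> + (norm (x - y))\<^sup>2)"
      unfolding C_def using B(1) \<delta>(1) by (simp add: pos_le_divide_eq mult_left_mono)
    moreover have "norm (F s x - F t y) \<le> 2 * B"
      using norm_triangle_ineq4[of "F s x" "F t y"] B(2)[OF st(1), of x] B(2)[OF st(2), of y] by linarith
    ultimately show ?thesis using \<open>\<kappa> > 0\<close> by linarith
  qed
  moreover have "C \<ge> 0" using B(1) by (simp add: C_def)
  ultimately show ?thesis using that by blast
qed

lemma periodic_lipschitz:
  fixes F :: "real \<Rightarrow> real ^ 'd \<Rightarrow> 'b::real_normed_vector"
  assumes F: "C01 T F" and per: "periodic T F"
  obtains L where "L \<ge> 0" "\<And>t y z. t \<in> {0..T} \<Longrightarrow> norm (F t y - F t z) \<le> L * norm (y - z)"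
proof -
  have "\<exists>B\<ge>0. \<forall>t\<in>{0..T}. \<forall>x. norm (partial i (F t) x) \<le> B" for i
    using periodic_bounded[OF C01_continuous_partial[OF F] periodic_partial[OF per]] by metis
  then obtain B where B: "\<And>i. B i \<ge> 0" "\<And>i t x. t \<in> {0..T} \<Longrightarrow> norm (partial i (F t) x) \<le> B i"
    by metis
  have "norm (F t y - F t z) \<le> (\<Sum>i\<in>UNIV. B i) * norm (y - z)" if t: "t \<in> {0..T}" for t y z
  proof (rule differentiable_bound[of UNIV])
    fix x :: "real ^ 'd"
    show "(F t has_derivative (\<lambda>h. \<Sum>k\<in>UNIV. h $ k *\<^sub>R partial k (F t) x)) (at x within UNIV)"
      by (rule partial_has_derivative[OF C01_differentiable[OF F t]])
    show "onorm (\<lambda>h. \<Sum>k\<in>UNIV. h $ k *\<^sub>R partial k (F t) x) \<le> (\<Sum>i\<in>UNIV. B i)"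
    proof (rule onorm_le)
      fix h :: "real ^ 'd"
      have "norm (\<Sum>k\<in>UNIV. h $ k *\<^sub>R partial k (F t) x) \<le> (\<Sum>k\<in>UNIV. norm (h $ k *\<^sub>R partial k (F t) x))"
        by (rule norm_sum)
      also have "\<dots> \<le> (\<Sum>k\<in>UNIV. norm h * B k)"
        unfolding norm_scaleR real_norm_def
        by (intro sum_mono mult_mono component_le_norm_cart B(2)[OF t]) auto
      finally show "norm (\<Sum>k\<in>UNIV. h $ k *\<^sub>R partial k (F t) x) \<le> (\<Sum>i\<in>UNIV. B i) * norm h"
        by (simp add: sum_distrib_left mult.commute)
    qed
  qed auto
  then show ?thesis using that[of "\<Sum>i\<in>UNIV. B i"] B(1) by (simp add: sum_nonneg)
qed

lemma set_integrable_torus_cell: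
  fixes f :: "real ^ 'd \<Rightarrow> real"
  shows "continuous_on UNIV f \<Longrightarrow> set_integrable lborel torus_cell f"
  unfolding set_integrable_def torus_cell_def
  by (intro borel_integrable_compact) (auto intro: continuous_on_subset)

lemma integral_torus_cell_translate:
  fixes f :: "real ^ 'd \<Rightarrow> real"
  assumes "continuous_on UNIV f" and "\<And>x i. f (x + axis i (2 * pi)) = f x"
  shows "(LINT x:torus_cell|lborel. f (x + a)) = (LINT x:torus_cell|lborel. f x)"
proof (rule integral_torus_cell_invariant[OF assms, of "\<lambda>x. x + a" "\<lambda>x. x - a"])
  show "distr lborel borel (\<lambda>x. x + a) = lborel"
    using lborel_distr_plus[of a] by (simp add: add.commute[of _ a])
qed (auto intro!: continuous_intros simp: ac_simps)

text \<open>
  The integral over the cell is invariant under translations, so the difference quotients of a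
  periodic function have integral zero; dominated convergence passes this on to the derivative.
\<close>

lemma integral_partial_zero:
  fixes F :: "real \<Rightarrow> real ^ 'd \<Rightarrow> real"
  assumes F: "C01 T F" and per: "periodic T F" and t: "t \<in> {0..T}"
  shows "(LINT x:torus_cell|lborel. partial i (F t) x) = 0"
proof -
  obtain L where L: "L \<ge> 0" "\<And>y z. norm (F t y - F t z) \<le> L * norm (y - z)"
    using periodic_lipschitz[OF F per] t by metis
  define r where "r n = inverse (real (Suc n))" for n
  have r: "r \<longlonglongrightarrow> 0" "\<And>n. r n > 0"
    unfolding r_def by (rule LIMSEQ_inverse_real_of_nat) simp
  let ?e = "axis i (1 :: real)"
  have contF: "continuous_on UNIV (F t)"
    by (rule continuous_on_slice[OF C01_continuous[OF F] t])
  have contFr: "continuous_on UNIV (\<lambda>x. F t (x + r n *\<^sub>R ?e))" for n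
    by (rule continuous_on_compose2[OF contF]) (auto intro!: continuous_intros)
  define q where "q n x = (F t (x + r n *\<^sub>R ?e) - F t x) /\<^sub>R r n" for n x
  have contq: "continuous_on UNIV (q n)" for n
    unfolding q_def by (intro continuous_intros contF contFr)
  have "(LINT x:torus_cell|lborel. q n x) = 0" for n
  proof -
    have "(LINT x:torus_cell|lborel. q n x) =
      ((LINT x:torus_cell|lborel. F t (x + r n *\<^sub>R ?e)) - (LINT x:torus_cell|lborel. F t x)) /\<^sub>R r n"
      unfolding q_def
      by (simp add: set_integral_diff(2)[OF set_integrable_torus_cell[OF contFr] set_integrable_torus_cell[OF contF]])
    then show ?thesis
      using integral_torus_cell_translate[OF contF] per t by (simp add: periodic_def)
  qed
  moreover have "(\<lambda>n. LINT x:torus_cell|lborel. q n x) \<longlonglongrightarrow> (LINT x:torus_cell|lborel. partial i (F t) x)"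
    unfolding set_lebesgue_integral_def
  proof (rule integral_dominated_convergence[where w="\<lambda>x. indicator torus_cell x *\<^sub>R L"])
    have "continuous_on UNIV (partial i (F t))"
      by (rule continuous_on_slice[OF C01_continuous_partial[OF F] t])
    then show "(\<lambda>x. indicat_real torus_cell x *\<^sub>R partial i (F t) x) \<in> borel_measurable lborel"
      using set_integrable_torus_cell unfolding set_integrable_def by blast
    show "(\<lambda>x. indicat_real torus_cell x *\<^sub>R q n x) \<in> borel_measurable lborel" for n
      using set_integrable_torus_cell[OF contq] unfolding set_integrable_def by blast
    show "integrable lborel (\<lambda>x :: real ^ 'd. indicat_real torus_cell x *\<^sub>R L)"
      using set_integrable_torus_cell[of "\<lambda>_. L"] unfolding set_integrable_def by simp
    show "AE x in lborel. (\<lambda>n. indicat_real torus_cell x *\<^sub>R q n x) \<longlonglongrightarrow> indicat_real torus_cell x *\<^sub>R partial i (F t) x"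
    proof (intro AE_I2 tendsto_intros)
      fix x
      show "(\<lambda>n. q n x) \<longlonglongrightarrow> partial i (F t) x"
        unfolding q_def partial_def
        by (rule has_derivative_difference_quotient[OF _ r])
           (simp add: frechet_derivative_works[symmetric] C01_differentiable[OF F t])
    qed
    show "AE x in lborel. norm (indicat_real torus_cell x *\<^sub>R q n x) \<le> indicat_real torus_cell x *\<^sub>R L" for n
    proof (rule AE_I2)
      fix x
      have "norm (F t (x + r n *\<^sub>R ?e) - F t x) \<le> L * r n"
        using L(2)[of "x + r n *\<^sub>R ?e" x] r(2)[of n] by simp
      then have "norm (q n x) \<le> L" using r(2)[of n] by (simp add: q_def field_simps)
      then show "norm (indicat_real torus_cell x *\<^sub>R q n x) \<le> indicat_real torus_cell x *\<^sub>R L"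
        by (simp add: indicator_def)
    qed
  qed
  ultimately show ?thesis by (simp add: LIMSEQ_const_iff)
qed

lemma continuous_on_integral_torus_cell:
  fixes F :: "real \<Rightarrow> real ^ 'd \<Rightarrow> real"
  assumes "jointly_continuous T F"
  shows "continuous_on {0..T} (\<lambda>t. LINT x:torus_cell|lborel. F t x)"
proof -
  have "continuous_on {0..T} (\<lambda>t. integral torus_cell (F t))"
    unfolding torus_cell_def
    by (rule integral_continuous_on_param) (auto intro: continuous_on_subset[OF assms])
  then show ?thesis
    by (rule continuous_on_eq)
       (simp add: set_borel_integral_eq_integral set_integrable_torus_cell continuous_on_slice[OF assms])
qed

lemma C01_I:
  assumes "jointly_continuous T F"
    and "\<And>t x. t \<in> {0..T} \<Longrightarrow> F t differentiable (at x)"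
    and "\<And>i. jointly_continuous T (F' i)"
    and "\<And>i t x. t \<in> {0..T} \<Longrightarrow> partial i (F t) x = F' i t x"
  shows "C01 T F"
  unfolding C01_def
proof (intro conjI allI ballI assms)
  show "jointly_continuous T (\<lambda>t x. partial i (F t) x)" for i
    by (rule continuous_on_eq[OF assms(3)[of i]]) (auto simp: assms(4))
qed

lemma C01_cong:
  assumes "C01 T F" "\<And>t x. t \<in> {0..T} \<Longrightarrow> G t x = F t x"
  shows "C01 T G"
proof (rule C01_I)
  have eq: "G t = F t" if "t \<in> {0..T}" for t using assms(2)[OF that] by auto
  show "jointly_continuous T G"
    by (rule continuous_on_eq[OF C01_continuous[OF assms(1)]]) (auto simp: eq)
  show "G t differentiable (at x)" if "t \<in> {0..T}" for t x
    unfolding eq[OF that] by (rule C01_differentiable[OF assms(1) that])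
  show "partial i (G t) x = partial i (F t) x" if "t \<in> {0..T}" for i t x
    unfolding eq[OF that] ..
qed (rule C01_continuous_partial[OF assms(1)])

lemma partial_add:
  assumes "a differentiable (at x)" "b differentiable (at x)"
  shows "partial i (\<lambda>y. a y + b y) x = partial i a x + partial i b x"
  using partial_eq[OF has_derivative_add[OF assms[unfolded frechet_derivative_works]]]
  by (simp add: partial_def)

lemma partial_linear:
  assumes "bounded_linear h" "a differentiable (at x)"
  shows "partial i (\<lambda>y. h (a y)) x = h (partial i a x)"
  using partial_eq[OF bounded_linear.has_derivative[OF assms(1) assms(2)[unfolded frechet_derivative_works]]]
  by (simp add: partial_def)

lemma partial_bilinear:
  assumes "bounded_bilinear mul" "a differentiable (at x)" "b differentiable (at x)"
  shows "partial i (\<lambda>y. mul (a y) (b y)) x = mul (partial i a x) (b x) + mul (a x) (partial i b x)"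
  using partial_eq[OF bounded_bilinear.FDERIV[OF assms(1) assms(2,3)[unfolded frechet_derivative_works]]]
  by (simp add: partial_def add.commute)

lemma differentiable_bilinear:
  assumes "bounded_bilinear mul" "a differentiable (at x)" "b differentiable (at x)"
  shows "(\<lambda>y. mul (a y) (b y)) differentiable (at x)"
  using bounded_bilinear.FDERIV[OF assms(1) assms(2,3)[unfolded frechet_derivative_works]]
  by (rule differentiableI)

lemma continuous_on_bilinear_pair:
  assumes "bounded_bilinear mul" "continuous_on S (\<lambda>(t, x). a t x)" "continuous_on S (\<lambda>(t, x). b t x)"
  shows "continuous_on S (\<lambda>(t, x). mul (a t x) (b t x))"
  using bounded_bilinear.continuous_on[OF assms] by (simp add: split_beta)

lemma C01_add:
  assumes a: "C01 T a" and b: "C01 T b"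
  shows "C01 T (\<lambda>t x. a t x + b t x)"
proof (rule C01_I[where F'="\<lambda>i t x. partial i (a t) x + partial i (b t) x"])
  note ca = C01_continuous[OF a] C01_continuous_partial[OF a]
  note cb = C01_continuous[OF b] C01_continuous_partial[OF b]
  show "jointly_continuous T (\<lambda>t x. a t x + b t x)"
    "jointly_continuous T (\<lambda>t x. partial i (a t) x + partial i (b t) x)" for i
    using continuous_on_add[OF ca(1) cb(1)] continuous_on_add[OF ca(2) cb(2)]
    by (simp_all add: split_beta)
  show "(\<lambda>x. a t x + b t x) differentiable (at x)" if "t \<in> {0..T}" for t x
    by (rule differentiable_add[OF C01_differentiable[OF a that] C01_differentiable[OF b that]])
  show "partial i (\<lambda>x. a t x + b t x) x = partial i (a t) x + partial i (b t) x" if "t \<in> {0..T}" for i t x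
    by (rule partial_add[OF C01_differentiable[OF a that] C01_differentiable[OF b that]])
qed

lemma C01_linear:
  assumes h: "bounded_linear h" and a: "C01 T a"
  shows "C01 T (\<lambda>t x. h (a t x))"
proof (rule C01_I[where F'="\<lambda>i t x. h (partial i (a t) x)"])
  show "jointly_continuous T (\<lambda>t x. h (a t x))"
    "jointly_continuous T (\<lambda>t x. h (partial i (a t) x))" for i
    using bounded_linear.continuous_on[OF h C01_continuous[OF a]]
      bounded_linear.continuous_on[OF h C01_continuous_partial[OF a]]
    by (simp_all add: split_beta)
  show "(\<lambda>x. h (a t x)) differentiable (at x)" if "t \<in> {0..T}" for t x
    using bounded_linear.has_derivative[OF h C01_differentiable[OF a that, unfolded frechet_derivative_works]]
    by (rule differentiableI)
  show "partial i (\<lambda>x. h (a t x)) x = h (partial i (a t) x)" if "t \<in> {0..T}" for i t x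
    by (rule partial_linear[OF h C01_differentiable[OF a that]])
qed

lemma C01_bilinear:
  assumes p: "bounded_bilinear mul" and a: "C01 T a" and b: "C01 T b"
  shows "C01 T (\<lambda>t x. mul (a t x) (b t x))"
proof (rule C01_I[where F'="\<lambda>i t x. mul (partial i (a t) x) (b t x) + mul (a t x) (partial i (b t) x)"])
  note ca = C01_continuous[OF a] C01_continuous_partial[OF a]
  note cb = C01_continuous[OF b] C01_continuous_partial[OF b]
  show "jointly_continuous T (\<lambda>t x. mul (a t x) (b t x))"
    by (rule continuous_on_bilinear_pair[OF p ca(1) cb(1)])
  show "jointly_continuous T (\<lambda>t x. mul (partial i (a t) x) (b t x) + mul (a t x) (partial i (b t) x))" for i
    using continuous_on_add[OF continuous_on_bilinear_pair[OF p ca(2) cb(1)] continuous_on_bilinear_pair[OF p ca(1) cb(2)]]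
    by (simp add: split_beta)
  show "(\<lambda>x. mul (a t x) (b t x)) differentiable (at x)" if "t \<in> {0..T}" for t x
    by (rule differentiable_bilinear[OF p C01_differentiable[OF a that] C01_differentiable[OF b that]])
  show "partial i (\<lambda>x. mul (a t x) (b t x)) x = mul (partial i (a t) x) (b t x) + mul (a t x) (partial i (b t) x)"
    if "t \<in> {0..T}" for i t x
    by (rule partial_bilinear[OF p C01_differentiable[OF a that] C01_differentiable[OF b that]])
qed

lemma C12_I:
  assumes "C01 T F"
    and "\<And>i. C01 T (F' i)" and "\<And>i t x. t \<in> {0..T} \<Longrightarrow> partial i (F t) x = F' i t x"
    and "jointly_continuous T Ft"
    and "\<And>t x. t \<in> {0..T} \<Longrightarrow> ((\<lambda>s. F s x) has_vector_derivative Ft t x) (at t within {0..T})"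
    and "T > 0"
  shows "C12 T F"
  unfolding C12_def
proof (intro conjI allI ballI assms(1))
  show "C01 T (\<lambda>t. partial i (F t))" for i
    by (rule C01_cong[OF assms(2)]) (rule assms(3))
  show "(\<lambda>s. F s x) differentiable at t within {0..T}" if "t \<in> {0..T}" for t x
    using assms(5)[OF that] unfolding has_vector_derivative_def by (rule differentiableI)
  show "jointly_continuous T (time_deriv T F)"
    by (rule continuous_on_eq[OF assms(4)]) (auto simp: time_deriv_eq[OF assms(5) assms(6)])
qed

lemma C12_add:
  assumes a: "C12 T a" and b: "C12 T b" and "T > 0"
  shows "C12 T (\<lambda>t x. a t x + b t x)"
proof (rule C12_I[where F'="\<lambda>i t x. partial i (a t) x + partial i (b t) x"
      and Ft="\<lambda>t x. time_deriv T a t x + time_deriv T b t x"])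
  show "jointly_continuous T (\<lambda>t x. time_deriv T a t x + time_deriv T b t x)"
    using continuous_on_add[OF C12_continuous_time_deriv[OF a] C12_continuous_time_deriv[OF b]]
    by (simp add: split_beta)
  show "C01 T (\<lambda>t x. a t x + b t x)" by (rule C01_add[OF C12_C01[OF a] C12_C01[OF b]])
  show "C01 T (\<lambda>t x. partial i (a t) x + partial i (b t) x)" for i
    by (rule C01_add[OF C12_partial[OF a] C12_partial[OF b]])
  show "partial i (\<lambda>x. a t x + b t x) x = partial i (a t) x + partial i (b t) x" if "t \<in> {0..T}" for i t x
    by (rule partial_add[OF C01_differentiable[OF C12_C01[OF a] that] C01_differentiable[OF C12_C01[OF b] that]])
  show "((\<lambda>s. a s x + b s x) has_vector_derivative time_deriv T a t x + time_deriv T b t x) (at t within {0..T})"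
    if "t \<in> {0..T}" for t x
    by (rule has_vector_derivative_add[OF time_deriv_works[OF a that] time_deriv_works[OF b that]])
qed (rule \<open>T > 0\<close>)

lemma C12_linear:
  assumes h: "bounded_linear h" and a: "C12 T a" and "T > 0"
  shows "C12 T (\<lambda>t x. h (a t x))"
proof (rule C12_I[where F'="\<lambda>i t x. h (partial i (a t) x)" and Ft="\<lambda>t x. h (time_deriv T a t x)"])
  show "jointly_continuous T (\<lambda>t x. h (time_deriv T a t x))"
    using bounded_linear.continuous_on[OF h C12_continuous_time_deriv[OF a]]
    by (simp add: split_beta)
  show "C01 T (\<lambda>t x. h (a t x))" by (rule C01_linear[OF h C12_C01[OF a]])
  show "C01 T (\<lambda>t x. h (partial i (a t) x))" for i by (rule C01_linear[OF h C12_partial[OF a]])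
  show "partial i (\<lambda>x. h (a t x)) x = h (partial i (a t) x)" if "t \<in> {0..T}" for i t x
    by (rule partial_linear[OF h C01_differentiable[OF C12_C01[OF a] that]])
  show "((\<lambda>s. h (a s x)) has_vector_derivative h (time_deriv T a t x)) (at t within {0..T})" if "t \<in> {0..T}" for t x
    by (rule bounded_linear.has_vector_derivative[OF h time_deriv_works[OF a that]])
qed (rule \<open>T > 0\<close>)

lemma C12_bilinear:
  assumes p: "bounded_bilinear mul" and a: "C12 T a" and b: "C12 T b" and "T > 0"
  shows "C12 T (\<lambda>t x. mul (a t x) (b t x))"
proof (rule C12_I[where F'="\<lambda>i t x. mul (partial i (a t) x) (b t x) + mul (a t x) (partial i (b t) x)"
      and Ft="\<lambda>t x. mul (a t x) (time_deriv T b t x) + mul (time_deriv T a t x) (b t x)"])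
  note c = C12_continuous_time_deriv[OF a] C12_continuous_time_deriv[OF b] C01_continuous[OF C12_C01[OF a]]
    C01_continuous[OF C12_C01[OF b]]
  show "jointly_continuous T (\<lambda>t x. mul (a t x) (time_deriv T b t x) + mul (time_deriv T a t x) (b t x))"
    using continuous_on_add[OF continuous_on_bilinear_pair[OF p c(3) c(2)] continuous_on_bilinear_pair[OF p c(1) c(4)]]
    by (simp add: split_beta)
  show "C01 T (\<lambda>t x. mul (a t x) (b t x))" by (rule C01_bilinear[OF p C12_C01[OF a] C12_C01[OF b]])
  show "C01 T (\<lambda>t x. mul (partial i (a t) x) (b t x) + mul (a t x) (partial i (b t) x))" for i
    by (rule C01_add[OF C01_bilinear[OF p C12_partial[OF a] C12_C01[OF b]] C01_bilinear[OF p C12_C01[OF a] C12_partial[OF b]]])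
  show "partial i (\<lambda>x. mul (a t x) (b t x)) x = mul (partial i (a t) x) (b t x) + mul (a t x) (partial i (b t) x)"
    if "t \<in> {0..T}" for i t x
    by (rule partial_bilinear[OF p C01_differentiable[OF C12_C01[OF a] that] C01_differentiable[OF C12_C01[OF b] that]])
  show "((\<lambda>s. mul (a s x) (b s x)) has_vector_derivative
      mul (a t x) (time_deriv T b t x) + mul (time_deriv T a t x) (b t x)) (at t within {0..T})" if "t \<in> {0..T}" for t x
    by (rule bounded_bilinear.has_vector_derivative[OF p time_deriv_works[OF a that] time_deriv_works[OF b that]])
qed (rule \<open>T > 0\<close>)

lemma continuous_on_generator:
  assumes F: "C12 T F" and v: "C01 T v"
  shows "jointly_continuous T (generator T \<nu> v F)"
proof -
  note c = C12_continuous_time_deriv[OF F, unfolded case_prod_unfold] C01_continuous[OF v, unfolded case_prod_unfold]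
    C01_continuous_partial[OF C12_C01[OF F], unfolded case_prod_unfold]
    C01_continuous_partial[OF C12_partial[OF F], unfolded case_prod_unfold]
  have "continuous_on ({0..T} \<times> UNIV) (\<lambda>z. \<Sum>i\<in>UNIV. v (fst z) (snd z) $ i *\<^sub>R partial i (F (fst z)) (snd z))"
    by (rule continuous_on_sum, rule continuous_on_scaleR[OF continuous_on_component[OF c(2)] c(3)])
  moreover have "continuous_on ({0..T} \<times> UNIV) (\<lambda>z. \<Sum>i\<in>UNIV. partial i (partial i (F (fst z))) (snd z))"
    by (rule continuous_on_sum, rule c(4))
  ultimately show ?thesis
    unfolding generator_def advect_def laplacian_def case_prod_unfold
    by (intro continuous_on_add continuous_on_scaleR continuous_on_const c(1))
qed

lemma time_deriv_add:
  assumes "C12 T a" "C12 T b" "T > 0" "t \<in> {0..T}"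
  shows "time_deriv T (\<lambda>s y. a s y + b s y) t x = time_deriv T a t x + time_deriv T b t x"
  by (rule time_deriv_eq[OF has_vector_derivative_add[OF time_deriv_works[OF assms(1,4)] time_deriv_works[OF assms(2,4)]] assms(3,4)])

lemma time_deriv_linear:
  assumes "bounded_linear h" "C12 T a" "T > 0" "t \<in> {0..T}"
  shows "time_deriv T (\<lambda>s y. h (a s y)) t x = h (time_deriv T a t x)"
  by (rule time_deriv_eq[OF bounded_linear.has_vector_derivative[OF assms(1) time_deriv_works[OF assms(2,4)]] assms(3,4)])

lemma generator_add:
  assumes a: "C12 T a" and b: "C12 T b" and T: "T > 0" and t: "t \<in> {0..T}"
  shows "generator T \<nu> v (\<lambda>s y. a s y + b s y) t x = generator T \<nu> v a t x + generator T \<nu> v b t x"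
proof -
  have p1: "partial i (\<lambda>y. a t y + b t y) = (\<lambda>y. partial i (a t) y + partial i (b t) y)" for i
    by (rule ext) (intro partial_add C01_differentiable[OF C12_C01[OF a] t] C01_differentiable[OF C12_C01[OF b] t])
  have p2: "partial i (\<lambda>y. partial i (a t) y + partial i (b t) y) x
      = partial i (partial i (a t)) x + partial i (partial i (b t)) x" for i
    using C01_differentiable[OF C12_partial[OF a] t] C01_differentiable[OF C12_partial[OF b] t]
    by (intro partial_add) auto
  show ?thesis
    by (simp add: time_deriv_add[OF a b T t] generator_def advect_def laplacian_def p1 p2 algebra_simps sum.distrib)
qed

lemma generator_linear:
  assumes h: "bounded_linear h" and a: "C12 T a" and T: "T > 0" and t: "t \<in> {0..T}"
  shows "generator T \<nu> v (\<lambda>s y. h (a s y)) t x = h (generator T \<nu> v a t x)"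
proof -
  interpret h: bounded_linear h by (rule h)
  have p1: "partial i (\<lambda>y. h (a t y)) = (\<lambda>y. h (partial i (a t) y))" for i
    by (rule ext) (intro partial_linear C01_differentiable[OF C12_C01[OF a] t] h)
  have p2: "partial i (\<lambda>y. h (partial i (a t) y)) x = h (partial i (partial i (a t)) x)" for i
    using C01_differentiable[OF C12_partial[OF a] t] by (intro partial_linear h) auto
  show ?thesis
    by (simp add: time_deriv_linear[OF h a T t] generator_def advect_def laplacian_def p1 p2 h.add h.sum h.scale)
qed

lemma laplacian_bilinear:
  assumes p: "bounded_bilinear mul" and a: "C12 T a" and b: "C12 T b" and t: "t \<in> {0..T}"
  shows "laplacian (\<lambda>y. mul (a t y) (b t y)) x =
    mul (laplacian (a t) x) (b t x) + mul (a t x) (laplacian (b t) x)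
    + 2 *\<^sub>R (\<Sum>i\<in>UNIV. mul (partial i (a t) x) (partial i (b t) x))"
proof -
  interpret p: bounded_bilinear mul by (rule p)
  have da: "a t differentiable (at y)" "partial i (a t) differentiable (at y)" for y i
    using C01_differentiable[OF C12_partial[OF a] t] C01_differentiable[OF C12_C01[OF a] t] by auto
  have db: "b t differentiable (at y)" "partial i (b t) differentiable (at y)" for y i
    using C01_differentiable[OF C12_partial[OF b] t] C01_differentiable[OF C12_C01[OF b] t] by auto
  have p1: "partial i (\<lambda>y. mul (a t y) (b t y)) =
      (\<lambda>y. mul (partial i (a t) y) (b t y) + mul (a t y) (partial i (b t) y))" for i
    by (rule ext) (intro partial_bilinear p da db)
  have p2: "partial i (\<lambda>y. mul (partial i (a t) y) (b t y) + mul (a t y) (partial i (b t) y)) x =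
     (mul (partial i (partial i (a t)) x) (b t x) + mul (partial i (a t) x) (partial i (b t) x)) +
     (mul (partial i (a t) x) (partial i (b t) x) + mul (a t x) (partial i (partial i (b t)) x))" for i
    by (simp add: partial_add partial_bilinear differentiable_bilinear p da db)
  show ?thesis
    unfolding laplacian_def p1 p2
    by (simp add: sum.distrib p.sum_left p.sum_right scaleR_2)
qed

text \<open>
  The product rule fails for the second-order part of the generator, which leaves the sum of
  products of first derivatives.
\<close>

lemma generator_bilinear:
  assumes p: "bounded_bilinear mul" and a: "C12 T a" and b: "C12 T b" and T: "T > 0" and t: "t \<in> {0..T}"
  shows "generator T \<nu> v (\<lambda>s y. mul (a s y) (b s y)) t x =
    mul (generator T \<nu> v a t x) (b t x) + mul (a t x) (generator T \<nu> v b t x)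
    + (2 * \<nu>) *\<^sub>R (\<Sum>i\<in>UNIV. mul (partial i (a t) x) (partial i (b t) x))"
proof -
  interpret p: bounded_bilinear mul by (rule p)
  have p1: "partial i (\<lambda>y. mul (a t y) (b t y)) x =
      mul (partial i (a t) x) (b t x) + mul (a t x) (partial i (b t) x)" for i
    by (intro partial_bilinear p C01_differentiable[OF C12_C01[OF a] t] C01_differentiable[OF C12_C01[OF b] t])
  have "time_deriv T (\<lambda>s y. mul (a s y) (b s y)) t x =
      mul (a t x) (time_deriv T b t x) + mul (time_deriv T a t x) (b t x)"
    by (rule time_deriv_eq[OF p.has_vector_derivative[OF time_deriv_works[OF a t] time_deriv_works[OF b t]] T t])
  then show ?thesis
    by (simp add: generator_def advect_def laplacian_bilinear[OF p a b t] p1 p.add_left p.add_right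
        p.scaleR_left p.scaleR_right p.sum_left p.sum_right sum.distrib scaleR_add_right mult.commute)
qed

section \<open>Smooth functions\<close>

lemma Ck_on_cong:
  assumes "Ck_on k S f" "\<And>z. z \<in> S \<Longrightarrow> g z = f z"
  shows "Ck_on k S g"
proof (cases k)
  case 0
  have "continuous_on S g"
    by (rule continuous_on_eq[of S f]) (use assms 0 in auto)
  then show ?thesis by (simp add: 0)
next
  case (Suc n)
  then obtain f' where f': "\<And>z. z \<in> S \<Longrightarrow> (f has_derivative f' z) (at z within S)"
    "\<And>b. b \<in> Basis \<Longrightarrow> Ck_on n S (\<lambda>z. f' z b)"
    using assms(1) by auto
  have "(g has_derivative f' z) (at z within S)" if "z \<in> S" for z
    by (rule has_derivative_transform[OF that _ f'(1)[OF that]]) (rule assms(2))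
  then show ?thesis using f'(2) unfolding Suc Ck_on.simps by blast
qed

lemma Ck_on_continuous: "Ck_on k S f \<Longrightarrow> continuous_on S f"
  by (cases k) (auto intro: has_derivative_continuous_on)

text \<open>
  The joint derivative in the directions \<open>(0, axis i 1)\<close> and \<open>(1, 0)\<close> gives the partial derivatives
  and the one-sided time derivative; a derivative within the strip is a full derivative in space.
\<close>

lemma Ck_on_Suc_slices:
  fixes F :: "real \<Rightarrow> real ^ 'd \<Rightarrow> 'b::real_normed_vector"
  assumes "Ck_on (Suc k) ({0..T} \<times> UNIV) (\<lambda>(t, x). F t x)" and T: "T > 0"
  obtains Ft where "\<And>t x. t \<in> {0..T} \<Longrightarrow> F t differentiable (at x)"
    and "\<And>i. Ck_on k ({0..T} \<times> UNIV) (\<lambda>(t, x). partial i (F t) x)"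
    and "\<And>t x. t \<in> {0..T} \<Longrightarrow> ((\<lambda>s. F s x) has_vector_derivative Ft t x) (at t within {0..T})"
    and "Ck_on k ({0..T} \<times> UNIV) (\<lambda>(t, x). Ft t x)"
proof -
  let ?S = "{0..T} \<times> (UNIV :: (real ^ 'd) set)"
  obtain f' where f': "\<And>z. z \<in> ?S \<Longrightarrow> ((\<lambda>(t, x). F t x) has_derivative f' z) (at z within ?S)"
    and Ck: "\<And>b. b \<in> Basis \<Longrightarrow> Ck_on k ?S (\<lambda>z. f' z b)"
    using assms(1) by auto
  have space: "(F t has_derivative (\<lambda>h. f' (t, x) (0, h))) (at x)" if t: "t \<in> {0..T}" for t x
  proof -
    have "((\<lambda>x. (t, x)) has_derivative (\<lambda>h. (0, h))) (at x)"
      by (auto intro!: derivative_eq_intros)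
    moreover have "((\<lambda>(t, x). F t x) has_derivative f' (t, x)) (at (t, x) within range (Pair t))"
      by (rule has_derivative_subset[OF f']) (use t in auto)
    ultimately show ?thesis
      using has_derivative_in_compose[of "\<lambda>x. (t, x)" _ x UNIV "\<lambda>(t, x). F t x" "f' (t, x)"] by simp
  qed
  have time: "((\<lambda>s. F s x) has_vector_derivative f' (t, x) (1, 0)) (at t within {0..T})" if t: "t \<in> {0..T}" for t x
  proof -
    have "((\<lambda>s. (s, x)) has_derivative (\<lambda>h. (h, 0))) (at t within {0..T})"
      by (auto intro!: derivative_eq_intros)
    moreover have d: "((\<lambda>(t, x). F t x) has_derivative f' (t, x)) (at (t, x) within (\<lambda>s. (s, x)) ` {0..T})"
      by (rule has_derivative_subset[OF f']) (use t in auto)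
    ultimately have "((\<lambda>s. F s x) has_derivative (\<lambda>h. f' (t, x) (h, 0))) (at t within {0..T})"
      using has_derivative_in_compose[of "\<lambda>s. (s, x)" _ t "{0..T}" "\<lambda>(t, x). F t x" "f' (t, x)"] by simp
    moreover have "(\<lambda>h. f' (t, x) (h, 0)) = (\<lambda>h. h *\<^sub>R f' (t, x) (1, 0))"
    proof
      show "f' (t, x) (h, 0) = h *\<^sub>R f' (t, x) (1, 0)" for h
        using linear_scale[OF has_derivative_linear[OF d], of h "(1, 0)"] by simp
    qed
    ultimately show ?thesis by (simp only: has_vector_derivative_def)
  qed
  show ?thesis
  proof (rule that[of "\<lambda>t x. f' (t, x) (1, 0)"])
    show "F t differentiable (at x)" if "t \<in> {0..T}" for t x
      using space[OF that] by (rule differentiableI)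
    show "Ck_on k ?S (\<lambda>(t, x). partial i (F t) x)" for i
    proof (rule Ck_on_cong)
      show "Ck_on k ?S (\<lambda>z. f' z (0, axis i 1))"
        by (rule Ck) (simp add: Basis_prod_def axis_in_Basis_iff)
      show "(\<lambda>(t, x). partial i (F t) x) z = f' z (0, axis i 1)" if "z \<in> ?S" for z
        using that by (auto simp: partial_eq[OF space])
    qed
    show "Ck_on k ?S (\<lambda>(t, x). f' (t, x) (1, 0))"
      by (rule Ck_on_cong[OF Ck[of "(1, 0)"]]) (auto simp: Basis_prod_def)
  qed (rule time)
qed

lemma Ck_on_imp_C01:
  fixes F :: "real \<Rightarrow> real ^ 'd \<Rightarrow> 'b::real_normed_vector"
  assumes "Ck_on (Suc k) ({0..T} \<times> UNIV) (\<lambda>(t, x). F t x)" and "T > 0"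
  shows "C01 T F"
  by (rule Ck_on_Suc_slices[OF assms])
     (use Ck_on_continuous assms(1) in \<open>blast intro: C01_I[OF _ _ _ refl]\<close>)

lemma smooth_on_imp_C12:
  fixes F :: "real \<Rightarrow> real ^ 'd \<Rightarrow> 'b::real_normed_vector"
  assumes "smooth_on ({0..T} \<times> UNIV) (\<lambda>(t, x). F t x)" and T: "T > 0"
  shows "C12 T F"
proof -
  have F: "Ck_on (Suc (Suc 0)) ({0..T} \<times> UNIV) (\<lambda>(t, x). F t x)"
    using assms(1) unfolding smooth_on_def by blast
  obtain Ft where "\<And>i. Ck_on (Suc 0) ({0..T} \<times> UNIV) (\<lambda>(t, x). partial i (F t) x)"
    and "\<And>t x. t \<in> {0..T} \<Longrightarrow> ((\<lambda>s. F s x) has_vector_derivative Ft t x) (at t within {0..T})"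
    and "Ck_on (Suc 0) ({0..T} \<times> UNIV) (\<lambda>(t, x). Ft t x)"
    using Ck_on_Suc_slices[OF F T] by metis
  note slices = this
  show ?thesis
  proof (rule C12_I[where F'="\<lambda>i t. partial i (F t)" and Ft=Ft])
    show "C01 T F" by (rule Ck_on_imp_C01[OF F T])
    show "C01 T (\<lambda>t. partial i (F t))" for i by (rule Ck_on_imp_C01[OF slices(1) T])
    show "jointly_continuous T Ft" by (rule Ck_on_continuous[OF slices(3)])
  qed (use slices(2) T in auto)
qed

section \<open>Integration by parts\<close>

lemma continuous_on_partial_slice: "C01 T F \<Longrightarrow> t \<in> {0..T} \<Longrightarrow> continuous_on UNIV (partial i (F t))"
  by (rule continuous_on_slice[OF C01_continuous_partial])

lemma integral_sum_partial_zero: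
  fixes F :: "'d \<Rightarrow> real \<Rightarrow> real ^ 'd \<Rightarrow> real"
  assumes "\<And>i. C01 T (F i)" "\<And>i. periodic T (F i)" "t \<in> {0..T}"
  shows "(LINT x:torus_cell|lborel. \<Sum>i\<in>UNIV. partial i (F i t) x) = 0"
proof -
  have "(LINT x:torus_cell|lborel. \<Sum>i\<in>UNIV. partial i (F i t) x) = (\<Sum>i\<in>UNIV. LINT x:torus_cell|lborel. partial i (F i t) x)"
    unfolding set_lebesgue_integral_def scaleR_sum_right
    by (rule Bochner_Integration.integral_sum)
       (rule set_integrable_torus_cell[OF continuous_on_partial_slice[OF assms(1,3)], unfolded set_integrable_def])
  then show ?thesis using integral_partial_zero[OF assms] by simp
qed

lemma generator_navier_stokes:
  assumes "navier_stokes_solution T \<nu> v p" "t \<in> {0..T}"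
  shows "generator T \<nu> v v t x = (2 * \<nu>) *\<^sub>R laplacian (v t) x - gradient (p t) x"
proof -
  have "time_deriv T v t x + advect (v t) (v t) x = \<nu> *\<^sub>R laplacian (v t) x - gradient (p t) x"
    using assms by (simp add: navier_stokes_solution_def)
  then show ?thesis
    unfolding generator_def by (simp add: vec_eq_iff algebra_simps)
qed

lemma C12_divergence_continuous:
  assumes "C01 T u"
  shows "jointly_continuous T (\<lambda>t x. divergence (u t) x)"
  unfolding divergence_def case_prod_unfold
  by (intro continuous_intros C01_continuous_partial[OF assms, unfolded case_prod_unfold])

text \<open>
  By the Navier-Stokes equation \<open>L v = 2 \<nu> \<Delta> v - \<nabla> p\<close>. The product rule then turns the integrand into
  \<open>v \<cdot> L \<eta> + 2 \<nu> (\<Delta> v \<cdot> \<eta> + \<Sum>\<^sub>i \<partial>\<^sub>i v \<cdot> \<partial>\<^sub>i \<eta>) - \<nabla> p \<cdot> \<eta>\<close>. The term in parentheses is the sum of the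
  derivatives \<open>\<partial>\<^sub>i (\<partial>\<^sub>i v \<cdot> \<eta>)\<close>, and \<open>\<nabla> p \<cdot> \<eta>\<close> differs from \<open>- p div \<eta>\<close> by the divergence of \<open>p \<eta>\<close>.
\<close>

theorem integral_generator_inner:
  fixes v \<eta> :: "real \<Rightarrow> real ^ 'd \<Rightarrow> real ^ 'd"
  assumes ns: "navier_stokes_solution T \<nu> v p" and \<eta>: "C12 T \<eta>" "periodic T \<eta>"
    and T: "T > 0" and t: "t \<in> {0..T}"
  shows "(LINT x:torus_cell|lborel. generator T \<nu> v (\<lambda>s y. v s y \<bullet> \<eta> s y) t x) =
    (LINT x:torus_cell|lborel. v t x \<bullet> generator T \<nu> v \<eta> t x + p t x * divergence (\<eta> t) x)"
proof -
  from ns have v: "C12 T v" "periodic T v" and p: "C01 T p" "periodic T p"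
    by (auto simp: navier_stokes_solution_def)
  define H1 where "H1 i s y = partial i (v s) y \<bullet> \<eta> s y" for i s y
  define H2 where "H2 i s y = (p s y *\<^sub>R \<eta> s y) $ i" for i s y
  have H1: "C01 T (H1 i)" for i
    unfolding H1_def by (rule C01_bilinear[OF bounded_bilinear_inner C12_partial[OF v(1)] C12_C01[OF \<eta>(1)]])
  have H1p: "periodic T (H1 i)" for i
    unfolding H1_def using periodic_partial[OF v(2), of i] \<eta>(2) by (simp add: periodic_def)
  have H2: "C01 T (H2 i)" for i
    unfolding H2_def
    by (rule C01_linear[OF bounded_linear_vec_nth C01_bilinear[OF bounded_bilinear_scaleR p(1) C12_C01[OF \<eta>(1)]]])
  have H2p: "periodic T (H2 i)" for i
    unfolding H2_def using p(2) \<eta>(2) by (simp add: periodic_def)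
  have dv: "partial i (v t) differentiable (at x)" and d\<eta>: "\<eta> t differentiable (at x)" and dp: "p t differentiable (at x)" for i x
    using C01_differentiable[OF C12_partial[OF v(1)] t] C01_differentiable[OF C12_C01[OF \<eta>(1)] t]
      C01_differentiable[OF p(1) t] by auto
  have P1: "(\<Sum>i\<in>UNIV. partial i (H1 i t) x) = laplacian (v t) x \<bullet> \<eta> t x + (\<Sum>i\<in>UNIV. partial i (v t) x \<bullet> partial i (\<eta> t) x)" for x
    unfolding H1_def
    by (simp add: partial_bilinear[OF bounded_bilinear_inner dv d\<eta>] sum.distrib laplacian_def inner_sum_left)
  have P2: "(\<Sum>i\<in>UNIV. partial i (H2 i t) x) = gradient (p t) x \<bullet> \<eta> t x + p t x * divergence (\<eta> t) x" for x
    unfolding H2_def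
    by (subst partial_linear[OF bounded_linear_vec_nth])
       (simp_all add: differentiable_bilinear[OF bounded_bilinear_scaleR dp d\<eta>] partial_bilinear[OF bounded_bilinear_scaleR dp d\<eta>]
         sum.distrib gradient_def divergence_def inner_vec_def sum_distrib_left)
  let ?A = "\<lambda>x. v t x \<bullet> generator T \<nu> v \<eta> t x + p t x * divergence (\<eta> t) x"
  have pt: "generator T \<nu> v (\<lambda>s y. v s y \<bullet> \<eta> s y) t x =
    ?A x + (2 * \<nu>) * (\<Sum>i\<in>UNIV. partial i (H1 i t) x) - (\<Sum>i\<in>UNIV. partial i (H2 i t) x)" for x
    unfolding generator_bilinear[OF bounded_bilinear_inner v(1) \<eta>(1) T t] generator_navier_stokes[OF ns t] P1 P2
    by (simp add: algebra_simps inner_diff_left)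
  have contA: "continuous_on UNIV ?A"
    using continuous_on_slice[OF C01_continuous[OF C12_C01[OF v(1)]] t]
      continuous_on_slice[OF continuous_on_generator[OF \<eta>(1) C12_C01[OF v(1)]] t]
      continuous_on_slice[OF C01_continuous[OF p(1)] t]
      continuous_on_slice[OF C12_divergence_continuous[OF C12_C01[OF \<eta>(1)]] t]
    by (intro continuous_intros)
  have c1: "continuous_on UNIV (\<lambda>x. \<Sum>i\<in>UNIV. partial i (H1 i t) x)"
    and c2: "continuous_on UNIV (\<lambda>x. \<Sum>i\<in>UNIV. partial i (H2 i t) x)"
    using continuous_on_partial_slice[OF H1 t] continuous_on_partial_slice[OF H2 t]
    by (auto intro!: continuous_on_sum)
  note i = contA[THEN set_integrable_torus_cell] c1[THEN set_integrable_torus_cell] c2[THEN set_integrable_torus_cell]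
  have i1: "set_integrable lborel torus_cell (\<lambda>x. (2 * \<nu>) * (\<Sum>i\<in>UNIV. partial i (H1 i t) x))"
    using i(2) by simp
  show ?thesis
    unfolding pt set_integral_diff(2)[OF set_integral_add(1)[OF i(1) i1] i(3)] set_integral_add(2)[OF i(1) i1]
    using integral_sum_partial_zero[OF H1 H1p t] integral_sum_partial_zero[OF H2 H2p t] by simp
qed

section \<open>Second-order expansion\<close>

lemma has_real_derivative_along_segment:
  fixes f :: "real ^ 'd \<Rightarrow> real"
  assumes "f differentiable (at (y + s *\<^sub>R h))"
  shows "((\<lambda>s. f (y + s *\<^sub>R h)) has_real_derivative (\<Sum>k\<in>UNIV. h $ k * partial k f (y + s *\<^sub>R h))) (at s)"
proof -
  have "((\<lambda>s. y + s *\<^sub>R h) has_derivative (\<lambda>r. r *\<^sub>R h)) (at s)"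
    by (auto intro!: derivative_eq_intros)
  from has_derivative_compose[OF this partial_has_derivative[OF assms]]
  have "((\<lambda>s. f (y + s *\<^sub>R h)) has_derivative (\<lambda>r. \<Sum>k\<in>UNIV. (r *\<^sub>R h) $ k *\<^sub>R partial k f (y + s *\<^sub>R h))) (at s)" .
  also have "(\<lambda>r. \<Sum>k\<in>UNIV. (r *\<^sub>R h) $ k *\<^sub>R partial k f (y + s *\<^sub>R h)) =
     (*) (\<Sum>k\<in>UNIV. h $ k * partial k f (y + s *\<^sub>R h))"
    by (rule ext) (simp add: sum_distrib_left mult_ac)
  finally show ?thesis by (simp add: has_field_derivative_def)
qed

lemma mean_value_segment:
  fixes f :: "real ^ 'd \<Rightarrow> real"
  assumes "\<And>x. f differentiable (at x)"
  obtains \<theta> where "0 \<le> \<theta>" "\<theta> \<le> 1" "f (y + h) - f y = (\<Sum>k\<in>UNIV. h $ k * partial k f (y + \<theta> *\<^sub>R h))"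
proof -
  have "\<exists>z>0. z < 1 \<and> f (y + 1 *\<^sub>R h) - f (y + 0 *\<^sub>R h) = (1 - 0) * (\<Sum>k\<in>UNIV. h $ k * partial k f (y + z *\<^sub>R h))"
    by (rule MVT2) (auto intro!: has_real_derivative_along_segment assms)
  then show ?thesis using that by (auto intro: less_imp_le)
qed

lemma taylor_segment:
  fixes f :: "real ^ 'd \<Rightarrow> real"
  assumes d1: "\<And>x. f differentiable (at x)" and d2: "\<And>i x. partial i f differentiable (at x)"
  obtains \<theta> where "0 \<le> \<theta>" "\<theta> \<le> 1" "f (y + h) - f y = (\<Sum>i\<in>UNIV. h $ i * partial i f y) +
    (\<Sum>i\<in>UNIV. \<Sum>j\<in>UNIV. h $ i * h $ j * partial j (partial i f) (y + \<theta> *\<^sub>R h)) / 2"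
proof -
  define D where "D m s = (if m = (0 :: nat) then f (y + s *\<^sub>R h)
      else if m = 1 then \<Sum>i\<in>UNIV. h $ i * partial i f (y + s *\<^sub>R h)
      else \<Sum>i\<in>UNIV. h $ i * (\<Sum>j\<in>UNIV. h $ j * partial j (partial i f) (y + s *\<^sub>R h)))" for m s
  have "\<exists>t>0. t < 1 \<and> f (y + 1 *\<^sub>R h) = (\<Sum>m<2. D m 0 / fact m * 1 ^ m) + D 2 t / fact 2 * 1 ^ 2"
  proof (rule Maclaurin[of 1 2 D "\<lambda>s. f (y + s *\<^sub>R h)"])
    show "D 0 = (\<lambda>s. f (y + s *\<^sub>R h))" by (rule ext) (simp add: D_def)
    show "\<forall>m t. m < 2 \<and> 0 \<le> t \<and> t \<le> 1 \<longrightarrow> (D m has_real_derivative D (Suc m) t) (at t)"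
    proof (intro allI impI)
      fix m :: nat and t :: real assume "m < 2 \<and> 0 \<le> t \<and> t \<le> 1"
      then consider "m = 0" | "m = 1" by linarith
      then show "(D m has_real_derivative D (Suc m) t) (at t)"
      proof cases
        case 1
        have "D m = (\<lambda>s. f (y + s *\<^sub>R h))" by (rule ext) (simp add: D_def 1)
        then show ?thesis using has_real_derivative_along_segment[OF d1, where y=y and s=t and h=h] by (simp add: D_def 1)
      next
        case 2
        have "D m = (\<lambda>s. \<Sum>i\<in>UNIV. h $ i * partial i f (y + s *\<^sub>R h))" by (rule ext) (simp add: D_def 2)
        moreover have "D (Suc m) t = (\<Sum>i\<in>UNIV. h $ i * (\<Sum>j\<in>UNIV. h $ j * partial j (partial i f) (y + t *\<^sub>R h)))"
          by (simp add: D_def 2)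
        ultimately show ?thesis
          by (simp only:) (rule DERIV_sum DERIV_cmult has_real_derivative_along_segment[OF d2])+
      qed
    qed
  qed simp_all
  then obtain \<theta> where "0 < \<theta>" "\<theta> < 1" "f (y + 1 *\<^sub>R h) = (\<Sum>m<2. D m 0 / fact m * 1 ^ m) + D 2 \<theta> / fact 2 * 1 ^ 2"
    by blast
  then show ?thesis
    by (intro that[of \<theta>]) (simp_all add: D_def numeral_2_eq_2 sum_distrib_left mult.assoc)
qed

lemma norm_add_square_le:
  fixes x y :: "'a::real_normed_vector"
  shows "(norm (x + y))\<^sup>2 \<le> 2 * (norm x)\<^sup>2 + 2 * (norm y)\<^sup>2"
proof -
  have "(norm (x + y))\<^sup>2 \<le> (norm x + norm y)\<^sup>2"
    by (intro power_mono norm_triangle_ineq) simp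
  also have "\<dots> \<le> 2 * (norm x)\<^sup>2 + 2 * (norm y)\<^sup>2"
    using zero_le_power2[of "norm x - norm y"] by (simp add: power2_sum power2_diff)
  finally show ?thesis .
qed

text \<open>
  The expansion behind Ito's formula. Here \<open>w\<close> stands for the noise increment over a time step
  \<open>\<epsilon>\<close>, of size \<open>\<epsilon>\<close> in mean square, and \<open>b\<close> for the drift increment, of size \<open>\<epsilon>\<close>. The bound has
  expectation at most a constant times \<open>\<kappa> \<epsilon> + C \<epsilon>\<^sup>2\<close>, which is \<open>o(\<epsilon>)\<close> as \<open>\<kappa>\<close> is arbitrary.
\<close>

lemma expansion_remainder:
  fixes F :: "real \<Rightarrow> real ^ 'd \<Rightarrow> real"
  assumes F: "C12 T F" and per_t: "periodic T (time_deriv T F)" and per_x: "\<And>i. periodic T (\<lambda>t. partial i (F t))"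
    and "\<kappa> > 0" "B \<ge> 0" "T > 0"
  obtains C where "C \<ge> 0" "\<And>t \<epsilon> y w b. t \<in> {0..T} \<Longrightarrow> 0 \<le> \<epsilon> \<Longrightarrow> t + \<epsilon> \<in> {0..T} \<Longrightarrow> norm b \<le> B * \<epsilon> \<Longrightarrow>
    \<bar>F (t + \<epsilon>) (y + w + b) - F t y - \<epsilon> * time_deriv T F t y - (\<Sum>i\<in>UNIV. (w + b) $ i * partial i (F t) y)
      - (\<Sum>i\<in>UNIV. \<Sum>j\<in>UNIV. w $ i * w $ j * partial j (partial i (F t)) y) / 2\<bar>
    \<le> \<kappa> * (\<epsilon> + (norm w)\<^sup>2) + C * (\<epsilon>\<^sup>2 + \<epsilon> * (norm w)\<^sup>2 + (norm w) ^ 4)"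
proof -
  define d where "d = real CARD('d)"
  define \<kappa>' where "\<kappa>' = \<kappa> / (1 + B * d + d\<^sup>2)"
  have d: "d \<ge> 0" by (simp add: d_def)
  have pos: "1 + B * d + d\<^sup>2 > 0" using d \<open>B \<ge> 0\<close> by (smt (verit) mult_nonneg_nonneg zero_le_power2)
  then have \<kappa>': "\<kappa>' > 0" "\<kappa>' * (1 + B * d + d\<^sup>2) = \<kappa>" using \<open>\<kappa> > 0\<close> by (simp_all add: \<kappa>'_def)
  define J where "J s x = (time_deriv T F s x, (\<chi> i. partial i (F s) x), (\<chi> i j. partial j (partial i (F s)) x))" for s x
  have "jointly_continuous T J"
    unfolding J_def case_prod_unfold
    by (intro continuous_on_Pair continuous_on_vec_lambda C12_continuous_time_deriv[OF F, unfolded case_prod_unfold]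
        C01_continuous[OF C12_partial[OF F], unfolded case_prod_unfold]
        C01_continuous_partial[OF C12_partial[OF F], unfolded case_prod_unfold])
  moreover have "periodic T J"
    using per_t per_x periodic_partial[OF per_x] by (simp add: periodic_def J_def)
  ultimately obtain C' where C': "C' \<ge> 0"
    and J: "\<And>s t x y. s \<in> {0..T} \<Longrightarrow> t \<in> {0..T} \<Longrightarrow> norm (J s x - J t y) \<le> \<kappa>' + C' * (\<bar>s - t\<bar> + (norm (x - y))\<^sup>2)"
    using periodic_modulus[OF _ _ \<kappa>'(1)] by metis
  have modulus: "\<bar>time_deriv T F s x - time_deriv T F t y\<bar> \<le> \<kappa>' + C' * (\<bar>s - t\<bar> + (norm (x - y))\<^sup>2)"
    "\<bar>partial i (F s) x - partial i (F t) y\<bar> \<le> \<kappa>' + C' * (\<bar>s - t\<bar> + (norm (x - y))\<^sup>2)"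
    "\<bar>partial j (partial i (F s)) x - partial j (partial i (F t)) y\<bar> \<le> \<kappa>' + C' * (\<bar>s - t\<bar> + (norm (x - y))\<^sup>2)"
    if "s \<in> {0..T}" "t \<in> {0..T}" for s t x y i j
  proof -
    let ?z = "J s x - J t y"
    have "\<bar>fst ?z\<bar> \<le> norm ?z" "\<bar>fst (snd ?z) $ i\<bar> \<le> norm ?z" "\<bar>snd (snd ?z) $ i $ j\<bar> \<le> norm ?z"
      using norm_fst_le[of "fst ?z" "snd ?z"] norm_snd_le[of "snd ?z" "fst ?z"]
        norm_fst_le[of "fst (snd ?z)" "snd (snd ?z)"] norm_snd_le[of "snd (snd ?z)" "fst (snd ?z)"]
        component_le_norm_cart[of "fst (snd ?z)" i] component_le_norm_cart[of "snd (snd ?z) $ i" j]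
        Finite_Cartesian_Product.norm_nth_le[where x="snd (snd ?z)" and i=i]
      by (simp_all only: prod.collapse real_norm_def)
    then show "\<bar>time_deriv T F s x - time_deriv T F t y\<bar> \<le> \<kappa>' + C' * (\<bar>s - t\<bar> + (norm (x - y))\<^sup>2)"
      "\<bar>partial i (F s) x - partial i (F t) y\<bar> \<le> \<kappa>' + C' * (\<bar>s - t\<bar> + (norm (x - y))\<^sup>2)"
      "\<bar>partial j (partial i (F s)) x - partial j (partial i (F t)) y\<bar> \<le> \<kappa>' + C' * (\<bar>s - t\<bar> + (norm (x - y))\<^sup>2)"
      using J[OF that, of x y] by (simp_all add: J_def)
  qed
  define C where "C = C' * (1 + 2 * (1 + d * B) + 2 * (1 + d * B) * B\<^sup>2 * T + d\<^sup>2)"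
  have C: "C \<ge> 0" unfolding C_def using C' d \<open>B \<ge> 0\<close> \<open>T > 0\<close> by (intro mult_nonneg_nonneg add_nonneg_nonneg) auto
  have "\<bar>F (t + \<epsilon>) (y + w + b) - F t y - \<epsilon> * time_deriv T F t y - (\<Sum>i\<in>UNIV. (w + b) $ i * partial i (F t) y)
      - (\<Sum>i\<in>UNIV. \<Sum>j\<in>UNIV. w $ i * w $ j * partial j (partial i (F t)) y) / 2\<bar>
    \<le> \<kappa> * (\<epsilon> + (norm w)\<^sup>2) + C * (\<epsilon>\<^sup>2 + \<epsilon> * (norm w)\<^sup>2 + (norm w) ^ 4)"
    if t: "t \<in> {0..T}" and \<epsilon>: "0 \<le> \<epsilon>" and t\<epsilon>: "t + \<epsilon> \<in> {0..T}" and b: "norm b \<le> B * \<epsilon>" for t \<epsilon> y w b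
  proof -
    define N where "N = (norm w)\<^sup>2"
    define H where "H = 2 * N + 2 * (B * \<epsilon>)\<^sup>2"
    have N: "N \<ge> 0" and H: "H \<ge> 0" by (simp_all add: N_def H_def)
    have near: "(norm (w + \<theta> *\<^sub>R b))\<^sup>2 \<le> H" if "0 \<le> \<theta>" "\<theta> \<le> 1" for \<theta>
    proof -
      have "norm (\<theta> *\<^sub>R b) \<le> norm b" using that by (simp add: mult_left_le_one_le)
      then have "(norm (\<theta> *\<^sub>R b))\<^sup>2 \<le> (B * \<epsilon>)\<^sup>2" using b by (intro power_mono) auto
      then show ?thesis using norm_add_square_le[of w "\<theta> *\<^sub>R b"] by (simp add: H_def N_def)
    qed
    have dF: "F t differentiable (at x)" and ddF: "partial i (F t) differentiable (at x)" for i x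
      using C01_differentiable[OF C12_C01[OF F] t] C01_differentiable[OF C12_partial[OF F] t] by auto
    \<comment> \<open>The step from \<open>(t, y)\<close> to \<open>(t + \<epsilon>, y + w + b)\<close> is made by noise, then drift, then time, and
      estimated from the last part backwards. Only the noise part has to be expanded to second order.\<close>
    have "\<exists>\<xi>\<in>{t..t + \<epsilon>}. F (t + \<epsilon>) (y + w + b) - F t (y + w + b) = (\<lambda>h. h *\<^sub>R time_deriv T F \<xi> (y + w + b)) (t + \<epsilon> - t)"
    proof (rule mvt_very_simple)
      fix s assume "t \<le> s" "s \<le> t + \<epsilon>"
      then have "s \<in> {0..T}" using t t\<epsilon> by auto
      from time_deriv_works[OF F this, of "y + w + b"]
      have "((\<lambda>s. F s (y + w + b)) has_derivative (\<lambda>h. h *\<^sub>R time_deriv T F s (y + w + b))) (at s within {0..T})"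
        by (simp add: has_vector_derivative_def)
      then show "((\<lambda>s. F s (y + w + b)) has_derivative (\<lambda>h. h *\<^sub>R time_deriv T F s (y + w + b))) (at s within {t..t + \<epsilon>})"
        by (rule has_derivative_subset) (use t t\<epsilon> in auto)
    qed (use \<epsilon> in simp)
    then obtain \<xi> where \<xi>: "\<xi> \<in> {t..t + \<epsilon>}"
      "F (t + \<epsilon>) (y + w + b) - F t (y + w + b) = \<epsilon> * time_deriv T F \<xi> (y + w + b)" by auto
    have "\<xi> \<in> {0..T}" using \<xi>(1) t t\<epsilon> by auto
    from modulus(1)[OF this t, of "y + w + b" y]
    have "\<bar>time_deriv T F \<xi> (y + w + b) - time_deriv T F t y\<bar> \<le> \<kappa>' + C' * (\<bar>\<xi> - t\<bar> + (norm (w + b))\<^sup>2)"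
      by (simp add: add.assoc)
    also have "\<dots> \<le> \<kappa>' + C' * (\<epsilon> + H)"
      using \<xi>(1) near[of 1] C' by (intro add_left_mono mult_left_mono add_mono) auto
    finally have "\<epsilon> * \<bar>time_deriv T F \<xi> (y + w + b) - time_deriv T F t y\<bar> \<le> \<epsilon> * (\<kappa>' + C' * (\<epsilon> + H))"
      using \<epsilon> by (rule mult_left_mono)
    then have A: "\<bar>F (t + \<epsilon>) (y + w + b) - F t (y + w + b) - \<epsilon> * time_deriv T F t y\<bar> \<le> \<epsilon> * (\<kappa>' + C' * (\<epsilon> + H))"
      unfolding \<xi>(2) using \<epsilon> by (simp add: right_diff_distrib[symmetric] abs_mult)
    obtain \<theta> where \<theta>: "0 \<le> \<theta>" "\<theta> \<le> 1"
      "F t (y + w + b) - F t (y + w) = (\<Sum>k\<in>UNIV. b $ k * partial k (F t) (y + w + \<theta> *\<^sub>R b))"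
      by (rule mean_value_segment[where f="F t" and y="y + w" and h=b, OF dF])
    have "\<bar>F t (y + w + b) - F t (y + w) - (\<Sum>k\<in>UNIV. b $ k * partial k (F t) y)\<bar>
        = \<bar>\<Sum>k\<in>UNIV. b $ k * (partial k (F t) (y + w + \<theta> *\<^sub>R b) - partial k (F t) y)\<bar>"
      unfolding \<theta>(3) by (simp add: sum_subtractf right_diff_distrib)
    also have "\<dots> \<le> (\<Sum>k\<in>(UNIV :: 'd set). (B * \<epsilon>) * (\<kappa>' + C' * H))"
    proof (rule order_trans[OF sum_abs sum_mono])
      fix k
      have "\<bar>partial k (F t) (y + w + \<theta> *\<^sub>R b) - partial k (F t) y\<bar> \<le> \<kappa>' + C' * (\<bar>t - t\<bar> + (norm (w + \<theta> *\<^sub>R b))\<^sup>2)"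
        using modulus(2)[OF t t, of k "y + w + \<theta> *\<^sub>R b" y] by (simp add: add.assoc)
      also have "\<dots> \<le> \<kappa>' + C' * H"
        using near[OF \<theta>(1,2)] C' by (intro add_left_mono mult_left_mono) auto
      finally show "\<bar>b $ k * (partial k (F t) (y + w + \<theta> *\<^sub>R b) - partial k (F t) y)\<bar> \<le> (B * \<epsilon>) * (\<kappa>' + C' * H)"
        unfolding abs_mult using order_trans[OF component_le_norm_cart b, of k] \<open>B \<ge> 0\<close> \<epsilon>
        by (intro mult_mono) auto
    qed
    finally have Bd: "\<bar>F t (y + w + b) - F t (y + w) - (\<Sum>k\<in>UNIV. b $ k * partial k (F t) y)\<bar> \<le> d * (B * \<epsilon> * (\<kappa>' + C' * H))"
      by (simp add: d_def)
    obtain \<tau> where \<tau>: "0 \<le> \<tau>" "\<tau> \<le> 1" "F t (y + w) - F t y = (\<Sum>i\<in>UNIV. w $ i * partial i (F t) y) +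
        (\<Sum>i\<in>UNIV. \<Sum>j\<in>UNIV. w $ i * w $ j * partial j (partial i (F t)) (y + \<tau> *\<^sub>R w)) / 2"
      by (rule taylor_segment[where f="F t" and y=y and h=w, OF dF ddF])
    let ?S = "\<lambda>z. \<Sum>i\<in>UNIV. \<Sum>j\<in>UNIV. w $ i * w $ j * partial j (partial i (F t)) z"
    have "\<bar>?S (y + \<tau> *\<^sub>R w) - ?S y\<bar>
        = \<bar>\<Sum>i\<in>UNIV. \<Sum>j\<in>UNIV. w $ i * w $ j * (partial j (partial i (F t)) (y + \<tau> *\<^sub>R w) - partial j (partial i (F t)) y)\<bar>"
      by (simp add: sum_subtractf right_diff_distrib)
    also have "\<dots> \<le> (\<Sum>i\<in>(UNIV :: 'd set). \<Sum>j\<in>(UNIV :: 'd set). N * (\<kappa>' + C' * N))"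
    proof (rule order_trans[OF sum_abs sum_mono], rule order_trans[OF sum_abs sum_mono])
      fix i j
      have "\<bar>partial j (partial i (F t)) (y + \<tau> *\<^sub>R w) - partial j (partial i (F t)) y\<bar> \<le> \<kappa>' + C' * (\<bar>t - t\<bar> + (norm (\<tau> *\<^sub>R w))\<^sup>2)"
        using modulus(3)[OF t t, of j i "y + \<tau> *\<^sub>R w" y] by simp
      also have "\<dots> \<le> \<kappa>' + C' * N"
      proof -
        have "norm (\<tau> *\<^sub>R w) \<le> norm w" using \<tau>(1,2) by (simp add: mult_left_le_one_le)
        then have "(norm (\<tau> *\<^sub>R w))\<^sup>2 \<le> N" unfolding N_def by (rule power_mono) simp
        then show ?thesis using C' by (intro add_left_mono mult_left_mono) auto
      qed
      finally have *: "\<bar>partial j (partial i (F t)) (y + \<tau> *\<^sub>R w) - partial j (partial i (F t)) y\<bar> \<le> \<kappa>' + C' * N" .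
      have "\<bar>w $ i * w $ j\<bar> \<le> N"
        unfolding abs_mult N_def power2_eq_square by (intro mult_mono component_le_norm_cart) auto
      then show "\<bar>w $ i * w $ j * (partial j (partial i (F t)) (y + \<tau> *\<^sub>R w) - partial j (partial i (F t)) y)\<bar> \<le> N * (\<kappa>' + C' * N)"
        unfolding abs_mult[of "w $ i * w $ j"] using * N by (intro mult_mono) auto
    qed
    finally have Cc: "\<bar>?S (y + \<tau> *\<^sub>R w) - ?S y\<bar> \<le> d\<^sup>2 * (N * (\<kappa>' + C' * N))"
      by (simp add: d_def power2_eq_square)
    have split: "(\<Sum>i\<in>UNIV. (w + b) $ i * partial i (F t) y) =
       (\<Sum>i\<in>UNIV. w $ i * partial i (F t) y) + (\<Sum>i\<in>UNIV. b $ i * partial i (F t) y)"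
      by (simp add: sum.distrib distrib_right)
    have "\<bar>F (t + \<epsilon>) (y + w + b) - F t y - \<epsilon> * time_deriv T F t y - (\<Sum>i\<in>UNIV. (w + b) $ i * partial i (F t) y) - ?S y / 2\<bar>
      \<le> \<epsilon> * (\<kappa>' + C' * (\<epsilon> + H)) + d * (B * \<epsilon> * (\<kappa>' + C' * H)) + d\<^sup>2 * (N * (\<kappa>' + C' * N)) / 2"
      using A Bd Cc \<tau>(3) unfolding split by linarith
    also have "\<dots> \<le> \<kappa> * (\<epsilon> + N) + C * (\<epsilon>\<^sup>2 + \<epsilon> * N + N\<^sup>2)"
    proof -
      have e3: "\<epsilon> * \<epsilon>\<^sup>2 \<le> T * \<epsilon>\<^sup>2" using t t\<epsilon> by (intro mult_right_mono) auto
      have "\<epsilon> * (\<kappa>' + C' * (\<epsilon> + H)) + d * (B * \<epsilon> * (\<kappa>' + C' * H)) + d\<^sup>2 * (N * (\<kappa>' + C' * N)) / 2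
        = \<kappa>' * (\<epsilon> * (1 + B * d) + d\<^sup>2 * N / 2) + C' * (\<epsilon>\<^sup>2 + 2 * (1 + d * B) * (\<epsilon> * N) + 2 * (1 + d * B) * B\<^sup>2 * (\<epsilon> * \<epsilon>\<^sup>2) + d\<^sup>2 * N\<^sup>2 / 2)"
        unfolding H_def by (simp add: algebra_simps power2_eq_square)
      also have "\<dots> \<le> \<kappa>' * ((1 + B * d + d\<^sup>2) * (\<epsilon> + N)) +
         C' * ((1 + 2 * (1 + d * B) + 2 * (1 + d * B) * B\<^sup>2 * T + d\<^sup>2) * (\<epsilon>\<^sup>2 + \<epsilon> * N + N\<^sup>2))"
      proof (intro add_mono mult_left_mono)
        have "0 \<le> d\<^sup>2 * \<epsilon>" "0 \<le> d\<^sup>2 * N" "0 \<le> (1 + B * d) * N" using d N \<epsilon> \<open>B \<ge> 0\<close> by simp_all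
        then show "\<epsilon> * (1 + B * d) + d\<^sup>2 * N / 2 \<le> (1 + B * d + d\<^sup>2) * (\<epsilon> + N)"
          by (simp add: algebra_simps)
        define a where "a = 2 * (1 + d * B)"
        define c where "c = a * B\<^sup>2"
        have a: "a \<ge> 0" "c \<ge> 0" using d \<open>B \<ge> 0\<close> by (simp_all add: a_def c_def)
        have "c * (\<epsilon> * \<epsilon>\<^sup>2) \<le> c * T * \<epsilon>\<^sup>2" using mult_left_mono[OF e3 a(2)] by (simp add: mult.assoc)
        moreover have "0 \<le> a * \<epsilon>\<^sup>2" "0 \<le> d\<^sup>2 * \<epsilon>\<^sup>2" "0 \<le> \<epsilon> * N" "0 \<le> c * T * (\<epsilon> * N)" "0 \<le> d\<^sup>2 * (\<epsilon> * N)"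
          "0 \<le> N\<^sup>2" "0 \<le> a * N\<^sup>2" "0 \<le> c * T * N\<^sup>2" "0 \<le> d\<^sup>2 * N\<^sup>2"
          using a d N \<epsilon> \<open>T > 0\<close> by simp_all
        ultimately have "\<epsilon>\<^sup>2 + a * (\<epsilon> * N) + c * (\<epsilon> * \<epsilon>\<^sup>2) + d\<^sup>2 * N\<^sup>2 / 2 \<le> (1 + a + c * T + d\<^sup>2) * (\<epsilon>\<^sup>2 + \<epsilon> * N + N\<^sup>2)"
          unfolding distrib_left distrib_right mult_1 by linarith
        then show "\<epsilon>\<^sup>2 + 2 * (1 + d * B) * (\<epsilon> * N) + 2 * (1 + d * B) * B\<^sup>2 * (\<epsilon> * \<epsilon>\<^sup>2) + d\<^sup>2 * N\<^sup>2 / 2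
          \<le> (1 + 2 * (1 + d * B) + 2 * (1 + d * B) * B\<^sup>2 * T + d\<^sup>2) * (\<epsilon>\<^sup>2 + \<epsilon> * N + N\<^sup>2)"
          by (simp add: a_def c_def)
      qed (use \<kappa>' C' in auto)
      also have "\<dots> = \<kappa> * (\<epsilon> + N) + C * (\<epsilon>\<^sup>2 + \<epsilon> * N + N\<^sup>2)"
        unfolding C_def \<kappa>'(2)[symmetric] by (simp only: mult.assoc)
      finally show ?thesis .
    qed
    finally show ?thesis by (simp add: N_def)
  qed
  with C show ?thesis by (rule that)
qed

section \<open>Drift increments of the flow\<close>

context additive_flow
begin

lemma drift_increment:
  assumes "0 \<le> t" "0 \<le> r" "t + r \<le> T"
  shows "g (t + r) x - g t x - (c (t + r) - c t) = integral {t..t + r} (\<lambda>s. v s (g s x))"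
proof -
  have "integral {0..t} (\<lambda>s. v s (g s x)) + integral {t..t + r} (\<lambda>s. v s (g s x)) = integral {0..t + r} (\<lambda>s. v s (g s x))"
    by (rule Henstock_Kurzweil_Integration.integral_combine) (use assms in \<open>auto intro: integrable_drift\<close>)
  then show ?thesis
    using flow_eq[of "t + r" x] flow_eq[of t x] assms by (simp add: algebra_simps)
qed

lemma drift_increment_le:
  assumes "0 \<le> t" "0 \<le> r" "t + r \<le> T" and B: "\<And>s y. s \<in> {0..T} \<Longrightarrow> norm (v s y) \<le> B"
  shows "norm (g (t + r) x - g t x - (c (t + r) - c t)) \<le> B * r"
proof -
  have "(\<lambda>s. v s (g s x)) integrable_on {0..t + r}" using assms by (intro integrable_drift) auto
  then have "(\<lambda>s. v s (g s x)) integrable_on {t..t + r}"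
    by (rule integrable_subinterval_real) (use assms in auto)
  then have "norm (integral {t..t + r} (\<lambda>s. v s (g s x))) \<le> integral {t..t + r} (\<lambda>_. B)"
    by (rule integral_norm_bound_integral) (use assms in \<open>auto intro: B\<close>)
  then show ?thesis unfolding drift_increment[OF assms(1-3)] using assms(2) by (simp add: mult.commute)
qed

lemma drift_increment_tendsto:
  assumes t: "0 \<le> t" and r: "r \<longlonglongrightarrow> 0" "\<And>n::nat. 0 < r n" "\<And>n. t + r n \<le> T"
  shows "(\<lambda>n. (g (t + r n) x - g t x - (c (t + r n) - c t)) $ i / r n) \<longlonglongrightarrow> v t (g t x) $ i"
proof -
  define J where "J u = integral {0..u} (\<lambda>s. v s (g s x))" for u
  have tT: "t \<in> {0..T}" using t r(2,3)[of 0] by simp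
  have "(J has_vector_derivative v t (g t x)) (at t within {0..T})"
    unfolding J_def
    by (rule integral_has_vector_derivative[OF _ tT]) (intro continuous_on_along_flow C01_continuous C01_drift)
  then have "((\<lambda>u. J u $ i) has_vector_derivative v t (g t x) $ i) (at t within {0..T})"
    by (rule bounded_linear.has_vector_derivative[OF bounded_linear_vec_nth])
  then have "((\<lambda>u. (J u $ i - J t $ i) / (u - t)) \<longlongrightarrow> v t (g t x) $ i) (at t within {0..T})"
    by (simp add: has_real_derivative_iff_has_vector_derivative[symmetric] has_field_derivative_iff)
  moreover have "filterlim (\<lambda>n. t + r n) (at t within {0..T}) sequentially"
    unfolding filterlim_at using r t
    by (auto intro!: tendsto_eq_intros always_eventually simp: less_imp_le add_nonneg_nonneg less_imp_neq[symmetric])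
  ultimately have "(\<lambda>n. (J (t + r n) $ i - J t $ i) / (t + r n - t)) \<longlonglongrightarrow> v t (g t x) $ i"
    by (rule filterlim_compose)
  moreover have "g (t + r n) x - g t x - (c (t + r n) - c t) = J (t + r n) - J t" for n
    using flow_eq[of "t + r n" x] flow_eq[OF tT, of x] r(2)[of n] r(3)[of n] t by (simp add: J_def)
  ultimately show ?thesis by simp
qed

end

section \<open>Conditional expectations of Wiener increments\<close>

lemma (in prob_space) normal_moments:
  assumes X: "distributed M lborel X (normal_density 0 \<sigma>)" and \<sigma>: "\<sigma> > 0"
  shows "integrable M (\<lambda>\<omega>. X \<omega> ^ k)" and "expectation X = 0"
    and "expectation (\<lambda>\<omega>. X \<omega> ^ 2) = \<sigma>\<^sup>2" and "expectation (\<lambda>\<omega>. X \<omega> ^ 4) = 3 * \<sigma> ^ 4"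
proof -
  have E: "expectation (\<lambda>\<omega>. X \<omega> ^ k) = (\<integral>x. normal_density 0 \<sigma> x * x ^ k \<partial>lborel)" for k
    by (rule distributed_integral[OF X, symmetric]) auto
  have "integrable lborel (\<lambda>x. normal_density 0 \<sigma> x * x ^ k)"
    using integrable_normal_moment[OF \<sigma>, of 0 k] by simp
  then show "integrable M (\<lambda>\<omega>. X \<omega> ^ k)"
    using distributed_integrable[OF X, of "\<lambda>x. x ^ k"] by simp
  show "expectation X = 0"
    using E[of 1] integral_normal_moment_odd[OF \<sigma>, of 0 0] by simp
  show "expectation (\<lambda>\<omega>. X \<omega> ^ 2) = \<sigma>\<^sup>2"
    using E[of 2] integral_normal_moment_even[OF \<sigma>, of 0 1] by simp
  show "expectation (\<lambda>\<omega>. X \<omega> ^ 4) = 3 * \<sigma> ^ 4"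
    using E[of 4] integral_normal_moment_even[OF \<sigma>, of 0 2]
    by (simp add: fact_numeral power_divide power_mult[symmetric])
qed

text \<open>
  Weights known at the earlier time come out of the conditional expectation, and a function of an
  independent increment then has its mean as conditional expectation.
\<close>

lemma (in prob_space) cond_exp_indep_zero:
  fixes w :: "'a \<Rightarrow> 'b::euclidean_space" and \<phi> :: "'b \<Rightarrow> real"
  assumes sub: "subalgebra M F" and w: "w \<in> borel_measurable M"
    and ind: "indep_set (sets F) (sets (vimage_algebra (space M) w borel))"
    and \<phi>: "\<phi> \<in> borel_measurable borel" and int: "integrable M (\<lambda>\<omega>. \<phi> (w \<omega>))"
    and zero: "expectation (\<lambda>\<omega>. \<phi> (w \<omega>)) = 0"
    and c: "c \<in> borel_measurable F" and K: "\<And>\<omega>. \<bar>c \<omega>\<bar> \<le> K"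
  shows "integrable M (\<lambda>\<omega>. c \<omega> * \<phi> (w \<omega>))"
    and "AE \<omega> in M. real_cond_exp M F (\<lambda>\<omega>. c \<omega> * \<phi> (w \<omega>)) \<omega> = 0"
proof -
  interpret finite_measure_subalgebra M F by standard (rule sub)
  have [measurable]: "w \<in> borel_measurable M" "\<phi> \<in> borel_measurable borel" by (fact w \<phi>)+
  have cM[measurable]: "c \<in> borel_measurable M" by (rule measurable_from_subalg[OF sub c])
  show int_c: "integrable M (\<lambda>\<omega>. c \<omega> * \<phi> (w \<omega>))"
  proof (rule Bochner_Integration.integrable_bound)
    show "integrable M (\<lambda>\<omega>. K * \<phi> (w \<omega>))" using int by simp
    show "AE \<omega> in M. norm (c \<omega> * \<phi> (w \<omega>)) \<le> norm (K * \<phi> (w \<omega>))"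
    proof (rule AE_I2)
      fix \<omega> show "norm (c \<omega> * \<phi> (w \<omega>)) \<le> norm (K * \<phi> (w \<omega>))"
        using K[of \<omega>] by (auto simp: abs_mult intro!: mult_right_mono)
    qed
  qed measurable
  have "AE \<omega> in M. real_cond_exp M F (\<lambda>\<omega>. \<phi> (w \<omega>)) \<omega> = 0"
  proof (rule real_cond_exp_charact)
    fix A assume A: "A \<in> sets F"
    then have AM[measurable]: "A \<in> sets M" using sub by (auto simp: subalgebra_def)
    have "indep_var borel (indicator A :: 'a \<Rightarrow> real) borel (\<lambda>\<omega>. \<phi> (w \<omega>))"
      unfolding indep_var_eq
    proof (intro conjI)
      have "sigma_sets (space M) {indicator A -` B \<inter> space M |B. B \<in> sets (borel :: real measure)} \<subseteq> sets F"
      proof -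
        have "(indicator A :: 'a \<Rightarrow> real) \<in> borel_measurable F" using A by simp
        then have "{indicator A -` B \<inter> space M |B. B \<in> sets (borel :: real measure)} \<subseteq> sets F"
          using sub by (auto simp: subalgebra_def dest: measurable_sets)
        then show ?thesis using sub sets.sigma_sets_subset[of _ F] by (simp add: subalgebra_def)
      qed
      moreover have "sigma_sets (space M) {(\<lambda>\<omega>. \<phi> (w \<omega>)) -` B \<inter> space M |B. B \<in> sets borel} \<subseteq> sets (vimage_algebra (space M) w borel)"
      proof -
        have "(\<lambda>\<omega>. \<phi> (w \<omega>)) -` B \<inter> space M \<in> sets (vimage_algebra (space M) w borel)" if "B \<in> sets borel" for B
        proof -
          have "\<phi> -` B \<in> sets borel" using measurable_sets[OF \<phi> that] by simp
          then have "w -` (\<phi> -` B) \<inter> space M \<in> sets (vimage_algebra (space M) w borel)" by (rule in_vimage_algebra)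
          then show ?thesis by (simp add: vimage_def)
        qed
        then show ?thesis
          using sets.sigma_sets_subset[of "{(\<lambda>\<omega>. \<phi> (w \<omega>)) -` B \<inter> space M |B. B \<in> sets borel}" "vimage_algebra (space M) w borel"]
          by auto
      qed
      ultimately show "indep_set (sigma_sets (space M) {indicator A -` B \<inter> space M |B. B \<in> sets (borel :: real measure)})
          (sigma_sets (space M) {(\<lambda>\<omega>. \<phi> (w \<omega>)) -` B \<inter> space M |B. B \<in> sets borel})"
        unfolding indep_set_def
        by (intro indep_sets_mono_sets[OF ind[unfolded indep_set_def]]) (auto split: bool.split)
    qed measurable
    then have "expectation (\<lambda>\<omega>. indicator A \<omega> * \<phi> (w \<omega>)) = expectation (indicator A) * expectation (\<lambda>\<omega>. \<phi> (w \<omega>))"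
      using int by (intro indep_var_lebesgue_integral) (auto intro!: integrable_real_indicator simp: emeasure_eq_measure)
    then show "(\<integral>\<omega>\<in>A. \<phi> (w \<omega>) \<partial>M) = (\<integral>\<omega>\<in>A. 0 \<partial>M)"
      by (simp add: zero set_lebesgue_integral_def)
  qed (use int in auto)
  moreover have "AE \<omega> in M. real_cond_exp M F (\<lambda>\<omega>. c \<omega> * \<phi> (w \<omega>)) \<omega> = c \<omega> * real_cond_exp M F (\<lambda>\<omega>. \<phi> (w \<omega>)) \<omega>"
    by (rule real_cond_exp_mult[OF c _ int_c]) measurable
  ultimately show "AE \<omega> in M. real_cond_exp M F (\<lambda>\<omega>. c \<omega> * \<phi> (w \<omega>)) \<omega> = 0" by auto
qed

lemma (in sigma_finite_subalgebra) integral_abs_real_cond_exp_le: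
  assumes "integrable M f"
  shows "(\<integral>x. \<bar>real_cond_exp M F f x\<bar> \<partial>M) \<le> (\<integral>x. \<bar>f x\<bar> \<partial>M)"
proof -
  have i: "integrable M (\<lambda>x. \<bar>f x\<bar>)" using assms by simp
  have "AE x in M. real_cond_exp M F f x \<le> real_cond_exp M F (\<lambda>x. \<bar>f x\<bar>) x"
    by (rule real_cond_exp_mono[OF _ assms i]) simp
  moreover have "AE x in M. real_cond_exp M F (\<lambda>x. - 1 * f x) x \<le> real_cond_exp M F (\<lambda>x. \<bar>f x\<bar>) x"
    by (rule real_cond_exp_mono[OF _ _ i]) (use assms in auto)
  moreover have "AE x in M. real_cond_exp M F (\<lambda>x. - 1 * f x) x = - 1 * real_cond_exp M F f x"
    by (rule real_cond_exp_cmult[OF assms])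
  ultimately have "AE x in M. \<bar>real_cond_exp M F f x\<bar> \<le> real_cond_exp M F (\<lambda>x. \<bar>f x\<bar>) x" by auto
  then have "(\<integral>x. \<bar>real_cond_exp M F f x\<bar> \<partial>M) \<le> (\<integral>x. real_cond_exp M F (\<lambda>x. \<bar>f x\<bar>) x \<partial>M)"
    by (intro integral_mono_AE) (auto intro: real_cond_exp_int assms i)
  then show ?thesis using real_cond_exp_int(2)[OF i] by simp
qed

lemma norm_cart_power2: "(norm (w :: real ^ 'd))\<^sup>2 = (\<Sum>i\<in>UNIV. (w $ i)\<^sup>2)"
  by (simp add: norm_vec_def L2_set_def sum_nonneg)

lemma norm_cart_power4_le: "norm (w :: real ^ 'd) ^ 4 \<le> real CARD('d) * (\<Sum>i\<in>UNIV. (w $ i) ^ 4)"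
proof -
  have "norm w ^ 4 = ((norm w)\<^sup>2)\<^sup>2" by simp
  also have "\<dots> \<le> (\<Sum>i\<in>UNIV. ((w $ i)\<^sup>2)\<^sup>2) * card (UNIV :: 'd set)"
    unfolding norm_cart_power2 by (rule sum_squared_le_sum_of_squares)
  finally show ?thesis by (simp add: mult.commute)
qed

locale stochastic_flow_setting = prob_space M for M :: "'w measure" +
  fixes P :: "real \<Rightarrow> 'w measure" and T \<nu> :: real and v :: "real \<Rightarrow> real ^ 'd \<Rightarrow> real ^ 'd"
    and W :: "real \<Rightarrow> 'w \<Rightarrow> real ^ 'd" and g :: "real \<Rightarrow> real ^ 'd \<Rightarrow> 'w \<Rightarrow> real ^ 'd"
  assumes filt: "usual_filtration M P" and wiener: "wiener_process M P W"
    and flow: "stochastic_flow M P T \<nu> v W g" and \<nu>: "\<nu> > 0" and T: "T > 0"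
    and v: "C01 T v" and per_v: "periodic T v"
begin

lemma subalg: "0 \<le> t \<Longrightarrow> subalgebra M (P t)"
  using filt by (simp add: usual_filtration_def)

lemma measurable_flow: "t \<in> {0..T} \<Longrightarrow> g t x \<in> borel_measurable (P t)"
  using flow by (simp add: stochastic_flow_def)

lemma measurable_flow': "t \<in> {0..T} \<Longrightarrow> g t x \<in> borel_measurable M"
  using measurable_from_subalg[OF subalg measurable_flow] by simp

lemma measurable_wiener: "0 \<le> t \<Longrightarrow> W t \<in> borel_measurable M"
  using measurable_from_subalg[OF subalg, of t "W t" borel] wiener by (simp add: wiener_process_def)

lemma AE_additive_flow: "AE \<omega> in M. \<exists>L. additive_flow T L v (\<lambda>s. sqrt (2 * \<nu>) *\<^sub>R W s \<omega>) (\<lambda>s x. g s x \<omega>)"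
proof -
  obtain L where L: "L \<ge> 0" "\<And>t y z. t \<in> {0..T} \<Longrightarrow> norm (v t y - v t z) \<le> L * norm (y - z)"
    by (rule periodic_lipschitz[OF v per_v]) blast
  have "AE \<omega> in M. continuous_on {0..} (\<lambda>t. W t \<omega>)"
    using wiener by (simp add: wiener_process_def)
  moreover have "AE \<omega> in M. \<forall>t\<in>{0..T}. \<forall>x. (\<lambda>s. v s (g s x \<omega>)) integrable_on {0..t} \<and>
        g t x \<omega> = x + sqrt (2 * \<nu>) *\<^sub>R W t \<omega> + integral {0..t} (\<lambda>s. v s (g s x \<omega>))"
    using flow by (simp add: stochastic_flow_def)
  ultimately show ?thesis
  proof eventually_elim
    case (elim \<omega>)
    have "continuous_on {0..T} (\<lambda>s. sqrt (2 * \<nu>) *\<^sub>R W s \<omega>)"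
      by (intro continuous_intros continuous_on_subset[OF elim(1)]) auto
    then have "additive_flow T L v (\<lambda>s. sqrt (2 * \<nu>) *\<^sub>R W s \<omega>) (\<lambda>s x. g s x \<omega>)"
      unfolding additive_flow_def using elim(2) L v by blast
    then show ?case by blast
  qed
qed

context
  fixes t \<epsilon> :: real
  assumes t: "0 \<le> t" and \<epsilon>: "0 < \<epsilon>"
begin

abbreviation "\<Delta>W \<equiv> \<lambda>\<omega>. W (t + \<epsilon>) \<omega> - W t \<omega>"

lemma increment:
  shows increment_normal: "distributed M lborel (\<lambda>\<omega>. \<Delta>W \<omega> $ i) (normal_density 0 (sqrt \<epsilon>))"
    and increment_indep_vars: "indep_vars (\<lambda>_. borel) (\<lambda>i \<omega>. \<Delta>W \<omega> $ i) UNIV"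
    and increment_indep: "indep_set (sets (P t)) (sets (vimage_algebra (space M) \<Delta>W borel))"
proof -
  have "\<forall>s t. 0 \<le> s \<longrightarrow> s < t \<longrightarrow>
        (\<forall>i. distributed M lborel (\<lambda>\<omega>. (W t \<omega> - W s \<omega>) $ i) (normal_density 0 (sqrt (t - s)))) \<and>
        indep_vars (\<lambda>_. borel) (\<lambda>i \<omega>. (W t \<omega> - W s \<omega>) $ i) UNIV \<and>
        indep_set (sets (P s)) (sets (vimage_algebra (space M) (\<lambda>\<omega>. W t \<omega> - W s \<omega>) borel))"
    using wiener by (simp add: wiener_process_def)
  from this[rule_format, OF t, of "t + \<epsilon>"] \<epsilon>
  show "distributed M lborel (\<lambda>\<omega>. \<Delta>W \<omega> $ i) (normal_density 0 (sqrt \<epsilon>))"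
    "indep_vars (\<lambda>_. borel) (\<lambda>i \<omega>. \<Delta>W \<omega> $ i) UNIV"
    "indep_set (sets (P t)) (sets (vimage_algebra (space M) \<Delta>W borel))"
    by simp_all
qed

lemma measurable_increment: "\<Delta>W \<in> borel_measurable M"
  using measurable_wiener[of t] measurable_wiener[of "t + \<epsilon>"] t \<epsilon> by simp

lemma increment_moments:
  shows "integrable M (\<lambda>\<omega>. \<Delta>W \<omega> $ i)" "expectation (\<lambda>\<omega>. \<Delta>W \<omega> $ i) = 0"
    and "integrable M (\<lambda>\<omega>. \<Delta>W \<omega> $ i * \<Delta>W \<omega> $ j)"
    and "expectation (\<lambda>\<omega>. \<Delta>W \<omega> $ i * \<Delta>W \<omega> $ j) = (if i = j then \<epsilon> else 0)"
proof -
  have s: "sqrt \<epsilon> > 0" using \<epsilon> by simp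
  note m = normal_moments[OF increment_normal s]
  show i1: "integrable M (\<lambda>\<omega>. \<Delta>W \<omega> $ i)" for i using m(1)[of i 1] by simp
  show e1: "expectation (\<lambda>\<omega>. \<Delta>W \<omega> $ i) = 0" for i using m(2)[of i] .
  have "integrable M (\<lambda>\<omega>. \<Delta>W \<omega> $ i * \<Delta>W \<omega> $ j) \<and> expectation (\<lambda>\<omega>. \<Delta>W \<omega> $ i * \<Delta>W \<omega> $ j) = (if i = j then \<epsilon> else 0)"
  proof (cases "i = j")
    case True
    then show ?thesis using m(1)[of i 2] m(3)[of i] \<epsilon> by (simp add: power2_eq_square)
  next
    case False
    have ind: "indep_vars (\<lambda>_. borel) (\<lambda>i \<omega>. \<Delta>W \<omega> $ i) {i, j}"
      using increment_indep_vars by (rule indep_vars_subset) simp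
    from indep_vars_lebesgue_integral[OF _ ind i1] indep_vars_integrable[OF _ ind i1] False e1[of i]
    show ?thesis by simp
  qed
  then show "integrable M (\<lambda>\<omega>. \<Delta>W \<omega> $ i * \<Delta>W \<omega> $ j)"
    "expectation (\<lambda>\<omega>. \<Delta>W \<omega> $ i * \<Delta>W \<omega> $ j) = (if i = j then \<epsilon> else 0)" by auto
qed

lemma increment_norm_moments:
  shows "integrable M (\<lambda>\<omega>. (norm (\<Delta>W \<omega>))\<^sup>2)" "expectation (\<lambda>\<omega>. (norm (\<Delta>W \<omega>))\<^sup>2) = real CARD('d) * \<epsilon>"
    and "integrable M (\<lambda>\<omega>. norm (\<Delta>W \<omega>) ^ 4)"
    and "expectation (\<lambda>\<omega>. norm (\<Delta>W \<omega>) ^ 4) \<le> 3 * (real CARD('d))\<^sup>2 * \<epsilon>\<^sup>2"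
proof -
  have s: "sqrt \<epsilon> > 0" using \<epsilon> by simp
  note m = normal_moments[OF increment_normal s]
  show "integrable M (\<lambda>\<omega>. (norm (\<Delta>W \<omega>))\<^sup>2)"
    unfolding norm_cart_power2 by (rule Bochner_Integration.integrable_sum) (rule m)
  show "expectation (\<lambda>\<omega>. (norm (\<Delta>W \<omega>))\<^sup>2) = real CARD('d) * \<epsilon>"
    unfolding norm_cart_power2
    by (subst Bochner_Integration.integral_sum) (use m(1) m(3) \<epsilon> in simp_all)
  have i4: "integrable M (\<lambda>\<omega>. real CARD('d) * (\<Sum>i\<in>UNIV. (\<Delta>W \<omega> $ i) ^ 4))"
    by (intro integrable_mult_right Bochner_Integration.integrable_sum m)
  have [measurable]: "\<Delta>W \<in> borel_measurable M" by (rule measurable_increment)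
  show i: "integrable M (\<lambda>\<omega>. norm (\<Delta>W \<omega>) ^ 4)"
  proof (rule Bochner_Integration.integrable_bound[OF i4])
    show "AE \<omega> in M. norm (norm (\<Delta>W \<omega>) ^ 4) \<le> norm (real CARD('d) * (\<Sum>i\<in>UNIV. (\<Delta>W \<omega> $ i) ^ 4))"
    proof (rule AE_I2)
      fix \<omega>
      show "norm (norm (\<Delta>W \<omega>) ^ 4) \<le> norm (real CARD('d) * (\<Sum>i\<in>UNIV. (\<Delta>W \<omega> $ i) ^ 4))"
        using order_trans[OF norm_cart_power4_le[of "\<Delta>W \<omega>"] abs_ge_self] by simp
    qed
  qed measurable
  have "expectation (\<lambda>\<omega>. norm (\<Delta>W \<omega>) ^ 4) \<le> expectation (\<lambda>\<omega>. real CARD('d) * (\<Sum>i\<in>UNIV. (\<Delta>W \<omega> $ i) ^ 4))"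
    by (rule integral_mono[OF i i4]) (rule norm_cart_power4_le)
  also have "\<dots> = real CARD('d) * (\<Sum>i\<in>(UNIV :: 'd set). 3 * sqrt \<epsilon> ^ 4)"
    by (subst integral_mult_right_zero, subst Bochner_Integration.integral_sum) (use m in simp_all)
  also have "sqrt \<epsilon> ^ 4 = \<epsilon>\<^sup>2"
    using \<epsilon> power_mult[of "sqrt \<epsilon>" 2 2] by simp
  finally show "expectation (\<lambda>\<omega>. norm (\<Delta>W \<omega>) ^ 4) \<le> 3 * (real CARD('d))\<^sup>2 * \<epsilon>\<^sup>2"
    by (simp add: power2_eq_square mult_ac)
qed

end

end

lemma periodic_generator:
  assumes "periodic T (time_deriv T F)" "\<And>i. periodic T (\<lambda>t. partial i (F t))" "periodic T v"
  shows "periodic T (generator T \<nu> v F)"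
  using assms(1,3) assms(2) periodic_partial[OF assms(2)]
  by (simp add: periodic_def generator_def advect_def laplacian_def)

lemma (in sigma_finite_subalgebra) real_cond_exp_sum_zero:
  fixes u :: "'i::finite \<Rightarrow> 'a \<Rightarrow> real"
  assumes "\<And>i. integrable M (u i)" "\<And>i. AE x in M. real_cond_exp M F (u i) x = 0"
  shows "AE x in M. real_cond_exp M F (\<lambda>x. \<Sum>i\<in>UNIV. u i x) x = 0"
proof -
  have "AE x in M. \<forall>i\<in>UNIV. real_cond_exp M F (u i) x = 0"
    by (rule AE_finite_allI) (auto intro: assms)
  moreover have "AE x in M. real_cond_exp M F (\<lambda>x. \<Sum>i\<in>UNIV. u i x) x = (\<Sum>i\<in>UNIV. real_cond_exp M F (u i) x)"
    by (rule real_cond_exp_sum[OF assms(1)])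
  ultimately show ?thesis by auto
qed

context stochastic_flow_setting
begin

text \<open>
  Ito's formula in conditional mean. Periodicity is asked of the derivatives of \<open>F\<close> instead of \<open>F\<close>
  itself, so that the coordinates of the lifted flow are covered.
\<close>

theorem gen_deriv_eq_generator:
  fixes F :: "real \<Rightarrow> real ^ 'd \<Rightarrow> real"
  assumes t: "0 \<le> t" "t < T" and F: "C12 T F" and per_t: "periodic T (time_deriv T F)"
    and per_x: "\<And>i. periodic T (\<lambda>t. partial i (F t))"
    and D: "has_gen_deriv M P T t (\<lambda>s \<omega>. F s (g s x \<omega>)) D"
  shows "AE \<omega> in M. D \<omega> = generator T \<nu> v F t (g t x \<omega>)"
proof -
  let ?L1 = "\<lambda>f. \<integral>\<omega>. \<bar>f \<omega>\<bar> \<partial>M"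
  have tT: "t \<in> {0..T}" using t by simp
  interpret E: finite_measure_subalgebra M "P t" by standard (rule subalg[OF t(1)])
  define a where "a = sqrt (2 * \<nu>)"
  have a2: "a * a = 2 * \<nu>" using \<nu> by (simp add: a_def)
  \<comment> \<open>The limit \<open>D\<close> is given, so one sequence of time steps is enough to identify it.\<close>
  define e where "e n = (T - t) / real (Suc n)" for n
  have e_pos: "0 < e n" for n using t by (simp add: e_def)
  have e_le: "t + e n \<le> T" for n
  proof -
    have "e n \<le> T - t" using t by (simp add: e_def divide_le_eq mult_le_cancel_left1)
    then show ?thesis by simp
  qed
  have e_T: "t + e n \<in> {0..T}" for n using t e_pos[of n] e_le[of n] by simp
  have e_lim: "e \<longlonglongrightarrow> 0"
    unfolding e_def using tendsto_mult[OF tendsto_const LIMSEQ_inverse_real_of_nat, of "T - t"]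
    by (simp add: divide_inverse)
  define y where "y \<omega> = g t x \<omega>" for \<omega>
  define dW where "dW n \<omega> = W (t + e n) \<omega> - W t \<omega>" for n \<omega>
  define b where "b n \<omega> = g (t + e n) x \<omega> - y \<omega> - a *\<^sub>R dW n \<omega>" for n \<omega>
  define f where "f i \<omega> = partial i (F t) (y \<omega>)" for i \<omega>
  define h where "h i j \<omega> = partial j (partial i (F t)) (y \<omega>)" for i j \<omega>
  define Lg where "Lg \<omega> = generator T \<nu> v F t (y \<omega>)" for \<omega>
  define Z where "Z n \<omega> = F (t + e n) (g (t + e n) x \<omega>) - F t (y \<omega>)" for n \<omega>
  have Z_int: "integrable M (Z n)" for n
    using D e_pos[of n] e_le[of n] unfolding has_gen_deriv_def Z_def y_def by auto
  have gen: "Lg \<omega> = time_deriv T F t (y \<omega>) + (\<Sum>i\<in>UNIV. v t (y \<omega>) $ i * f i \<omega>) + \<nu> * (\<Sum>i\<in>UNIV. h i i \<omega>)" for \<omega>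
    by (simp add: Lg_def generator_def advect_def laplacian_def f_def h_def)

  have y_meas: "y \<in> borel_measurable (P t)"
    unfolding y_def by (rule measurable_flow[OF tT])
  have meas_y: "(\<lambda>\<omega>. \<phi> (y \<omega>)) \<in> borel_measurable (P t)" if "continuous_on UNIV \<phi>" for \<phi> :: "real ^ 'd \<Rightarrow> real"
    using measurable_comp[OF y_meas borel_measurable_continuous_onI[OF that]] by (simp add: o_def)
  have f_meas: "f i \<in> borel_measurable (P t)" for i
    unfolding f_def by (intro meas_y continuous_on_slice[OF C01_continuous[OF C12_partial[OF F]] tT])
  have h_meas: "h i j \<in> borel_measurable (P t)" for i j
    unfolding h_def by (intro meas_y continuous_on_slice[OF C01_continuous_partial[OF C12_partial[OF F]] tT])
  have L_meas: "Lg \<in> borel_measurable (P t)"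
    unfolding Lg_def by (intro meas_y continuous_on_slice[OF continuous_on_generator[OF F v] tT])
  have v_meas: "(\<lambda>\<omega>. v t (y \<omega>) $ i) \<in> borel_measurable (P t)" for i
    by (intro meas_y continuous_on_component continuous_on_slice[OF C01_continuous[OF v] tT])
  note from_Pt = measurable_from_subalg[OF subalg[OF t(1)]]
  have [measurable]: "f i \<in> borel_measurable M" "h i j \<in> borel_measurable M" "Lg \<in> borel_measurable M"
    "(\<lambda>\<omega>. v t (y \<omega>) $ i) \<in> borel_measurable M" "y \<in> borel_measurable M" for i j
    by (rule from_Pt[OF f_meas] from_Pt[OF h_meas] from_Pt[OF L_meas] from_Pt[OF v_meas] from_Pt[OF y_meas])+
  have [measurable]: "dW n \<in> borel_measurable M" for n
    unfolding dW_def using measurable_increment[OF t(1) e_pos] .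
  have b_meas: "b n \<in> borel_measurable M" for n
    unfolding b_def using measurable_flow'[OF e_T[of n]] by measurable
  have [measurable]: "(\<lambda>\<omega>. b n \<omega> $ i) \<in> borel_measurable M" for n i
    by (rule borel_measurable_continuous_on[OF _ b_meas]) (intro continuous_intros)
  have "\<exists>K. \<forall>\<omega>. \<bar>f i \<omega>\<bar> \<le> K" for i
    unfolding f_def using periodic_bounded[OF C01_continuous[OF C12_partial[OF F]] per_x] tT
    by (metis real_norm_def)
  then obtain Kf where Kf: "\<And>i \<omega>. \<bar>f i \<omega>\<bar> \<le> Kf i" by metis
  have "\<exists>K. \<forall>\<omega>. \<bar>h i j \<omega>\<bar> \<le> K" for i j
    unfolding h_def
    using periodic_bounded[OF C01_continuous_partial[OF C12_partial[OF F]] periodic_partial[OF per_x]] tT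
    by (metis real_norm_def)
  then obtain Kh where Kh: "\<And>i j \<omega>. \<bar>h i j \<omega>\<bar> \<le> Kh i j" by metis
  obtain KL where KL: "\<And>\<omega>. \<bar>Lg \<omega>\<bar> \<le> KL"
    unfolding Lg_def
    using periodic_bounded[OF continuous_on_generator[OF F v] periodic_generator[OF per_t per_x per_v]] tT
    by (metis real_norm_def)
  obtain B where B: "B \<ge> 0" "\<And>s z. s \<in> {0..T} \<Longrightarrow> norm (v s z) \<le> B"
    by (rule periodic_bounded[OF C01_continuous[OF v] per_v]) blast
  have Kf0: "0 \<le> Kf i" for i using Kf[of i undefined] by linarith

  \<comment> \<open>The first-order noise term, and the second-order one after its mean has been subtracted: that
    mean, \<open>\<nu> (e n) \<Delta> F\<close>, is the second-order part of the generator. As \<open>a\<^sup>2 / 2 = \<nu>\<close>, the factor of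
    the second-order term is \<open>\<nu>\<close>.\<close>
  define S1 where "S1 n i \<omega> = f i \<omega> * (a * dW n \<omega> $ i)" for n i \<omega>
  define S2 where "S2 n i j \<omega> = h i j \<omega> * (\<nu> * (dW n \<omega> $ i * dW n \<omega> $ j - (if i = j then e n else 0)))" for n i j \<omega>
  have S1: "integrable M (S1 n i)" "AE \<omega> in M. real_cond_exp M (P t) (S1 n i) \<omega> = 0" for n i
  proof -
    note m = increment_moments[OF t(1) e_pos, of n, folded dW_def]
    note * = cond_exp_indep_zero[OF subalg[OF t(1)] _ increment_indep[OF t(1) e_pos, of n, folded dW_def] _ _ _ f_meas Kf,
        where \<phi>="\<lambda>w. a * w $ i"]
    show "integrable M (S1 n i)" "AE \<omega> in M. real_cond_exp M (P t) (S1 n i) \<omega> = 0"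
      unfolding S1_def by (rule *; use m(1,2)[of i] in simp)+
  qed
  have S2: "integrable M (S2 n i j)" "AE \<omega> in M. real_cond_exp M (P t) (S2 n i j) \<omega> = 0" for n i j
  proof -
    note m = increment_moments[OF t(1) e_pos, of n, folded dW_def]
    have m4: "integrable M (\<lambda>\<omega>. \<nu> * (dW n \<omega> $ i * dW n \<omega> $ j - (if i = j then e n else 0)))"
      by (intro integrable_mult_right Bochner_Integration.integrable_diff m(3)) simp
    have m5: "expectation (\<lambda>\<omega>. \<nu> * (dW n \<omega> $ i * dW n \<omega> $ j - (if i = j then e n else 0))) = 0"
      by (subst integral_mult_right_zero, subst Bochner_Integration.integral_diff[OF m(3)]) (simp_all add: m(4) prob_space)
    have m6: "(\<lambda>w :: real ^ 'd. \<nu> * (w $ i * w $ j - (if i = j then e n else 0))) \<in> borel_measurable borel"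
      by (intro borel_measurable_continuous_onI continuous_intros)
    note * = cond_exp_indep_zero[OF subalg[OF t(1)] _ increment_indep[OF t(1) e_pos, of n, folded dW_def] m6 m4 m5 h_meas Kh]
    show "integrable M (S2 n i j)" "AE \<omega> in M. real_cond_exp M (P t) (S2 n i j) \<omega> = 0"
      unfolding S2_def by (rule *, measurable)+
  qed
  define S where "S n \<omega> = (\<Sum>i\<in>UNIV. S1 n i \<omega>) + (\<Sum>i\<in>UNIV. \<Sum>j\<in>UNIV. S2 n i j \<omega>)" for n \<omega>
  have S_int1: "integrable M (\<lambda>\<omega>. \<Sum>i\<in>UNIV. S1 n i \<omega>)" "integrable M (\<lambda>\<omega>. \<Sum>j\<in>UNIV. S2 n i j \<omega>)"
    "integrable M (\<lambda>\<omega>. \<Sum>i\<in>UNIV. \<Sum>j\<in>UNIV. S2 n i j \<omega>)" for n i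
    by (intro Bochner_Integration.integrable_sum S1 S2)+
  have S_int: "integrable M (S n)" for n
    unfolding S_def by (intro Bochner_Integration.integrable_add S_int1)
  have S_zero: "AE \<omega> in M. real_cond_exp M (P t) (S n) \<omega> = 0" for n
  proof -
    have "AE \<omega> in M. real_cond_exp M (P t) (\<lambda>\<omega>. \<Sum>i\<in>UNIV. S1 n i \<omega>) \<omega> = 0"
      by (rule E.real_cond_exp_sum_zero[OF S1])
    moreover have "AE \<omega> in M. real_cond_exp M (P t) (\<lambda>\<omega>. \<Sum>i\<in>UNIV. \<Sum>j\<in>UNIV. S2 n i j \<omega>) \<omega> = 0"
      by (rule E.real_cond_exp_sum_zero[OF S_int1(2) E.real_cond_exp_sum_zero[OF S2]])
    moreover have "AE \<omega> in M. real_cond_exp M (P t) (S n) \<omega> =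
        real_cond_exp M (P t) (\<lambda>\<omega>. \<Sum>i\<in>UNIV. S1 n i \<omega>) \<omega> + real_cond_exp M (P t) (\<lambda>\<omega>. \<Sum>i\<in>UNIV. \<Sum>j\<in>UNIV. S2 n i j \<omega>) \<omega>"
      unfolding S_def by (rule E.real_cond_exp_add[OF S_int1(1,3)])
    ultimately show ?thesis by auto
  qed

  \<comment> \<open>What is left has to be \<open>o(e n)\<close> in \<open>L\<^sup>1\<close>. It consists of the Taylor remainder \<open>R\<close>, treated by
    moments, and of the error \<open>G\<close> in replacing the mean drift over the time step by its value at \<open>t\<close>,
    treated by dominated convergence.\<close>
  define Q where "Q n \<omega> = Z n \<omega> - e n * Lg \<omega> - S n \<omega>" for n \<omega>
  have L_int: "integrable M Lg"
    by (rule integrable_const_bound[of _ KL]) (use KL in auto)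
  have Q_int: "integrable M (Q n)" for n
    unfolding Q_def by (intro Bochner_Integration.integrable_diff integrable_mult_right Z_int L_int S_int)
  have cond_Z: "AE \<omega> in M. real_cond_exp M (P t) (Z n) \<omega> = e n * Lg \<omega> + real_cond_exp M (P t) (Q n) \<omega>" for n
  proof -
    have Zeq: "Z n = (\<lambda>\<omega>. (e n * Lg \<omega> + S n \<omega>) + Q n \<omega>)" by (rule ext) (simp add: Q_def)
    have i: "integrable M (\<lambda>\<omega>. e n * Lg \<omega>)" by (intro integrable_mult_right L_int)
    have "AE \<omega> in M. real_cond_exp M (P t) (Z n) \<omega> =
        real_cond_exp M (P t) (\<lambda>\<omega>. e n * Lg \<omega> + S n \<omega>) \<omega> + real_cond_exp M (P t) (Q n) \<omega>"
      unfolding Zeq by (rule E.real_cond_exp_add) (intro Bochner_Integration.integrable_add i S_int Q_int)+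
    moreover have "AE \<omega> in M. real_cond_exp M (P t) (\<lambda>\<omega>. e n * Lg \<omega> + S n \<omega>) \<omega> =
        real_cond_exp M (P t) (\<lambda>\<omega>. e n * Lg \<omega>) \<omega> + real_cond_exp M (P t) (S n) \<omega>"
      by (rule E.real_cond_exp_add[OF i S_int])
    moreover have "AE \<omega> in M. real_cond_exp M (P t) (\<lambda>\<omega>. e n * Lg \<omega>) \<omega> = e n * Lg \<omega>"
      by (rule E.real_cond_exp_F_meas[OF i]) (use L_meas in simp)
    ultimately show ?thesis using S_zero[of n] by eventually_elim simp
  qed

  define G where "G n \<omega> = (\<Sum>i\<in>UNIV. (b n \<omega> $ i / e n - v t (y \<omega>) $ i) * f i \<omega>)" for n \<omega>
  define R where "R n \<omega> = F (t + e n) (y \<omega> + a *\<^sub>R dW n \<omega> + b n \<omega>) - F t (y \<omega>) - e n * time_deriv T F t (y \<omega>)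
      - (\<Sum>i\<in>UNIV. (a *\<^sub>R dW n \<omega> + b n \<omega>) $ i * partial i (F t) (y \<omega>))
      - (\<Sum>i\<in>UNIV. \<Sum>j\<in>UNIV. (a *\<^sub>R dW n \<omega>) $ i * (a *\<^sub>R dW n \<omega>) $ j * partial j (partial i (F t)) (y \<omega>)) / 2" for n \<omega>
  have Q_eq: "Q n \<omega> = R n \<omega> + e n * G n \<omega>" for n \<omega>
  proof -
    have Z: "F (t + e n) (y \<omega> + a *\<^sub>R dW n \<omega> + b n \<omega>) - F t (y \<omega>) = Z n \<omega>"
      by (simp add: Z_def b_def)
    have r1: "(\<Sum>i\<in>UNIV. (a *\<^sub>R dW n \<omega> + b n \<omega>) $ i * partial i (F t) (y \<omega>)) = (\<Sum>i\<in>UNIV. S1 n i \<omega>) + (\<Sum>i\<in>UNIV. b n \<omega> $ i * f i \<omega>)"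
      by (simp add: S1_def f_def sum.distrib[symmetric] algebra_simps)
    have "(\<Sum>i\<in>UNIV. \<Sum>j\<in>UNIV. (a *\<^sub>R dW n \<omega>) $ i * (a *\<^sub>R dW n \<omega>) $ j * partial j (partial i (F t)) (y \<omega>)) / 2
      = (\<Sum>i\<in>UNIV. \<Sum>j\<in>UNIV. (a * a) * (dW n \<omega> $ i * dW n \<omega> $ j * h i j \<omega>)) / 2"
      by (simp add: h_def mult_ac)
    also have "\<dots> = \<nu> * (\<Sum>i\<in>UNIV. \<Sum>j\<in>UNIV. dW n \<omega> $ i * dW n \<omega> $ j * h i j \<omega>)"
      unfolding a2 sum_distrib_left[symmetric] by simp
    finally have r2: "(\<Sum>i\<in>UNIV. \<Sum>j\<in>UNIV. (a *\<^sub>R dW n \<omega>) $ i * (a *\<^sub>R dW n \<omega>) $ j * partial j (partial i (F t)) (y \<omega>)) / 2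
      = \<nu> * (\<Sum>i\<in>UNIV. \<Sum>j\<in>UNIV. dW n \<omega> $ i * dW n \<omega> $ j * h i j \<omega>)" .
    have "(\<Sum>i\<in>UNIV. \<Sum>j\<in>UNIV. S2 n i j \<omega>) =
       (\<Sum>i\<in>UNIV. \<Sum>j\<in>UNIV. \<nu> * (dW n \<omega> $ i * dW n \<omega> $ j * h i j \<omega>) - (if i = j then \<nu> * (e n * h i j \<omega>) else 0))"
      by (intro sum.cong refl) (simp add: S2_def algebra_simps)
    also have "\<dots> = \<nu> * (\<Sum>i\<in>UNIV. \<Sum>j\<in>UNIV. dW n \<omega> $ i * dW n \<omega> $ j * h i j \<omega>) - \<nu> * (e n * (\<Sum>i\<in>UNIV. h i i \<omega>))"
      by (simp add: sum_subtractf sum_distrib_left)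
    finally have r3: "(\<Sum>i\<in>UNIV. \<Sum>j\<in>UNIV. S2 n i j \<omega>) = 
      \<nu> * (\<Sum>i\<in>UNIV. \<Sum>j\<in>UNIV. dW n \<omega> $ i * dW n \<omega> $ j * h i j \<omega>) - \<nu> * (e n * (\<Sum>i\<in>UNIV. h i i \<omega>))" .
    have r4: "e n * G n \<omega> = (\<Sum>i\<in>UNIV. b n \<omega> $ i * f i \<omega>) - e n * (\<Sum>i\<in>UNIV. v t (y \<omega>) $ i * f i \<omega>)"
      unfolding G_def sum_distrib_left sum_subtractf[symmetric]
      by (intro sum.cong refl) (use e_pos[of n] in \<open>simp add: field_simps\<close>)
    show ?thesis
      unfolding R_def Q_def S_def gen Z r1 r2 r3 r4 by (simp add: algebra_simps)
  qed

  have path: "AE \<omega> in M. (\<forall>n. norm (b n \<omega>) \<le> B * e n) \<and> (\<forall>i. (\<lambda>n. b n \<omega> $ i / e n) \<longlonglongrightarrow> v t (y \<omega>) $ i)"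
    using AE_additive_flow
  proof eventually_elim
    case (elim \<omega>)
    then obtain L where "additive_flow T L v (\<lambda>s. sqrt (2 * \<nu>) *\<^sub>R W s \<omega>) (\<lambda>s x. g s x \<omega>)" by blast
    then interpret additive_flow T L v "\<lambda>s. sqrt (2 * \<nu>) *\<^sub>R W s \<omega>" "\<lambda>s x. g s x \<omega>" .
    have beq: "b n \<omega> = g (t + e n) x \<omega> - g t x \<omega> - (sqrt (2 * \<nu>) *\<^sub>R W (t + e n) \<omega> - sqrt (2 * \<nu>) *\<^sub>R W t \<omega>)" for n
      by (simp add: b_def y_def dW_def a_def scaleR_diff_right)
    show ?case
      unfolding beq y_def
      using drift_increment_le[OF t(1) less_imp_le[OF e_pos] e_le B(2)] drift_increment_tendsto[OF t(1) e_lim e_pos e_le]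
      by blast
  qed

  have G_bound: "AE \<omega> in M. \<forall>n. \<bar>G n \<omega>\<bar> \<le> (\<Sum>i\<in>UNIV. 2 * B * Kf i)"
    using path
  proof eventually_elim
    case (elim \<omega>)
    show ?case
    proof
      fix n
      show "\<bar>G n \<omega>\<bar> \<le> (\<Sum>i\<in>UNIV. 2 * B * Kf i)"
        unfolding G_def
      proof (rule order_trans[OF sum_abs sum_mono])
        fix i
        have "\<bar>b n \<omega> $ i\<bar> \<le> B * e n" using order_trans[OF component_le_norm_cart] elim by blast
        then have "\<bar>b n \<omega> $ i / e n\<bar> \<le> B" using e_pos[of n] by (simp add: divide_le_eq)
        moreover have "\<bar>v t (y \<omega>) $ i\<bar> \<le> B" using order_trans[OF component_le_norm_cart B(2)[OF tT]] .
        ultimately have "\<bar>b n \<omega> $ i / e n - v t (y \<omega>) $ i\<bar> \<le> 2 * B" by linarith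
        then show "\<bar>(b n \<omega> $ i / e n - v t (y \<omega>) $ i) * f i \<omega>\<bar> \<le> 2 * B * Kf i"
          unfolding abs_mult using Kf B(1) by (intro mult_mono) auto
      qed
    qed
  qed
  have G_meas[measurable]: "G n \<in> borel_measurable M" for n
    unfolding G_def by measurable
  have G_int: "integrable M (G n)" for n
    by (rule integrable_const_bound[of _ "\<Sum>i\<in>UNIV. 2 * B * Kf i"]) (use G_bound in \<open>auto elim: eventually_mono\<close>)
  have "(\<lambda>n. ?L1 (G n)) \<longlonglongrightarrow> (\<integral>\<omega>. 0 \<partial>M)"
  proof (rule integral_dominated_convergence[where w="\<lambda>_. \<Sum>i\<in>UNIV. 2 * B * Kf i"])
    show "AE \<omega> in M. (\<lambda>n. \<bar>G n \<omega>\<bar>) \<longlonglongrightarrow> 0"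
      using path
    proof eventually_elim
      case (elim \<omega>)
      have "(\<lambda>n. G n \<omega>) \<longlonglongrightarrow> (\<Sum>i\<in>UNIV. (v t (y \<omega>) $ i - v t (y \<omega>) $ i) * f i \<omega>)"
        unfolding G_def using elim by (intro tendsto_intros) auto
      then show ?case by (simp add: tendsto_rabs_zero)
    qed
    show "AE \<omega> in M. norm \<bar>G n \<omega>\<bar> \<le> (\<Sum>i\<in>UNIV. 2 * B * Kf i)" for n
      using G_bound by (auto elim: eventually_mono)
  qed auto
  then have G_lim: "(\<lambda>n. ?L1 (G n)) \<longlonglongrightarrow> 0" by simp

  have R_eq: "R n = (\<lambda>\<omega>. Q n \<omega> - e n * G n \<omega>)" for n by (rule ext) (simp add: Q_eq)
  have R_int: "integrable M (R n)" for n
    unfolding R_eq by (intro Bochner_Integration.integrable_diff integrable_mult_right Q_int G_int)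
  define d where "d = real CARD('d)"
  define c1 where "c1 = 1 + 2 * \<nu> * d"
  define c2 where "c2 = 1 + 2 * \<nu> * d + 12 * \<nu>\<^sup>2 * d\<^sup>2"
  have c: "c1 > 0" "c2 > 0" using \<nu> by (simp_all add: c1_def c2_def d_def add_pos_nonneg)
  have R_le: "\<exists>C\<ge>0. \<forall>n. ?L1 (R n) / e n \<le> \<kappa> * c1 + C * c2 * e n" if \<kappa>: "\<kappa> > 0" for \<kappa>
  proof -
    obtain C where C: "C \<ge> 0" "\<And>t \<epsilon> y w b. t \<in> {0..T} \<Longrightarrow> 0 \<le> \<epsilon> \<Longrightarrow> t + \<epsilon> \<in> {0..T} \<Longrightarrow> norm b \<le> B * \<epsilon> \<Longrightarrow>
      \<bar>F (t + \<epsilon>) (y + w + b) - F t y - \<epsilon> * time_deriv T F t y - (\<Sum>i\<in>UNIV. (w + b) $ i * partial i (F t) y)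
        - (\<Sum>i\<in>UNIV. \<Sum>j\<in>UNIV. w $ i * w $ j * partial j (partial i (F t)) y) / 2\<bar>
      \<le> \<kappa> * (\<epsilon> + (norm w)\<^sup>2) + C * (\<epsilon>\<^sup>2 + \<epsilon> * (norm w)\<^sup>2 + (norm w) ^ 4)"
      by (rule expansion_remainder[OF F per_t per_x \<kappa> B(1) T]) blast
    have "?L1 (R n) / e n \<le> \<kappa> * c1 + C * c2 * e n" for n
    proof -
      note m = increment_norm_moments[OF t(1) e_pos, of n, folded dW_def d_def]
      define N2 where "N2 \<omega> = (norm (dW n \<omega>))\<^sup>2" for \<omega>
      define N4 where "N4 \<omega> = norm (dW n \<omega>) ^ 4" for \<omega>
      note m = m[folded N2_def N4_def]
      have n2: "(norm (a *\<^sub>R dW n \<omega>))\<^sup>2 = 2 * \<nu> * N2 \<omega>" for \<omega>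
        using a2 by (simp add: N2_def power_mult_distrib power2_eq_square)
      have n4: "norm (a *\<^sub>R dW n \<omega>) ^ 4 = 4 * \<nu>\<^sup>2 * N4 \<omega>" for \<omega>
      proof -
        have "norm (a *\<^sub>R dW n \<omega>) ^ 4 = ((norm (a *\<^sub>R dW n \<omega>))\<^sup>2)\<^sup>2" by simp
        then show ?thesis unfolding n2 by (simp add: N2_def N4_def power_mult_distrib)
      qed
      define U where "U \<omega> = (\<kappa> * e n + C * (e n)\<^sup>2) + (\<kappa> * (2 * \<nu>) + C * e n * (2 * \<nu>)) * N2 \<omega> + C * (4 * \<nu>\<^sup>2) * N4 \<omega>" for \<omega>
      have U_int: "integrable M U"
        unfolding U_def by (intro Bochner_Integration.integrable_add integrable_mult_right m) simp_all
      have "AE \<omega> in M. \<bar>R n \<omega>\<bar> \<le> U \<omega>"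
        using path
      proof eventually_elim
        case (elim \<omega>)
        then have "norm (b n \<omega>) \<le> B * e n" by blast
        from C(2)[OF tT less_imp_le[OF e_pos] e_T this, of "y \<omega>" "a *\<^sub>R dW n \<omega>"]
        have "\<bar>R n \<omega>\<bar> \<le> \<kappa> * (e n + 2 * \<nu> * N2 \<omega>) + C * ((e n)\<^sup>2 + e n * (2 * \<nu> * N2 \<omega>) + 4 * \<nu>\<^sup>2 * N4 \<omega>)"
          unfolding R_def n2 n4 .
        then show ?case by (simp add: U_def algebra_simps)
      qed
      then have "?L1 (R n) \<le> (\<integral>\<omega>. U \<omega> \<partial>M)"
        using R_int U_int by (intro integral_mono_AE) auto
      also have "\<dots> = (\<kappa> * e n + C * (e n)\<^sup>2) + (\<kappa> * (2 * \<nu>) + C * e n * (2 * \<nu>)) * (d * e n) + C * (4 * \<nu>\<^sup>2) * expectation N4"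
        unfolding U_def using m by (simp add: prob_space)
      also have "\<dots> \<le> (\<kappa> * e n + C * (e n)\<^sup>2) + (\<kappa> * (2 * \<nu>) + C * e n * (2 * \<nu>)) * (d * e n) + C * (4 * \<nu>\<^sup>2) * (3 * d\<^sup>2 * (e n)\<^sup>2)"
        using m(4) C(1) by (intro add_left_mono mult_left_mono) auto
      also have "\<dots> = (\<kappa> * c1 + C * c2 * e n) * e n"
        by (simp add: c1_def c2_def algebra_simps power2_eq_square)
      finally show ?thesis using e_pos[of n] by (simp add: divide_le_eq)
    qed
    with C(1) show ?thesis by blast
  qed
  have R_lim: "(\<lambda>n. ?L1 (R n) / e n) \<longlonglongrightarrow> 0"
  proof (rule LIMSEQ_I)
    fix r :: real assume r: "0 < r"
    obtain C where C: "C \<ge> 0" "\<And>n. ?L1 (R n) / e n \<le> r / (2 * c1) * c1 + C * c2 * e n"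
      using R_le[of "r / (2 * c1)"] r c by auto
    have "(\<lambda>n. C * c2 * e n) \<longlonglongrightarrow> C * c2 * 0" by (intro tendsto_intros e_lim)
    then have "eventually (\<lambda>n. C * c2 * e n < r / 2) sequentially"
      by (rule order_tendstoD) (use r in simp)
    then obtain N where N: "\<And>n. n \<ge> N \<Longrightarrow> C * c2 * e n < r / 2" by (auto simp: eventually_sequentially)
    have "norm (?L1 (R n) / e n - 0) < r" if "n \<ge> N" for n
    proof -
      have "0 \<le> ?L1 (R n) / e n" using e_pos[of n] by (intro divide_nonneg_pos) auto
      moreover have "?L1 (R n) / e n \<le> r / 2 + C * c2 * e n" using C(2)[of n] c by simp
      ultimately show ?thesis using N[OF that] by simp
    qed
    then show "\<exists>N. \<forall>n\<ge>N. norm (?L1 (R n) / e n - 0) < r" by blast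
  qed

  \<comment> \<open>Convergence in \<open>L\<^sup>1\<close> gives almost sure convergence along a subsequence, where the limit is
    \<open>D\<close> by hypothesis.\<close>
  define u where "u n \<omega> = real_cond_exp M (P t) (Q n) \<omega> / e n" for n \<omega>
  have u_int: "integrable M (u n)" for n
    unfolding u_def using E.real_cond_exp_int(1)[OF Q_int] by simp
  have u_le: "(\<integral>\<omega>. norm (u n \<omega>) \<partial>M) \<le> ?L1 (R n) / e n + ?L1 (G n)" for n
  proof -
    have "(\<integral>\<omega>. norm (u n \<omega>) \<partial>M) = (\<integral>\<omega>. \<bar>real_cond_exp M (P t) (Q n) \<omega>\<bar> \<partial>M) / e n"
      unfolding u_def using e_pos[of n] by simp
    also have "\<dots> \<le> ?L1 (Q n) / e n"
      using E.integral_abs_real_cond_exp_le[OF Q_int] e_pos[of n] by (intro divide_right_mono) auto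
    also have "?L1 (Q n) \<le> (\<integral>\<omega>. \<bar>R n \<omega>\<bar> + e n * \<bar>G n \<omega>\<bar> \<partial>M)"
    proof (rule integral_mono)
      show "\<bar>Q n \<omega>\<bar> \<le> \<bar>R n \<omega>\<bar> + e n * \<bar>G n \<omega>\<bar>" for \<omega>
        unfolding Q_eq using e_pos[of n] abs_triangle_ineq[of "R n \<omega>" "e n * G n \<omega>"] by (simp add: abs_mult)
    qed (use Q_int R_int G_int in auto)
    also have "\<dots> = ?L1 (R n) + e n * ?L1 (G n)"
      using R_int G_int by simp
    finally show ?thesis using e_pos[of n] by (simp add: add_divide_distrib divide_right_mono)
  qed
  have "(\<lambda>n. \<integral>\<omega>. norm (u n \<omega>) \<partial>M) \<longlonglongrightarrow> 0"
  proof (rule tendsto_sandwich[OF _ _ tendsto_const])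
    show "(\<lambda>n. ?L1 (R n) / e n + ?L1 (G n)) \<longlonglongrightarrow> 0"
      using tendsto_add[OF R_lim G_lim] by simp
  qed (use u_le in auto)
  then obtain r where r: "strict_mono r" "AE \<omega> in M. (\<lambda>n. u (r n) \<omega>) \<longlonglongrightarrow> 0"
    using tendsto_L1_AE_subseq[where u=u and M=M] u_int by blast
  have "AE \<omega> in M. \<forall>n. real_cond_exp M (P t) (Z n) \<omega> = e n * Lg \<omega> + real_cond_exp M (P t) (Q n) \<omega>"
    using cond_Z by (simp add: AE_all_countable)
  moreover have "AE \<omega> in M. (\<lambda>n. real_cond_exp M (P t) (Z n) \<omega> / e n) \<longlonglongrightarrow> D \<omega>"
  proof -
    have "AE \<omega> in M. (\<lambda>n. cond_exp M (P t) (\<lambda>\<omega>. F (t + e n) (g (t + e n) x \<omega>) - F t (g t x \<omega>)) \<omega> /\<^sub>R e n) \<longlonglongrightarrow> D \<omega>"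
      using D e_pos e_le e_lim unfolding has_gen_deriv_def by blast
    then show ?thesis
      by (simp add: cond_exp_def Z_def[abs_def] y_def divide_inverse mult.commute)
  qed
  ultimately show ?thesis
    using r(2)
  proof eventually_elim
    case (elim \<omega>)
    have "real_cond_exp M (P t) (Z n) \<omega> / e n = Lg \<omega> + u n \<omega>" for n
      using elim(1) e_pos[of n] by (simp add: u_def add_divide_distrib)
    with elim(2) have "(\<lambda>n. Lg \<omega> + u n \<omega>) \<longlonglongrightarrow> D \<omega>" by simp
    then have "(\<lambda>n. Lg \<omega> + u (r n) \<omega>) \<longlonglongrightarrow> D \<omega>"
      using LIMSEQ_subseq_LIMSEQ[OF _ r(1)] by (fastforce simp: o_def)
    moreover have "(\<lambda>n. Lg \<omega> + u (r n) \<omega>) \<longlonglongrightarrow> Lg \<omega> + 0"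
      by (intro tendsto_intros elim(3))
    ultimately have "D \<omega> = Lg \<omega>" using LIMSEQ_unique by force
    then show ?case by (simp add: Lg_def y_def)
  qed
qed

end

section \<open>Volume preservation\<close>

lemma C1_diffeomorphism_continuous:
  assumes "C1_diffeomorphism f"
  shows "continuous_on UNIV f" "continuous_on UNIV (inv f)"
  using assms unfolding C1_diffeomorphism_def
  by (auto intro!: continuous_at_imp_continuous_on differentiable_imp_continuous_within)

text \<open>
  By \<open>det_flow\<close> the lifted map preserves Lebesgue measure, and
  \<open>flow_equivariant\<close> makes it the lift of a map of the torus.
\<close>

lemma (in additive_flow) volume_preserving:
  assumes per: "periodic T v" and div: "\<And>s y. s \<in> {0..T} \<Longrightarrow> divergence (v s) y = 0"
    and diff: "\<And>s. s \<in> {0..T} \<Longrightarrow> C1_diffeomorphism (g s)" and t: "t \<in> {0..T}"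
  shows "det (jacobian (g t) (at x)) = 1"
    and "continuous_on UNIV f \<Longrightarrow> (\<And>x i. f (x + axis i (2 * pi)) = f x) \<Longrightarrow>
      (LINT x:torus_cell|lborel. f (g t x)) = (LINT x:torus_cell|lborel. (f x :: real))"
proof -
  have der: "(g s has_derivative frechet_derivative (g s) (at x)) (at x)" if "s \<in> {0..T}" for s x
    using diff[OF that] by (simp add: C1_diffeomorphism_def frechet_derivative_works)
  have det: "det (matrix (frechet_derivative (g t) (at x))) = 1" for x
    by (rule det_flow[where A="\<lambda>s. frechet_derivative (g s) (at x)", OF der t div])
  then show "det (jacobian (g t) (at x)) = 1" by (simp add: jacobian_def)
  have bij: "bij (g t)" using diff[OF t] by (simp add: C1_diffeomorphism_def)
  assume f: "continuous_on UNIV f" "\<And>x i. f (x + axis i (2 * pi)) = f x"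
  show "(LINT x:torus_cell|lborel. f (g t x)) = (LINT x:torus_cell|lborel. f x)"
  proof (rule integral_torus_cell_invariant[OF f, where h="inv (g t)"])
    show "distr lborel borel (g t) = lborel"
      by (rule distr_lborel_volume_preserving[OF der[OF t] _ bij]) (simp add: det)
    show "g t (x + axis i (2 * pi)) = g t x + axis i (2 * pi)" for x i
      by (rule flow_equivariant[OF _ t]) (use per in \<open>simp add: periodic_def\<close>)
  qed (use bij C1_diffeomorphism_continuous[OF diff[OF t]] in \<open>auto simp: bij_is_inj bij_is_surj surj_f_inv_f\<close>)
qed

section \<open>Variation of the Lagrangian\<close>

definition gradient_matrix :: "(real ^ 'd \<Rightarrow> real ^ 'd) \<Rightarrow> real ^ 'd \<Rightarrow> real ^ 'd ^ 'd" where
  "gradient_matrix u x = (\<chi> i j. partial j u x $ i)"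

lemma det_jacobian_transformed:
  fixes f \<eta> :: "real ^ 'd \<Rightarrow> real ^ 'd"
  assumes f: "f differentiable (at x)" and \<eta>: "\<eta> differentiable (at (f x))"
  shows "det (jacobian (\<lambda>y. f y + \<alpha> *\<^sub>R \<eta> (f y)) (at x)) =
    det (mat 1 + \<alpha> *\<^sub>R gradient_matrix \<eta> (f x)) * det (jacobian f (at x))"
proof -
  let ?f' = "frechet_derivative f (at x)"
  let ?D = "\<lambda>h. h + \<alpha> *\<^sub>R (\<Sum>k\<in>UNIV. h $ k *\<^sub>R partial k \<eta> (f x))"
  have f': "(f has_derivative ?f') (at x)" using f by (simp add: frechet_derivative_works)
  have D: "((\<lambda>z. z + \<alpha> *\<^sub>R \<eta> z) has_derivative ?D) (at (f x))"
    by (intro has_derivative_add has_derivative_ident has_derivative_scaleR_right partial_has_derivative \<eta>)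
  have "((\<lambda>y. f y + \<alpha> *\<^sub>R \<eta> (f y)) has_derivative (\<lambda>h. ?D (?f' h))) (at x)"
    by (rule has_derivative_compose[OF f' D])
  then have "frechet_derivative (\<lambda>y. f y + \<alpha> *\<^sub>R \<eta> (f y)) (at x) = (\<lambda>h. ?D (?f' h))"
    by (rule frechet_derivative_at[symmetric])
  then have "jacobian (\<lambda>y. f y + \<alpha> *\<^sub>R \<eta> (f y)) (at x) = matrix (?D \<circ> ?f')"
    by (simp add: jacobian_def o_def)
  also have "\<dots> = matrix ?D ** matrix ?f'"
    by (rule matrix_compose[OF has_derivative_linear[OF f'] has_derivative_linear[OF D]])
  also have "matrix ?D = mat 1 + \<alpha> *\<^sub>R gradient_matrix \<eta> (f x)"
    by (simp add: vec_eq_iff matrix_def mat_def gradient_matrix_def axis_def if_distrib[of "\<lambda>c. c * _"] cong: if_cong)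
  finally show ?thesis by (simp add: det_mul jacobian_def)
qed

lemma has_derivative_det_identity:
  fixes N :: "real ^ 'n ^ 'n"
  shows "((\<lambda>\<alpha>. det (mat 1 + \<alpha> *\<^sub>R N)) has_real_derivative trace N) (at 0)"
proof -
  have "((\<lambda>\<alpha>. det (mat 1 + \<alpha> *\<^sub>R N)) has_real_derivative trace N * det (mat 1 + 0 *\<^sub>R N)) (at 0)"
    by (rule has_field_derivative_det_linear) (auto intro!: derivative_eq_intros)
  then show ?thesis by simp
qed

text \<open>
  The mean value theorem, with the derivative of the determinant bounded through the Leibniz
  formula; only the uniformity in the matrix matters.
\<close>

lemma det_identity_perturbation_le:
  fixes N :: "real ^ 'n ^ 'n"
  assumes N: "\<And>i j. \<bar>N $ i $ j\<bar> \<le> K" and \<alpha>: "0 < \<alpha>" "\<alpha> \<le> 1"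
  shows "\<bar>det (mat 1 + \<alpha> *\<^sub>R N) - 1\<bar> \<le> \<alpha> * (\<Sum>i\<in>(UNIV :: 'n set). \<Sum>p | p permutes (UNIV :: 'n set). (1 + K) ^ CARD('n))"
proof -
  let ?D = "\<lambda>z. \<Sum>i\<in>UNIV. det (\<chi> k. if k = i then N $ i else (mat 1 + z *\<^sub>R N) $ k)"
  have "\<exists>z>0. z < \<alpha> \<and> det (mat 1 + \<alpha> *\<^sub>R N) - det (mat 1 + 0 *\<^sub>R N) = (\<alpha> - 0) * ?D z"
    by (rule MVT2) (use \<alpha> in \<open>auto intro!: has_field_derivative_det derivative_eq_intros\<close>)
  then obtain z where z: "0 < z" "z < \<alpha>" "det (mat 1 + \<alpha> *\<^sub>R N) - 1 = \<alpha> * ?D z" by auto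
  have K: "K \<ge> 0" using N[of undefined undefined] by linarith
  have "\<bar>?D z\<bar> \<le> (\<Sum>i\<in>(UNIV :: 'n set). \<Sum>p | p permutes (UNIV :: 'n set). (1 + K) ^ CARD('n))"
  proof (rule order_trans[OF sum_abs sum_mono], rule abs_det_le)
    fix i k j :: 'n
    have "\<bar>(mat 1 + z *\<^sub>R N) $ k $ j\<bar> \<le> 1 + K"
    proof -
      have "\<bar>z * N $ k $ j\<bar> \<le> 1 * K" unfolding abs_mult using z \<alpha> N K by (intro mult_mono) auto
      moreover have "\<bar>(mat 1 :: real ^ 'n ^ 'n) $ k $ j\<bar> \<le> 1" by (simp add: mat_def)
      ultimately show ?thesis by simp
    qed
    then show "\<bar>(\<chi> k. if k = i then N $ i else (mat 1 + z *\<^sub>R N) $ k) $ k $ j\<bar> \<le> 1 + K"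
      using N[of i j] by auto
  qed
  then show ?thesis unfolding z(3) abs_mult using \<alpha> by (intro mult_mono) auto
qed

text \<open>
  The factor \<open>det (I + \<alpha> N) - 1\<close> vanishes at \<open>\<alpha> = 0\<close>, so the difference quotient of the pressure term
  tends to \<open>q x * trace (N x)\<close>, with \<open>q\<close> at the unperturbed point, by continuity of \<open>q\<close>.
\<close>

lemma integral_variation:
  fixes V H \<eta> :: "real ^ 'd \<Rightarrow> real ^ 'd" and q :: "real ^ 'd \<Rightarrow> real" and N :: "real ^ 'd \<Rightarrow> real ^ 'd ^ 'd"
  assumes V: "continuous_on UNIV V" and H: "continuous_on UNIV H" and \<eta>: "continuous_on UNIV \<eta>"
    and q: "continuous_on UNIV q" and N: "\<And>i j. continuous_on UNIV (\<lambda>x. N x $ i $ j)"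
    and bounds: "\<And>x. norm (V x) \<le> BV" "\<And>x. norm (H x) \<le> BH" "\<And>x. \<bar>q x\<bar> \<le> Bq" "\<And>x i j. \<bar>N x $ i $ j\<bar> \<le> BN"
    and r: "r \<longlonglongrightarrow> 0" "\<And>n::nat. 0 < r n" "\<And>n. r n \<le> 1"
  defines "\<Phi> \<equiv> \<lambda>\<alpha> x. (norm (V x + \<alpha> *\<^sub>R H x))\<^sup>2 / 2 + q (x + \<alpha> *\<^sub>R \<eta> x) * (det (mat 1 + \<alpha> *\<^sub>R N x) - 1)"
  shows "continuous_on UNIV (\<Phi> \<alpha>)"
    and "(\<lambda>n. ((LINT x:torus_cell|lborel. \<Phi> (r n) x) - (LINT x:torus_cell|lborel. \<Phi> 0 x)) / r n)
      \<longlonglongrightarrow> (LINT x:torus_cell|lborel. V x \<bullet> H x + q x * trace (N x))"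
proof -
  have cN: "continuous_on UNIV (\<lambda>x. det (mat 1 + \<alpha> *\<^sub>R N x))" for \<alpha>
    unfolding det_def by (simp, intro continuous_intros N)
  have cq: "continuous_on UNIV (\<lambda>x. q (x + \<alpha> *\<^sub>R \<eta> x))" for \<alpha>
    by (rule continuous_on_compose2[OF q]) (auto intro!: continuous_intros \<eta>)
  show c\<Phi>: "continuous_on UNIV (\<Phi> \<alpha>)" for \<alpha>
    unfolding \<Phi>_def by (intro continuous_intros V H cN cq) auto
  define Q where "Q n x = (\<Phi> (r n) x - \<Phi> 0 x) / r n" for n x
  have cQ: "continuous_on UNIV (Q n)" for n
    unfolding Q_def using r(2)[of n] by (intro continuous_intros c\<Phi>) auto
  have QI: "(LINT x:torus_cell|lborel. Q n x) = ((LINT x:torus_cell|lborel. \<Phi> (r n) x) - (LINT x:torus_cell|lborel. \<Phi> 0 x)) / r n" for n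
    unfolding Q_def
    by (simp add: set_integral_diff(2)[OF set_integrable_torus_cell[OF c\<Phi>] set_integrable_torus_cell[OF c\<Phi>]])
  have Q: "Q n x = V x \<bullet> H x + r n * (norm (H x))\<^sup>2 / 2 + q (x + r n *\<^sub>R \<eta> x) * ((det (mat 1 + r n *\<^sub>R N x) - 1) / r n)" for n x
  proof -
    have "(norm (V x + r n *\<^sub>R H x))\<^sup>2 = (norm (V x))\<^sup>2 + 2 * r n * (V x \<bullet> H x) + (r n)\<^sup>2 * (norm (H x))\<^sup>2"
      unfolding power2_norm_eq_inner by (simp add: inner_add_left inner_add_right inner_commute power2_eq_square)
    then have "\<Phi> (r n) x - \<Phi> 0 x = r n * (V x \<bullet> H x + r n * (norm (H x))\<^sup>2 / 2) + q (x + r n *\<^sub>R \<eta> x) * (det (mat 1 + r n *\<^sub>R N x) - 1)"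
      unfolding \<Phi>_def by (simp add: algebra_simps power2_eq_square)
    then show ?thesis unfolding Q_def using r(2)[of n] by (simp add: add_divide_distrib)
  qed
  define Kd where "Kd = (\<Sum>i\<in>(UNIV :: 'd set). \<Sum>p | p permutes (UNIV :: 'd set). (1 + BN) ^ CARD('d))"
  define w where "w = BV * BH + BH\<^sup>2 / 2 + Bq * Kd"
  have pos: "BV \<ge> 0" "BH \<ge> 0" "Bq \<ge> 0"
    using order_trans[OF norm_ge_zero bounds(1)] order_trans[OF norm_ge_zero bounds(2)] order_trans[OF abs_ge_zero bounds(3)] by auto
  have Qw: "\<bar>Q n x\<bar> \<le> w" for n x
  proof -
    have "\<bar>V x \<bullet> H x\<bar> \<le> BV * BH"
      using Cauchy_Schwarz_ineq2[of "V x" "H x"] mult_mono[OF bounds(1) bounds(2) pos(1) norm_ge_zero, of x x] by linarith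
    moreover have "\<bar>r n * (norm (H x))\<^sup>2 / 2\<bar> \<le> BH\<^sup>2 / 2"
    proof -
      have "r n * (norm (H x))\<^sup>2 \<le> 1 * BH\<^sup>2"
        using r(2,3)[of n] bounds(2) by (intro mult_mono power_mono) auto
      then show ?thesis using r(2)[of n] by simp
    qed
    moreover have "\<bar>q (x + r n *\<^sub>R \<eta> x) * ((det (mat 1 + r n *\<^sub>R N x) - 1) / r n)\<bar> \<le> Bq * Kd"
    proof -
      have "\<bar>(det (mat 1 + r n *\<^sub>R N x) - 1) / r n\<bar> \<le> Kd"
        using det_identity_perturbation_le[of "N x" BN "r n"] bounds(4) r(2,3)[of n]
        by (simp add: Kd_def divide_le_eq mult.commute)
      then show ?thesis unfolding abs_mult using bounds(3) pos(3) by (intro mult_mono) auto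
    qed
    ultimately show ?thesis unfolding Q w_def by linarith
  qed
  have Qlim: "(\<lambda>n. Q n x) \<longlonglongrightarrow> V x \<bullet> H x + q x * trace (N x)" for x
  proof -
    have "((\<lambda>\<alpha>. det (mat 1 + \<alpha> *\<^sub>R N x)) has_derivative (*) (trace (N x))) (at 0)"
      using has_derivative_det_identity[of "N x"] by (simp add: has_field_derivative_def)
    from has_derivative_difference_quotient[OF this r(1,2), of 1]
    have 1: "(\<lambda>n. (det (mat 1 + r n *\<^sub>R N x) - 1) / r n) \<longlonglongrightarrow> trace (N x)"
      by (simp add: divide_inverse mult.commute)
    have "(\<lambda>n. x + r n *\<^sub>R \<eta> x) \<longlonglongrightarrow> x + 0 *\<^sub>R \<eta> x" by (intro tendsto_intros r)
    then have 2: "(\<lambda>n. q (x + r n *\<^sub>R \<eta> x)) \<longlonglongrightarrow> q x"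
      by (intro continuous_on_tendsto_compose[OF q]) auto
    have "(\<lambda>n. Q n x) \<longlonglongrightarrow> V x \<bullet> H x + 0 * (norm (H x))\<^sup>2 / 2 + q x * trace (N x)"
      unfolding Q by (intro tendsto_intros r 1 2) auto
    then show ?thesis by simp
  qed
  have cT: "continuous_on UNIV (\<lambda>x. V x \<bullet> H x + q x * trace (N x))"
    unfolding trace_def by (intro continuous_intros V H q N)
  have "(\<lambda>n. LINT x:torus_cell|lborel. Q n x) \<longlonglongrightarrow> (LINT x:torus_cell|lborel. V x \<bullet> H x + q x * trace (N x))"
    unfolding set_lebesgue_integral_def
  proof (rule integral_dominated_convergence[where w="\<lambda>x. indicator torus_cell x *\<^sub>R w"])
    show "integrable lborel (\<lambda>x :: real ^ 'd. indicat_real torus_cell x *\<^sub>R w)"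
      using set_integrable_torus_cell[of "\<lambda>_. w"] unfolding set_integrable_def by simp
    show "AE x in lborel. norm (indicat_real torus_cell x *\<^sub>R Q n x) \<le> indicat_real torus_cell x *\<^sub>R w" for n
      using Qw by (intro AE_I2) (simp add: indicator_def)
    show "AE x in lborel. (\<lambda>n. indicat_real torus_cell x *\<^sub>R Q n x) \<longlonglongrightarrow> indicat_real torus_cell x *\<^sub>R (V x \<bullet> H x + q x * trace (N x))"
      by (intro AE_I2 tendsto_intros Qlim)
  qed (use set_integrable_torus_cell[OF cQ] set_integrable_torus_cell[OF cT] in \<open>auto simp: set_integrable_def dest: borel_measurable_integrable\<close>)
  then show "(\<lambda>n. ((LINT x:torus_cell|lborel. \<Phi> (r n) x) - (LINT x:torus_cell|lborel. \<Phi> 0 x)) / r n)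
      \<longlonglongrightarrow> (LINT x:torus_cell|lborel. V x \<bullet> H x + q x * trace (N x))"
    unfolding QI .
qed

section \<open>Versions of the generalised derivatives\<close>

lemma cond_exp_component:
  fixes Y :: "'w \<Rightarrow> real ^ 'd"
  shows "cond_exp M F Y \<omega> $ i = cond_exp M F (\<lambda>\<omega>. Y \<omega> $ i) \<omega>"
proof -
  have "axis i (1 :: real) \<in> Basis" by (simp add: axis_in_Basis_iff)
  then have "cond_exp M F Y \<omega> \<bullet> axis i 1 = real_cond_exp M F (\<lambda>\<omega>. Y \<omega> \<bullet> axis i 1) \<omega>"
    by (simp add: cond_exp_def)
  then show ?thesis by (simp add: cond_exp_def inner_axis)
qed

lemma has_gen_deriv_component:
  fixes X :: "real \<Rightarrow> 'w \<Rightarrow> real ^ 'd"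
  assumes "has_gen_deriv M P T t X D"
  shows "has_gen_deriv M P T t (\<lambda>s \<omega>. X s \<omega> $ i) (\<lambda>\<omega>. D \<omega> $ i)"
  unfolding has_gen_deriv_def
proof (intro conjI ballI allI impI)
  fix s assume "s \<in> {t<..T}"
  then have "integrable M (\<lambda>\<omega>. X s \<omega> - X t \<omega>)" using assms by (simp add: has_gen_deriv_def)
  from integrable_bounded_linear[OF bounded_linear_vec_nth this, of i]
  show "integrable M (\<lambda>\<omega>. X s \<omega> $ i - X t \<omega> $ i)" by simp
next
  fix \<epsilon> :: "nat \<Rightarrow> real" assume "\<forall>n. 0 < \<epsilon> n \<and> t + \<epsilon> n \<le> T" "\<epsilon> \<longlonglongrightarrow> 0"
  then have "AE \<omega> in M. (\<lambda>n. cond_exp M (P t) (\<lambda>\<omega>. X (t + \<epsilon> n) \<omega> - X t \<omega>) \<omega> /\<^sub>R \<epsilon> n) \<longlonglongrightarrow> D \<omega>"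
    using assms by (simp add: has_gen_deriv_def)
  then show "AE \<omega> in M. (\<lambda>n. cond_exp M (P t) (\<lambda>\<omega>. X (t + \<epsilon> n) \<omega> $ i - X t \<omega> $ i) \<omega> /\<^sub>R \<epsilon> n) \<longlonglongrightarrow> D \<omega> $ i"
  proof eventually_elim
    case (elim \<omega>)
    from tendsto_vec_nth[OF this, of i] show ?case by (simp add: cond_exp_component)
  qed
qed

lemma C01_const: "C01 T (\<lambda>t x. c)"
  by (rule C01_I[where F'="\<lambda>i t x. 0"]) (auto simp: partial_eq[OF has_derivative_const])

lemma partial_ident: "partial i (\<lambda>x. x) x = axis i 1"
  by (simp add: partial_eq[OF has_derivative_ident])

lemma C12_ident:
  assumes "T > 0"
  shows "C12 T (\<lambda>t x. x)"
proof (rule C12_I[where F'="\<lambda>i t x. axis i 1" and Ft="\<lambda>t x. 0"])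
  show "C01 T (\<lambda>t x. x)"
    by (rule C01_I[where F'="\<lambda>i t x. axis i 1"])
       (auto simp: partial_ident case_prod_unfold intro: continuous_intros)
qed (auto simp: partial_ident C01_const assms)

lemma time_deriv_ident: "T > 0 \<Longrightarrow> t \<in> {0..T} \<Longrightarrow> time_deriv T (\<lambda>t x. x) t x = 0"
  by (rule time_deriv_eq) auto

lemma generator_ident:
  fixes v :: "real \<Rightarrow> real ^ 'd \<Rightarrow> real ^ 'd"
  assumes "T > 0" "t \<in> {0..T}"
  shows "generator T \<nu> v (\<lambda>s x. x) t x = v t x"
proof -
  have "partial i (\<lambda>x. x :: real ^ 'd) = (\<lambda>x. axis i 1)" for i
    by (rule ext) (rule partial_ident)
  moreover have "(\<Sum>i\<in>UNIV. v t x $ i *\<^sub>R axis i 1) = v t x"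
    by (simp add: vec_eq_iff axis_def if_distrib cong: if_cong)
  ultimately show ?thesis
    by (simp add: generator_def advect_def laplacian_def time_deriv_ident[OF assms] partial_eq[OF has_derivative_const])
qed

context stochastic_flow_setting
begin

text \<open>
  Each coordinate of the transformed flow is a function of the flow whose derivatives are periodic:
  the identity, which the generator maps to \<open>v\<close>, plus \<open>\<alpha>\<close> times \<open>\<eta>\<close>.
\<close>

lemma transformed_gen_deriv:
  assumes t: "0 \<le> t" "t < T" and \<eta>: "C12 T \<eta>" "periodic T \<eta>"
    and D: "has_gen_deriv M P T t (\<lambda>s. transformed_flow \<eta> \<alpha> g s x) D"
  shows "AE \<omega> in M. D \<omega> = v t (g t x \<omega>) + \<alpha> *\<^sub>R generator T \<nu> v \<eta> t (g t x \<omega>)"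
proof -
  have tT: "t \<in> {0..T}" using t by simp
  let ?h = "\<lambda>z :: real ^ 'd. \<alpha> *\<^sub>R z"
  define F where "F s z = z + ?h (\<eta> s z)" for s z
  have h: "bounded_linear ?h" by (rule bounded_linear_scaleR_right)
  have h\<eta>: "C12 T (\<lambda>s z. ?h (\<eta> s z))" by (rule C12_linear[OF h \<eta>(1) T])
  have F: "C12 T F" unfolding F_def by (rule C12_add[OF C12_ident[OF T] h\<eta> T])
  have genF: "generator T \<nu> v F t z = v t z + \<alpha> *\<^sub>R generator T \<nu> v \<eta> t z" for z
    unfolding F_def generator_add[OF C12_ident[OF T] h\<eta> T tT] generator_linear[OF h \<eta>(1) T tT] generator_ident[OF T tT]
    by simp
  have timeF: "time_deriv T F s z = \<alpha> *\<^sub>R time_deriv T \<eta> s z" if "s \<in> {0..T}" for s z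
    unfolding F_def time_deriv_add[OF C12_ident[OF T] h\<eta> T that] time_deriv_linear[OF h \<eta>(1) T that] time_deriv_ident[OF T that]
    by simp
  have partF: "partial k (F s) z = axis k 1 + \<alpha> *\<^sub>R partial k (\<eta> s) z" if s: "s \<in> {0..T}" for k s z
  proof -
    have "partial k (F s) z = partial k (\<lambda>z. z) z + partial k (\<lambda>z. ?h (\<eta> s z)) z"
      unfolding F_def by (rule partial_add[OF C01_differentiable[OF C12_C01[OF C12_ident[OF T]] s]
            C01_differentiable[OF C12_C01[OF h\<eta>] s]])
    then show ?thesis
      unfolding partial_ident partial_linear[OF h C01_differentiable[OF C12_C01[OF \<eta>(1)] s]] by simp
  qed
  have "AE \<omega> in M. D \<omega> $ i = (v t (g t x \<omega>) + \<alpha> *\<^sub>R generator T \<nu> v \<eta> t (g t x \<omega>)) $ i" for i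
  proof -
    note lin = bounded_linear_vec_nth[of i]
    have Fi: "C12 T (\<lambda>s z. F s z $ i)" by (rule C12_linear[OF lin F T])
    have "periodic T (time_deriv T (\<lambda>s z. F s z $ i))"
      using periodic_time_deriv[OF \<eta>(2,1) T]
      by (simp add: periodic_def time_deriv_linear[OF lin F T] timeF)
    moreover have "periodic T (\<lambda>s. partial k (\<lambda>z. F s z $ i))" for k
      using periodic_partial[OF \<eta>(2), of k]
      by (simp add: periodic_def partial_linear[OF lin C01_differentiable[OF C12_C01[OF F]]] partF)
    moreover have "has_gen_deriv M P T t (\<lambda>s \<omega>. F s (g s x \<omega>) $ i) (\<lambda>\<omega>. D \<omega> $ i)"
      using has_gen_deriv_component[OF D, of i] by (simp add: F_def transformed_flow_def)
    ultimately have "AE \<omega> in M. D \<omega> $ i = generator T \<nu> v (\<lambda>s z. F s z $ i) t (g t x \<omega>)"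
      by (rule gen_deriv_eq_generator[OF t Fi])
    then show ?thesis unfolding generator_linear[OF lin F T tT] genF .
  qed
  then have "AE \<omega> in M. \<forall>i\<in>UNIV. D \<omega> $ i = (v t (g t x \<omega>) + \<alpha> *\<^sub>R generator T \<nu> v \<eta> t (g t x \<omega>)) $ i"
    by (intro AE_finite_allI) auto
  then show ?thesis by eventually_elim (simp add: vec_eq_iff)
qed

lemma AE_diffeomorphism: "AE \<omega> in M. \<forall>t\<in>{0..T}. C1_diffeomorphism (\<lambda>x. g t x \<omega>)"
  using flow by (simp add: stochastic_flow_def)

end

text \<open>
  The exceptional null set of each parameter is different. Only those of a countable dense set of
  parameters are united; continuity settles the others.
\<close>

lemma AE_continuous_versions_agree:
  fixes f h :: "'i::second_countable_topology \<Rightarrow> 'a \<Rightarrow> 'b::t2_space"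
  assumes "\<And>z. AE \<omega> in M. f z \<omega> = h z \<omega>"
    and "AE \<omega> in M. continuous_on UNIV (\<lambda>z. f z \<omega>)" and "AE \<omega> in M. continuous_on UNIV (\<lambda>z. h z \<omega>)"
  shows "AE \<omega> in M. \<forall>z. f z \<omega> = h z \<omega>"
proof -
  obtain S :: "'i set" where S: "countable S" "\<And>X. open X \<Longrightarrow> X \<noteq> {} \<Longrightarrow> \<exists>d\<in>S. d \<in> X"
    using countable_dense_exists[where 'a='i] by blast
  have "AE \<omega> in M. \<forall>z\<in>S. f z \<omega> = h z \<omega>"
    using assms(1) by (simp add: AE_ball_countable[OF S(1)])
  with assms(2,3) show ?thesis
  proof eventually_elim
    case (elim \<omega>)
    have "closed {z. f z \<omega> = h z \<omega>}" by (rule closed_Collect_eq[OF elim(1,2)])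
    then have "open (- {z. f z \<omega> = h z \<omega>})" by (rule open_Compl)
    with S(2)[of "- {z. f z \<omega> = h z \<omega>}"] elim(3) show ?case by blast
  qed
qed

section \<open>The conservation law\<close>

context stochastic_flow_setting
begin

text \<open>
  Two computations of the derivative of the integrated Lagrangian at \<open>\<alpha> = 0\<close> along almost every
  path: invariance gives the integral of \<open>L G\<close>, and \<open>integral_variation\<close> gives the other side. Both
  are deterministic, since volume preservation removes the flow from the integrals.
\<close>

lemma noether_identity:
  fixes \<eta> :: "real \<Rightarrow> real ^ 'd \<Rightarrow> real ^ 'd" and p G :: "real \<Rightarrow> real ^ 'd \<Rightarrow> real"
  assumes ns: "navier_stokes_solution T \<nu> v p" and \<eta>: "C12 T \<eta>" "periodic T \<eta>"
    and inv: "lagrangian_invariant M P T g p \<eta> G" and t: "0 \<le> t" "t < T"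
  shows "(LINT x:torus_cell|lborel. v t x \<bullet> generator T \<nu> v \<eta> t x + p t x * divergence (\<eta> t) x) =
    (LINT x:torus_cell|lborel. generator T \<nu> v G t x)"
proof -
  have tT: "t \<in> {0..T}" using t by simp
  from ns have p: "C01 T p" "periodic T p" and div: "\<And>s y. s \<in> {0..T} \<Longrightarrow> divergence (v s) y = 0"
    by (auto simp: navier_stokes_solution_def)
  from inv have G: "C12 T G" "periodic T G" by (auto simp: lagrangian_invariant_def)
  obtain U K where U: "\<And>\<alpha> x. has_gen_deriv M P T t (\<lambda>s. transformed_flow \<eta> \<alpha> g s x) (U \<alpha> x)"
    "AE \<omega> in M. continuous_on UNIV (\<lambda>(\<alpha>, x). U \<alpha> x \<omega>)"
    and K: "\<And>x. has_gen_deriv M P T t (\<lambda>s \<omega>. G s (g s x \<omega>)) (K x)"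
    "AE \<omega> in M. continuous_on UNIV (\<lambda>x. K x \<omega>)"
    and der: "AE \<omega> in M. ((\<lambda>\<alpha>. LINT x:torus_cell|lborel.
                    lagrangian p t (\<lambda>y. U \<alpha> y \<omega>) (\<lambda>y. transformed_flow \<eta> \<alpha> g t y \<omega>) x)
            has_real_derivative (LINT x:torus_cell|lborel. K x \<omega>)) (at 0)"
    using inv t unfolding lagrangian_invariant_def by (meson atLeastLessThan_iff)

  define V where "V = v t"
  define H where "H = generator T \<nu> v \<eta> t"
  define N where "N = gradient_matrix (\<eta> t)"
  define \<Phi> where "\<Phi> \<alpha> x = (norm (V x + \<alpha> *\<^sub>R H x))\<^sup>2 / 2
      + p t (x + \<alpha> *\<^sub>R \<eta> t x) * (det (mat 1 + \<alpha> *\<^sub>R N x) - 1)" for \<alpha> x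
  have cV: "continuous_on UNIV V" unfolding V_def by (rule continuous_on_slice[OF C01_continuous[OF v] tT])
  have cH: "continuous_on UNIV H" unfolding H_def by (rule continuous_on_slice[OF continuous_on_generator[OF \<eta>(1) v] tT])
  have cG: "continuous_on UNIV (generator T \<nu> v G t)" by (rule continuous_on_slice[OF continuous_on_generator[OF G(1) v] tT])
  have c\<eta>: "continuous_on UNIV (\<eta> t)" by (rule continuous_on_slice[OF C01_continuous[OF C12_C01[OF \<eta>(1)]] tT])
  have cp: "continuous_on UNIV (p t)" by (rule continuous_on_slice[OF C01_continuous[OF p(1)] tT])
  have cN: "continuous_on UNIV (\<lambda>x. N x $ i $ j)" for i j
    unfolding N_def gradient_matrix_def
    using continuous_on_component[OF continuous_on_partial_slice[OF C12_C01[OF \<eta>(1)] tT]] by simp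
  have perV: "V (x + axis i (2 * pi)) = V x" for x i
    using per_v tT by (simp add: V_def periodic_def)
  have per_gen: "periodic T (generator T \<nu> v \<eta>)" "periodic T (generator T \<nu> v G)"
    by (intro periodic_generator periodic_time_deriv periodic_partial \<eta> G T per_v)+
  have perH: "H (x + axis i (2 * pi)) = H x" for x i
    using per_gen(1) tT by (simp add: H_def periodic_def)
  have per\<eta>: "\<eta> t (x + axis i (2 * pi)) = \<eta> t x" for x i
    using \<eta>(2) tT by (simp add: periodic_def)
  have perN: "N (x + axis i (2 * pi)) = N x" for x i
    unfolding N_def gradient_matrix_def by (simp add: partial_translate[of "\<eta> t", OF per\<eta>])
  have per\<Phi>: "\<Phi> \<alpha> (x + axis i (2 * pi)) = \<Phi> \<alpha> x" for \<alpha> x i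
  proof -
    have shift: "x + axis i (2 * pi) + \<alpha> *\<^sub>R \<eta> t x = (x + \<alpha> *\<^sub>R \<eta> t x) + axis i (2 * pi)"
      by simp
    have "p t (x + axis i (2 * pi) + \<alpha> *\<^sub>R \<eta> t x) = p t (x + \<alpha> *\<^sub>R \<eta> t x)"
      unfolding shift using p(2) tT unfolding periodic_def by blast
    then show ?thesis by (simp add: \<Phi>_def perV perH per\<eta> perN)
  qed

  obtain BV where BV: "\<And>x. norm (V x) \<le> BV"
    unfolding V_def using periodic_bounded[OF C01_continuous[OF v] per_v] tT by metis
  obtain BH where BH: "\<And>x. norm (H x) \<le> BH"
    unfolding H_def using periodic_bounded[OF continuous_on_generator[OF \<eta>(1) v] per_gen(1)] tT by metis
  obtain Bp where Bp: "\<And>x. \<bar>p t x\<bar> \<le> Bp"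
    using periodic_bounded[OF C01_continuous[OF p(1)] p(2)] tT by (metis real_norm_def)
  have "\<exists>B\<ge>0. \<forall>x. norm (partial j (\<eta> t) x) \<le> B" for j
    using periodic_bounded[OF C01_continuous_partial[OF C12_C01[OF \<eta>(1)]] periodic_partial[OF \<eta>(2)]] tT by metis
  then obtain B where B: "\<And>j. B j \<ge> 0" "\<And>j x. norm (partial j (\<eta> t) x) \<le> B j" by metis
  have BN: "\<bar>N x $ i $ j\<bar> \<le> (\<Sum>j\<in>UNIV. B j)" for x i j
  proof -
    have "\<bar>N x $ i $ j\<bar> \<le> B j"
      unfolding N_def gradient_matrix_def using order_trans[OF component_le_norm_cart B(2)] by simp
    also have "\<dots> \<le> (\<Sum>j\<in>UNIV. B j)" by (rule member_le_sum) (auto intro: B(1))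
    finally show ?thesis .
  qed
  define r where "r n = inverse (real (Suc n))" for n
  have r: "r \<longlonglongrightarrow> 0" "\<And>n. 0 < r n" "\<And>n. r n \<le> 1"
    unfolding r_def by (rule LIMSEQ_inverse_real_of_nat) (auto simp: inverse_le_1_iff)
  note variation = integral_variation[OF cV cH c\<eta> cp cN BV BH Bp BN r]
  have c\<Phi>: "continuous_on UNIV (\<Phi> \<alpha>)" for \<alpha>
    unfolding \<Phi>_def by (rule variation(1))
  have lim1: "(\<lambda>n. ((LINT x:torus_cell|lborel. \<Phi> (r n) x) - (LINT x:torus_cell|lborel. \<Phi> 0 x)) / r n)
      \<longlonglongrightarrow> (LINT x:torus_cell|lborel. V x \<bullet> H x + p t x * trace (N x))"
    unfolding \<Phi>_def by (rule variation(2))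

  have contg: "AE \<omega> in M. continuous_on UNIV (\<lambda>x. g t x \<omega>)"
    using AE_diffeomorphism tT by (auto intro: C1_diffeomorphism_continuous elim!: eventually_mono)
  have Ueq: "AE \<omega> in M. \<forall>z. U (fst z) (snd z) \<omega> = V (g t (snd z) \<omega>) + fst z *\<^sub>R H (g t (snd z) \<omega>)"
  proof (rule AE_continuous_versions_agree)
    show "AE \<omega> in M. U (fst z) (snd z) \<omega> = V (g t (snd z) \<omega>) + fst z *\<^sub>R H (g t (snd z) \<omega>)" for z
      unfolding V_def H_def by (rule transformed_gen_deriv[OF t \<eta> U(1)])
    show "AE \<omega> in M. continuous_on UNIV (\<lambda>z. U (fst z) (snd z) \<omega>)"
      using U(2) by (simp add: case_prod_unfold)
    show "AE \<omega> in M. continuous_on UNIV (\<lambda>z. V (g t (snd z) \<omega>) + fst z *\<^sub>R H (g t (snd z) \<omega>))"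
      using contg
    proof eventually_elim
      case (elim \<omega>)
      have "continuous_on UNIV (\<lambda>z :: real \<times> (real ^ 'd). g t (snd z) \<omega>)"
        by (rule continuous_on_compose2[OF elim]) (auto intro: continuous_intros)
      then show ?case
        by (intro continuous_on_add continuous_on_scaleR continuous_on_fst continuous_on_id
            continuous_on_compose2[OF cV] continuous_on_compose2[OF cH]) auto
    qed
  qed
  have Keq: "AE \<omega> in M. \<forall>x. K x \<omega> = generator T \<nu> v G t (g t x \<omega>)"
  proof (rule AE_continuous_versions_agree[OF _ K(2)])
    show "AE \<omega> in M. K x \<omega> = generator T \<nu> v G t (g t x \<omega>)" for x
      by (rule gen_deriv_eq_generator[OF t G(1) periodic_time_deriv[OF G(2,1) T] periodic_partial[OF G(2)] K(1)])
    show "AE \<omega> in M. continuous_on UNIV (\<lambda>x. generator T \<nu> v G t (g t x \<omega>))"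
      using contg by eventually_elim (auto intro: continuous_on_compose2[OF cG])
  qed

  have "AE \<omega> in M. (LINT x:torus_cell|lborel. V x \<bullet> H x + p t x * trace (N x)) =
    (LINT x:torus_cell|lborel. generator T \<nu> v G t x)"
    using Ueq Keq der AE_diffeomorphism AE_additive_flow
  proof eventually_elim
    case (elim \<omega>)
    then obtain L where "additive_flow T L v (\<lambda>s. sqrt (2 * \<nu>) *\<^sub>R W s \<omega>) (\<lambda>s x. g s x \<omega>)" by blast
    then interpret additive_flow T L v "\<lambda>s. sqrt (2 * \<nu>) *\<^sub>R W s \<omega>" "\<lambda>s x. g s x \<omega>" .
    have vol1: "det (jacobian (\<lambda>x. g t x \<omega>) (at x)) = 1" for x
      by (rule volume_preserving(1)[OF per_v div bspec[OF elim(4)] tT])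
    have vol2: "(LINT x:torus_cell|lborel. f (g t x \<omega>)) = (LINT x:torus_cell|lborel. f x)"
      if "continuous_on UNIV f" "\<And>x i. f (x + axis i (2 * pi)) = f x" for f :: "real ^ 'd \<Rightarrow> real"
      by (rule volume_preserving(2)[OF per_v div bspec[OF elim(4)] tT that])
    have lag: "lagrangian p t (\<lambda>y. U \<alpha> y \<omega>) (\<lambda>y. transformed_flow \<eta> \<alpha> g t y \<omega>) x = \<Phi> \<alpha> (g t x \<omega>)" for \<alpha> x
    proof -
      have "(\<lambda>x. g t x \<omega>) differentiable (at x)"
        using elim(4) tT by (simp add: C1_diffeomorphism_def)
      then have "det (jacobian (\<lambda>y. transformed_flow \<eta> \<alpha> g t y \<omega>) (at x)) = det (mat 1 + \<alpha> *\<^sub>R N (g t x \<omega>))"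
        unfolding transformed_flow_def N_def
        by (subst det_jacobian_transformed) (auto simp: vol1 C01_differentiable[OF C12_C01[OF \<eta>(1)] tT])
      moreover have "U \<alpha> x \<omega> = V (g t x \<omega>) + \<alpha> *\<^sub>R H (g t x \<omega>)"
        using elim(1) by (metis fst_conv snd_conv)
      ultimately show ?thesis by (simp add: lagrangian_def \<Phi>_def transformed_flow_def)
    qed
    have L\<Phi>: "(LINT x:torus_cell|lborel. lagrangian p t (\<lambda>y. U \<alpha> y \<omega>) (\<lambda>y. transformed_flow \<eta> \<alpha> g t y \<omega>) x)
        = (LINT x:torus_cell|lborel. \<Phi> \<alpha> x)" for \<alpha>
      unfolding lag by (rule vol2[OF c\<Phi> per\<Phi>])
    have KG: "(LINT x:torus_cell|lborel. K x \<omega>) = (LINT x:torus_cell|lborel. generator T \<nu> v G t x)"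
      using elim(2) vol2[OF cG] per_gen(2) tT by (simp add: periodic_def)
    have "((\<lambda>\<alpha>. LINT x:torus_cell|lborel. \<Phi> \<alpha> x) has_derivative (*) (LINT x:torus_cell|lborel. generator T \<nu> v G t x)) (at 0)"
      using elim(3) unfolding L\<Phi> KG by (simp add: has_field_derivative_def)
    from has_derivative_difference_quotient[OF this r(1,2), of 1]
    have "(\<lambda>n. ((LINT x:torus_cell|lborel. \<Phi> (r n) x) - (LINT x:torus_cell|lborel. \<Phi> 0 x)) / r n)
      \<longlonglongrightarrow> (LINT x:torus_cell|lborel. generator T \<nu> v G t x)"
      by (simp add: divide_inverse mult.commute)
    with lim1 show ?case by (rule LIMSEQ_unique)
  qed
  then have "(LINT x:torus_cell|lborel. V x \<bullet> H x + p t x * trace (N x)) = (LINT x:torus_cell|lborel. generator T \<nu> v G t x)"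
    by simp
  moreover have "trace (N x) = divergence (\<eta> t) x" for x
    by (simp add: N_def gradient_matrix_def trace_def divergence_def)
  ultimately show ?thesis by (simp add: V_def H_def)
qed

end

theorem mainTheorem2:
  fixes M :: "'w measure"
    and P :: "real \<Rightarrow> 'w measure"
    and W :: "real \<Rightarrow> 'w \<Rightarrow> real ^ 'd"
    and g :: "real \<Rightarrow> real ^ 'd \<Rightarrow> 'w \<Rightarrow> real ^ 'd"
    and v \<eta> :: "real \<Rightarrow> real ^ 'd \<Rightarrow> real ^ 'd"
    and p G :: "real \<Rightarrow> real ^ 'd \<Rightarrow> real"
    and \<nu> T :: real
  assumes "prob_space M" and "usual_filtration M P" and "wiener_process M P W"
    and "\<nu> > 0" and "T > 0"
    and "navier_stokes_solution T \<nu> v p"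
    and "stochastic_flow M P T \<nu> v W g"
    and "periodic T \<eta>" and "smooth_on ({0..T} \<times> UNIV) (\<lambda>(t, x). \<eta> t x)"
    and "\<And>x. \<eta> 0 x = 0" and "\<And>x. \<eta> T x = 0"
    and "lagrangian_invariant M P T g p \<eta> G"
  shows "\<forall>t\<in>{0..T}.
    (LINT x:torus_cell|lborel. generator T \<nu> v (\<lambda>s y. v s y \<bullet> \<eta> s y - G s y) t x) = 0"
proof -
  from assms(6) have v': "C12 T v" "periodic T v" by (auto simp: navier_stokes_solution_def)
  interpret stochastic_flow_setting M P T \<nu> v W g
    by (intro stochastic_flow_setting.intro stochastic_flow_setting_axioms.intro assms C12_C01 v')
  have \<eta>: "C12 T \<eta>" by (rule smooth_on_imp_C12[OF assms(9,5)])
  have G: "C12 T G" using assms(12) by (simp add: lagrangian_invariant_def)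
  have v\<eta>: "C12 T (\<lambda>s y. v s y \<bullet> \<eta> s y)"
    by (rule C12_bilinear[OF bounded_bilinear_inner v'(1) \<eta> assms(5)])
  have mG: "C12 T (\<lambda>s y. - G s y)"
    by (rule C12_linear[OF bounded_linear_minus[OF bounded_linear_ident] G assms(5)])
  have F: "C12 T (\<lambda>s y. v s y \<bullet> \<eta> s y - G s y)"
    using C12_add[OF v\<eta> mG assms(5)] by simp
  let ?I = "\<lambda>t. LINT x:torus_cell|lborel. generator T \<nu> v (\<lambda>s y. v s y \<bullet> \<eta> s y - G s y) t x"
  have zero: "?I t = 0" if t: "t \<in> {0..<T}" for t
  proof -
    have tT: "t \<in> {0..T}" using t by simp
    note i = set_integrable_torus_cell[OF continuous_on_slice[OF continuous_on_generator[OF v\<eta> C12_C01[OF v'(1)]] tT]]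
      set_integrable_torus_cell[OF continuous_on_slice[OF continuous_on_generator[OF G C12_C01[OF v'(1)]] tT]]
    have "?I t = (LINT x:torus_cell|lborel. generator T \<nu> v (\<lambda>s y. v s y \<bullet> \<eta> s y) t x) -
        (LINT x:torus_cell|lborel. generator T \<nu> v G t x)"
      using generator_add[OF v\<eta> mG assms(5) tT] generator_linear[OF bounded_linear_minus[OF bounded_linear_ident] G assms(5) tT]
        set_integral_diff(2)[OF i] by simp
    also have "\<dots> = 0"
      unfolding integral_generator_inner[OF assms(6) \<eta> assms(8,5) tT]
      using noether_identity[OF assms(6) \<eta> assms(8,12)] t by simp
    finally show ?thesis .
  qed
  \<comment> \<open>The invariance says nothing about \<open>t = T\<close>; this time is reached by continuity.\<close>
  have "continuous_on {0..T} ?I"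
    by (intro continuous_on_integral_torus_cell continuous_on_generator F C12_C01 v')
  then have "continuous_on (closure {0..<T}) ?I" using assms(5) by simp
  from continuous_constant_on_closure[OF this zero] show ?thesis
    using assms(5) by simp
qed

end
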